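(* Assume $H$ is twice continuously differentiable in a neighborhood of $\beta^*$, and let $\mathcal H=\nabla^2H(\beta^* )$. Define $h:\mathbb R^n\to\mathbb R^n$ by $$h(\xi)=\operatorname*{argmin}\Big\{\|h+\mathcal H^{-1}\xi\|_{\mathcal H}^2\;:\; h\in\mathbb R^n,\ h_i=0\ \text{for } i\in I_{=>},\ h_i\le 0\ \text{for } i\in I_{==}\Big\},\qquad \|a\|_{\mathcal H}^2=a^{\top}\mathcal H a .$$ Then, as $t\to\infty$, $\sqrt t(\beta^\gamma-\beta^* )$ converges in distribution to $h(G)$, where $G\sim\mathcal N\big(0,\operatorname{Cov}[\nabla F(\cdot,\beta^* )]\big)$.
   Context: Setting. There are $n$ buyers with budgets $b_i>0$, a measurable item space $\Theta$ with integrating measure $d\theta$, nonnegative integrable valuations $v_i:\Theta\to[0,\infty)$ with $\max_i\sup_\theta v_i(\theta)<\infty$, and a bounded supply function $s\ge 0$ with $\int_\Theta s\,d\theta=1$. Write $\mathbb E[g]=\int g\,s\,d\theta$ (and $\operatorname{Cov}$ accordingly). Let $\theta^1,\theta^2,\dots$ be i.i.d. draws from the density $s$ and $P_tf=\frac1t\sum_{\tau=1}^tf(\theta^\tau)$. For $\beta\in(0,\infty)^n$ put $$F(\theta,\beta)=\max_{i}\beta_iv_i(\theta)-\sum_{i=1}^nb_i\log\beta_i,\quad H(\beta)=\mathbb E[F(\cdot,\beta)],\quad H_t(\beta)=P_tF(\cdot,\beta).$$ The limit FPPE (first-price pacing equilibrium) pacing multiplier is $\beta^*=\operatorname{argmin}_{(0,1]^n}H$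 and the finite (observed) FPPE pacing multiplier is $\beta^\gamma=\operatorname{argmin}_{(0,1]^n}H_t$. Under twice continuous differentiability of $H$ near $\beta^*$, $\mathcal H$ is positive definite and $\nabla F(\theta,\beta^* )$ (gradient in $\beta$) exists for almost every $\theta$ (w.r.t. $s$). The leftover budgets are $\delta^*=-\nabla H(\beta^* )$ (equivalently, $\delta_i^*$ is $b_i$ minus buyer $i$'s equilibrium payment), so $\delta_i^*\ge0$ and $\delta_i^*=0$ when $\beta_i^*<1$. Buyer sets: $I_{=>}=\{i:\beta_i^*=1,\delta_i^*>0\}$ and $I_{==}=\{i:\beta_i^*=1,\delta_i^*=0\}$. *)

theory Defs
  imports "HOL-Probability.Probability"
begin

text \<open>\<open>grad\<close> and \<open>hessian\<close> are meaningful only at points of (twice) differentiability;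
  elsewhere \<open>grad\<close> is an unspecified constant.\<close>

definition grad :: "(real^'n::finite \<Rightarrow> real) \<Rightarrow> real^'n \<Rightarrow> real^'n" where
  "grad f x = (THE D. GDERIV f x :> D)"

definition hessian :: "(real^'n::finite \<Rightarrow> real) \<Rightarrow> real^'n \<Rightarrow> real^'n^'n" where
  "hessian f x = matrix (frechet_derivative (grad f) (at x))"

definition C2_on :: "(real^'n::finite \<Rightarrow> real) \<Rightarrow> (real^'n) set \<Rightarrow> bool" where
  "C2_on f U \<longleftrightarrow> open U \<and>
     (\<exists>g A. (\<forall>x\<in>U. GDERIV f x :> g x \<and> (g has_derivative (\<lambda>h. A x *v h)) (at x)) \<and>
            continuous_on U A)"

definition sq_norm :: "real^'n^'n \<Rightarrow> real^'n::finite \<Rightarrow> real" where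
  "sq_norm A a = a \<bullet> (A *v a)"

text \<open>The normal law with variance 0 is the point mass at the mean, so that
  singular covariance matrices are allowed.\<close>

definition normal_law :: "real \<Rightarrow> real \<Rightarrow> real measure" where
  "normal_law m var =
     (if var = 0 then return borel m else density lborel (normal_density m (sqrt var)))"

definition normal_vector ::
  "'g measure \<Rightarrow> ('g \<Rightarrow> real^'n::finite) \<Rightarrow> real^'n \<Rightarrow> real^'n^'n \<Rightarrow> bool" where
  "normal_vector Q G m S \<longleftrightarrow> prob_space Q \<and> G \<in> borel_measurable Q \<and>
     (\<forall>a. distr Q borel (\<lambda>\<omega>. a \<bullet> G \<omega>) = normal_law (a \<bullet> m) (a \<bullet> (S *v a)))"

text \<open>Measurability is part of the definition because the Bochner integral of a
  non-measurable function is 0 by convention.\<close>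

definition conv_in_distribution ::
  "'w measure \<Rightarrow> (nat \<Rightarrow> 'w \<Rightarrow> 'b::topological_space) \<Rightarrow> 'g measure \<Rightarrow> ('g \<Rightarrow> 'b) \<Rightarrow> bool" where
  "conv_in_distribution P X Q Y \<longleftrightarrow>
     (\<forall>t. X t \<in> borel_measurable P) \<and> Y \<in> borel_measurable Q \<and>
     (\<forall>f::'b \<Rightarrow> real. continuous_on UNIV f \<and> bounded (range f) \<longrightarrow>
        (\<lambda>t. \<integral>\<omega>. f (X t \<omega>) \<partial>P) \<longlonglongrightarrow> (\<integral>\<omega>. f (Y \<omega>) \<partial>Q))"

definition supply_E :: "'a measure \<Rightarrow> ('a \<Rightarrow> real) \<Rightarrow> ('a \<Rightarrow> real) \<Rightarrow> real" where
  "supply_E M s g = (\<integral>\<theta>. g \<theta> * s \<theta> \<partial>M)"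

definition supply_Cov :: "'a measure \<Rightarrow> ('a \<Rightarrow> real) \<Rightarrow> ('a \<Rightarrow> real^'n::finite) \<Rightarrow> real^'n^'n" where
  "supply_Cov M s g = (\<chi> i j. supply_E M s (\<lambda>\<theta>.
     (g \<theta> $ i - supply_E M s (\<lambda>\<theta>'. g \<theta>' $ i)) * (g \<theta> $ j - supply_E M s (\<lambda>\<theta>'. g \<theta>' $ j))))"

text \<open>The objectives below are intended only for \<open>\<beta>\<close> with positive components. The finite
  objective \<open>sample_H\<close> is indexed from \<open>t = 1\<close>; at \<open>t = 0\<close> it is constantly 0.\<close>

definition pacing_F ::
  "('n::finite \<Rightarrow> real) \<Rightarrow> ('n \<Rightarrow> 'a \<Rightarrow> real) \<Rightarrow> 'a \<Rightarrow> real^'n \<Rightarrow> real" where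
  "pacing_F b v \<theta> \<beta> = (MAX i. \<beta> $ i * v i \<theta>) - (\<Sum>i\<in>UNIV. b i * ln (\<beta> $ i))"

definition pacing_H ::
  "'a measure \<Rightarrow> ('a \<Rightarrow> real) \<Rightarrow> ('n::finite \<Rightarrow> real) \<Rightarrow> ('n \<Rightarrow> 'a \<Rightarrow> real) \<Rightarrow> real^'n \<Rightarrow> real" where
  "pacing_H M s b v \<beta> = supply_E M s (\<lambda>\<theta>. pacing_F b v \<theta> \<beta>)"

definition sample_H ::
  "('n::finite \<Rightarrow> real) \<Rightarrow> ('n \<Rightarrow> 'a \<Rightarrow> real) \<Rightarrow> (nat \<Rightarrow> 'a) \<Rightarrow> nat \<Rightarrow> real^'n \<Rightarrow> real" where
  "sample_H b v \<theta> t \<beta> = 1 / real t * (\<Sum>\<tau>=1..t. pacing_F b v (\<theta> \<tau>) \<beta>)"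

definition pacing_box :: "(real^'n::finite) set" where
  "pacing_box = {\<beta>. \<forall>i. 0 < \<beta> $ i \<and> \<beta> $ i \<le> 1}"

definition beta_star ::
  "'a measure \<Rightarrow> ('a \<Rightarrow> real) \<Rightarrow> ('n::finite \<Rightarrow> real) \<Rightarrow> ('n \<Rightarrow> 'a \<Rightarrow> real) \<Rightarrow> real^'n" where
  "beta_star M s b v = arg_min_on (pacing_H M s b v) pacing_box"

definition beta_sample ::
  "('n::finite \<Rightarrow> real) \<Rightarrow> ('n \<Rightarrow> 'a \<Rightarrow> real) \<Rightarrow> (nat \<Rightarrow> 'a) \<Rightarrow> nat \<Rightarrow> real^'n" where
  "beta_sample b v \<theta> t = arg_min_on (sample_H b v \<theta> t) pacing_box"

definition leftover ::
  "'a measure \<Rightarrow> ('a \<Rightarrow> real) \<Rightarrow> ('n::finite \<Rightarrow> real) \<Rightarrow> ('n \<Rightarrow> 'a \<Rightarrow> real) \<Rightarrow> real^'n" where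
  "leftover M s b v = - grad (pacing_H M s b v) (beta_star M s b v)"

text \<open>Unpaced buyers with positive leftover budget, and with zero leftover budget.\<close>

definition I_pos ::
  "'a measure \<Rightarrow> ('a \<Rightarrow> real) \<Rightarrow> ('n::finite \<Rightarrow> real) \<Rightarrow> ('n \<Rightarrow> 'a \<Rightarrow> real) \<Rightarrow> 'n set" where
  "I_pos M s b v = {i. beta_star M s b v $ i = 1 \<and> leftover M s b v $ i > 0}"

definition I_zero ::
  "'a measure \<Rightarrow> ('a \<Rightarrow> real) \<Rightarrow> ('n::finite \<Rightarrow> real) \<Rightarrow> ('n \<Rightarrow> 'a \<Rightarrow> real) \<Rightarrow> 'n set" where
  "I_zero M s b v = {i. beta_star M s b v $ i = 1 \<and> leftover M s b v $ i = 0}"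

definition limit_hessian ::
  "'a measure \<Rightarrow> ('a \<Rightarrow> real) \<Rightarrow> ('n::finite \<Rightarrow> real) \<Rightarrow> ('n \<Rightarrow> 'a \<Rightarrow> real) \<Rightarrow> real^'n^'n" where
  "limit_hessian M s b v = hessian (pacing_H M s b v) (beta_star M s b v)"

definition limit_map ::
  "'a measure \<Rightarrow> ('a \<Rightarrow> real) \<Rightarrow> ('n::finite \<Rightarrow> real) \<Rightarrow> ('n \<Rightarrow> 'a \<Rightarrow> real) \<Rightarrow> real^'n \<Rightarrow> real^'n" where
  "limit_map M s b v \<xi> =
     arg_min_on
       (\<lambda>h. sq_norm (limit_hessian M s b v) (h + matrix_inv (limit_hessian M s b v) *v \<xi>))
       {h. (\<forall>i\<in>I_pos M s b v. h $ i = 0) \<and> (\<forall>i\<in>I_zero M s b v. h $ i \<le> 0)}"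

end

theory Submission
  imports Defs
begin

text \<open>The pacing multiplier of the observed market is a convex M-estimator with box constraints. Its
  asymptotic law is found by rescaling the objective. Let \<open>W\<^sub>t\<close> be the normalized sum of the centred gradients
  \<open>\<nabla>F(\<theta>\<^sup>\<tau>, \<beta>\<^sup>*)\<close>. The function \<open>Z\<^sub>t(h) = t (H\<^sub>t(\<beta>\<^sup>* + h / \<surd>t) - H\<^sub>t(\<beta>\<^sup>*))\<close> is convex, the
  scaled error minimizes it over the rescaled box, and
  \<open>Z\<^sub>t(h) = W\<^sub>t \<bullet> h - \<surd>t (\<delta>\<^sup>* \<bullet> h) + R\<^sub>t(h)\<close>,
  where \<open>R\<^sub>t\<close> collects the first-order Taylor remainders of the single items (\<open>local_objective_expansion\<close>).

  The mean of \<open>R\<^sub>t(h)\<close> tends to half the Hessian form of \<open>h\<close> because \<open>H\<close> is twice differentiable; its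
  variance tends to 0 because the remainder of almost every item is of smaller order than its argument
  (\<open>sample_remainder_limit\<close>). For this, almost every item must be differentiable at \<open>\<beta>\<^sup>*\<close>, which follows from
  differentiability of the mean: a tie between buyers is a kink, and kinks of positive total mass would remain visible
  in \<open>H\<close> (\<open>AE_clear_winner\<close>). Since \<open>R\<^sub>t\<close> is convex, pointwise convergence in probability is uniform on compact
  sets (\<open>convex_uniformly_close\<close>).

  The penalty \<open>- \<surd>t (\<delta>\<^sup>* \<bullet> h)\<close> is nonnegative on the rescaled box and grows with \<open>t\<close>; in the limit it forces
  the coordinates of unpaced buyers with leftover budget to 0, while the box leaves the constraint \<open>h\<^sub>i \<le> 0\<close> for
  the other unpaced buyers and no constraint for paced ones. Strong convexity of the limiting quadratic program
  shows that the scaled error differs from its minimizer \<open>h(W\<^sub>t)\<close> by a quantity tending to 0 in probability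
  (\<open>constrained_argmin_stability\<close>, \<open>scaled_error_close_to_quadratic_min\<close>). The Hessian is positive definite
  because of the logarithmic term. Finally \<open>W\<^sub>t\<close> converges in distribution to \<open>G\<close>, by the central limit theorem
  in each direction and \<open>conv_in_distribution_char\<close>, and \<open>h\<close> is Lipschitz continuous, so
  \<open>conv_in_distribution_transfer\<close> concludes. Measurability of the multiplier of the observed market is a separate
  matter, settled by \<open>measurable_well_posed_argmin\<close>.\<close>

section \<open>Convex functions and quadratic programs\<close>

text \<open>Pointwise closeness of convex functions to a continuous function is automatically uniform on
  compact sets, and finitely many test points decide it. Cover the ball by small cubes: on a cube a convex
  function is at most its largest value at the corners, which gives the upper bound; the lower bound at
  \<open>h\<close> follows from convexity on the segment from \<open>h\<close> through a nearby centre to the mirror image of \<open>h\<close>.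
  Finiteness of \<open>D\<close> is what turns convergence in probability at each point into uniform convergence
  in probability.\<close>

lemma convex_uniformly_close:
  fixes q :: "'b::euclidean_space \<Rightarrow> real"
  assumes q: "continuous_on (cball 0 (K + 2)) q" and e: "e > 0"
  shows "\<exists>D e'. finite D \<and> e' > 0 \<and> (\<forall>T h. convex_on (cball 0 (K + 2)) T \<and> (\<forall>d\<in>D. \<bar>T d - q d\<bar> \<le> e') \<and> norm h \<le> K
      \<longrightarrow> \<bar>T h - q h\<bar> \<le> e)"
proof -
  have "uniformly_continuous_on (cball 0 (K + 2)) q"
    using q by (intro compact_uniformly_continuous) auto
  then obtain \<delta>0 where "\<delta>0 > 0"
    and \<delta>0: "\<And>x y. norm x \<le> K + 2 \<Longrightarrow> norm y \<le> K + 2 \<Longrightarrow> dist y x < \<delta>0 \<Longrightarrow> \<bar>q y - q x\<bar> < e / 8"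
    using e unfolding uniformly_continuous_on_def
    by (metis dist_real_def mem_cball_0 zero_less_divide_iff zero_less_numeral)
  define \<delta> where "\<delta> = min 1 \<delta>0"
  have \<delta>: "\<delta> > 0" "\<delta> \<le> 1" "\<delta> \<le> \<delta>0" using \<open>\<delta>0 > 0\<close> by (auto simp: \<delta>_def)
  have near: "\<bar>q y - q x\<bar> \<le> e / 8" if "norm x \<le> K + 2" "norm y \<le> K + 2" "norm (y - x) < \<delta>" for x y
    using \<delta>0[of x y] that \<delta> by (auto simp: dist_norm)
  define r where "r = \<delta> / (4 * DIM('b))"
  have r: "r > 0" "DIM('b) * r = \<delta> / 4" using \<delta> by (auto simp: r_def)
  define cube where "cube x = cbox (x - (\<Sum>i\<in>Basis. r *\<^sub>R i)) (x + (\<Sum>i\<in>Basis. r *\<^sub>R i))" for x :: 'b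
  have cube: "norm (y - x) \<le> \<delta> / 4" if "y \<in> cube x" for x y
  proof -
    have "norm (y - x) \<le> (\<Sum>i\<in>Basis. \<bar>(y - x) \<bullet> i\<bar>)" by (rule norm_le_l1)
    also have "\<dots> \<le> (\<Sum>i\<in>(Basis::'b set). r)"
      using that by (intro sum_mono) (auto simp: cube_def mem_box inner_simps abs_le_iff algebra_simps)
    finally show ?thesis using r by simp
  qed
  have "\<forall>x. \<exists>S. finite S \<and> cube x = convex hull S"
    unfolding cube_def using cube_convex_hull[OF r(1)] by metis
  then obtain S where S: "\<And>x. finite (S x)" "\<And>x. cube x = convex hull (S x)" by metis
  have "\<exists>X. finite X \<and> X \<subseteq> cball 0 (K + 1) \<and> cball (0::'b) (K + 1) \<subseteq> (\<Union>x\<in>X. ball x r)"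
    using compactE_image[OF compact_cball[of "0::'b" "K + 1"], of "cball 0 (K + 1)" "\<lambda>x. ball x r"] r
    by (metis UN_I centre_in_ball open_ball subsetI)
  then obtain X where X: "finite X" "X \<subseteq> cball 0 (K + 1)" "cball (0::'b) (K + 1) \<subseteq> (\<Union>x\<in>X. ball x r)"
    by blast
  have cover: "\<exists>x\<in>X. h \<in> cube x" if h: "norm h \<le> K + 1" for h
  proof -
    obtain x where x: "x \<in> X" "dist x h < r" using X(3) h by force
    have "\<bar>(h - x) \<bullet> i\<bar> \<le> r" if "i \<in> Basis" for i
      using Basis_le_norm[OF that, of "h - x"] x(2) by (simp add: dist_norm norm_minus_commute)
    then have "h \<in> cube x"
      unfolding cube_def mem_box by (auto simp: inner_simps abs_le_iff algebra_simps)
    then show ?thesis using x by blast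
  qed
  have S_sub: "S x \<subseteq> cube x" for x using S(2) hull_subset by metis
  have cube_sub: "cube x \<subseteq> cball 0 (K + 2)" if "x \<in> X" for x
  proof
    fix y assume "y \<in> cube x"
    then show "y \<in> cball 0 (K + 2)"
      using cube[of y x] X(2) that \<delta> norm_triangle_sub[of y x] by force
  qed
  define D where "D = X \<union> (\<Union>x\<in>X. S x)"
  show ?thesis
  proof (intro exI[of _ D] exI[of _ "e / 8"] conjI allI impI)
    show "finite D" using X S by (auto simp: D_def)
    show "e / 8 > 0" using e by simp
    fix T :: "'b \<Rightarrow> real" and h :: 'b
    assume "convex_on (cball 0 (K + 2)) T \<and> (\<forall>d\<in>D. \<bar>T d - q d\<bar> \<le> e / 8) \<and> norm h \<le> K"
    then have T: "convex_on (cball 0 (K + 2)) T" and TD: "\<And>d. d \<in> D \<Longrightarrow> \<bar>T d - q d\<bar> \<le> e / 8"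
      and h: "norm h \<le> K" by auto
    have upper: "T y \<le> q y + 3 * e / 8" if y: "norm y \<le> K + 1" for y
    proof -
      obtain x where x: "x \<in> X" "y \<in> cube x" using cover[OF y] by blast
      have "T s \<le> q x + e / 4" if "s \<in> S x" for s
      proof -
        have "s \<in> cube x" using S_sub that by blast
        moreover have "norm x \<le> K + 2" using X x by force
        ultimately have "\<bar>q s - q x\<bar> \<le> e / 8" using near[of x s] cube[of s x] cube_sub[OF x(1)] \<delta> by force
        moreover have "\<bar>T s - q s\<bar> \<le> e / 8" using TD that x by (auto simp: D_def)
        ultimately show ?thesis by linarith
      qed
      then have "\<forall>z\<in>convex hull (S x). T z \<le> q x + e / 4"
        using T cube_sub[OF x(1)] unfolding S(2)
        by (intro convex_on_convex_hull_bound) (auto intro: convex_on_subset)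
      then have "T y \<le> q x + e / 4" using x S by blast
      moreover have "\<bar>q y - q x\<bar> \<le> e / 8"
        using near[of x y] cube[OF x(2)] X(2) x y \<delta> by force
      ultimately show ?thesis by linarith
    qed
    obtain x where x: "x \<in> X" "h \<in> cube x" using cover[of h] h by auto
    \<comment> \<open>The upper bound at the mirror image of \<open>h\<close> in \<open>x\<close> turns into a lower bound at \<open>h\<close>.\<close>
    define h' where "h' = 2 *\<^sub>R x - h"
    have hx: "norm (h - x) \<le> \<delta> / 4" using cube[OF x(2)] .
    have h'h: "norm (h' - h) \<le> \<delta> / 2"
    proof -
      have "h' - h = 2 *\<^sub>R (x - h)" by (simp add: h'_def algebra_simps scaleR_2)
      then show ?thesis using hx by (simp add: norm_minus_commute)
    qed
    have h'K: "norm h' \<le> K + 1" using h'h h \<delta> norm_triangle_sub[of h' h] by linarith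
    have xK: "norm x \<le> K + 1" using X x by auto
    have "T ((1 - 1/2) *\<^sub>R h + (1/2) *\<^sub>R h') \<le> (1 - 1/2) * T h + (1/2) * T h'"
      using T h h'K by (intro convex_onD) auto
    moreover have "(1 - 1/2) *\<^sub>R h + (1/2) *\<^sub>R h' = x"
      by (simp add: h'_def scaleR_diff_right)
    ultimately have "T x \<le> T h / 2 + T h' / 2" by simp
    moreover have "\<bar>T x - q x\<bar> \<le> e / 8" using TD x by (auto simp: D_def)
    moreover have "T h' \<le> q h' + 3 * e / 8" using upper[OF h'K] .
    moreover have "\<bar>q h' - q h\<bar> \<le> e / 8" using near[of h h'] h'h h h'K \<delta> by auto
    moreover have "\<bar>q h - q x\<bar> \<le> e / 8" using near[of x h] hx h xK \<delta> by auto
    moreover have "T h \<le> q h + 3 * e / 8" using upper[of h] h by simp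
    ultimately show "\<bar>T h - q h\<bar> \<le> e" using e by linarith
  qed
qed

definition quad_form :: "real^'n^'n \<Rightarrow> real^'n::finite \<Rightarrow> real^'n \<Rightarrow> real" where
  "quad_form A w h = w \<bullet> h + (h \<bullet> (A *v h)) / 2"

definition is_min_on :: "('b \<Rightarrow> real) \<Rightarrow> 'b set \<Rightarrow> 'b \<Rightarrow> bool" where
  "is_min_on f S x \<longleftrightarrow> x \<in> S \<and> (\<forall>y\<in>S. f x \<le> f y)"

lemma is_min_on_arg_min_on:
  assumes "is_min_on f S x" shows "is_min_on f S (arg_min_on f S)"
proof -
  have "is_arg_min f (\<lambda>x. x \<in> S) x" using assms by (auto simp: is_min_on_def is_arg_min_def not_less)
  then have "is_arg_min f (\<lambda>x. x \<in> S) (arg_min_on f S)"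
    unfolding arg_min_on_def arg_min_def by (rule someI)
  then show ?thesis by (auto simp: is_min_on_def is_arg_min_def not_less)
qed

lemma continuous_matrix_vector_mult [continuous_intros]:
  fixes A :: "real^'n^'m"
  shows "continuous_on S f \<Longrightarrow> continuous_on S (\<lambda>x. A *v f x)"
  by (rule continuous_on_compose2[OF linear_continuous_on[OF matrix_vector_mul_bounded_linear]]) auto

text \<open>The coercivity constant \<open>c\<close> is a parameter because it controls both the strong convexity of the
  quadratic program and the Lipschitz constant of its solution map.\<close>

locale pos_def_matrix =
  fixes A :: "real^'n::finite^'n" and c :: real
  assumes symmetric: "x \<bullet> (A *v y) = y \<bullet> (A *v x)"
    and c_pos: "c > 0" and coercive: "c * (norm h)\<^sup>2 \<le> h \<bullet> (A *v h)"
begin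

lemma quad_form_expand:
  "quad_form A w (x + d) = quad_form A w x + (w + A *v x) \<bullet> d + (d \<bullet> (A *v d)) / 2"
  using symmetric[of x d]
  by (simp add: quad_form_def inner_add_left inner_add_right matrix_vector_right_distrib
      inner_commute field_simps)

lemma quad_form_lower: "c / 2 * (norm h)\<^sup>2 - norm w * norm h \<le> quad_form A w h"
  using coercive[of h] Cauchy_Schwarz_ineq2[of w h] by (simp add: quad_form_def abs_le_iff)

text \<open>First-order optimality along the segment from \<open>x\<close> to \<open>y\<close> makes the linear term of the expansion at
  \<open>x\<close> nonnegative, so the quadratic term is left over as growth.\<close>

lemma quad_form_growth:
  assumes S: "convex S" and x: "is_min_on (quad_form A w) S x" and y: "y \<in> S"
  shows "quad_form A w x + c / 2 * (norm (y - x))\<^sup>2 \<le> quad_form A w y"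
proof -
  define d where "d = y - x"
  define l where "l = (w + A *v x) \<bullet> d"
  have "l \<ge> 0"
  proof (rule ccontr)
    assume "\<not> l \<ge> 0"
    define B where "B = d \<bullet> (A *v d)"
    have B: "B \<ge> 0" using coercive[of d] c_pos by (auto simp: B_def intro: order_trans[rotated])
    define s where "s = min 1 (- l / (B + 1))"
    have s: "s > 0" "s \<le> 1" using \<open>\<not> l \<ge> 0\<close> B by (auto simp: s_def divide_simps)
    have "s * (B + 1) \<le> (- l / (B + 1)) * (B + 1)" using B unfolding s_def by (intro mult_right_mono) auto
    also have "\<dots> = - l" using B by simp
    finally have "s * (B + 1) \<le> - l" .
    then have "s * B / 2 < - l" using s mult_nonneg_nonneg[of s B] B distrib_left[of s B 1] by linarith
    then have "s * (l + s * B / 2) < 0" using s by (intro mult_pos_neg) auto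
    moreover have "x + s *\<^sub>R d \<in> S"
      using convexD[OF S, of x y "1 - s" s] s x y by (simp add: d_def is_min_on_def algebra_simps)
    then have "quad_form A w x \<le> quad_form A w (x + s *\<^sub>R d)" using x by (simp add: is_min_on_def)
    then have "0 \<le> s * l + s * s * B / 2"
      unfolding quad_form_expand by (simp add: l_def B_def matrix_vector_mult_scaleR)
    ultimately show False by (simp add: algebra_simps)
  qed
  then show ?thesis
    using quad_form_expand[of w x d] coercive[of d] by (simp add: l_def[symmetric]) (simp add: d_def)
qed

lemma quad_form_min_exists:
  assumes "closed S" "S \<noteq> {}"
  shows "\<exists>x. is_min_on (quad_form A w) S x"
proof -
  obtain y where y: "y \<in> S" using assms by blast
  define R where "R = max (norm y) (2 * (norm w + \<bar>quad_form A w y\<bar> + 1) / c + 1)"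
  have cont: "continuous_on X (quad_form A w)" for X
    unfolding quad_form_def[abs_def] by (intro continuous_intros) auto
  have "compact (S \<inter> cball 0 R)" using assms by (simp add: closed_Int_compact)
  moreover have yR: "y \<in> S \<inter> cball 0 R" using y by (simp add: R_def)
  ultimately obtain x where x: "x \<in> S \<inter> cball 0 R" "\<And>z. z \<in> S \<inter> cball 0 R \<Longrightarrow> quad_form A w x \<le> quad_form A w z"
    using continuous_attains_inf[OF _ _ cont, of "S \<inter> cball 0 R"] by blast
  have "quad_form A w x \<le> quad_form A w z" if "z \<in> S" for z
  proof (cases "norm z \<le> R")
    case True
    then show ?thesis using x that by auto
  next
    case False
    then have z: "norm z > 2 * (norm w + \<bar>quad_form A w y\<bar> + 1) / c + 1" by (simp add: R_def)
    moreover have "2 * (norm w + \<bar>quad_form A w y\<bar> + 1) / c \<ge> 0" using c_pos by simp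
    ultimately have z1: "norm z > 1" "norm z > 2 * (norm w + \<bar>quad_form A w y\<bar> + 1) / c" by linarith+
    then have "c / 2 * norm z - norm w > \<bar>quad_form A w y\<bar>" using c_pos by (simp add: field_simps)
    then have "\<bar>quad_form A w y\<bar> * 1 \<le> (c / 2 * norm z - norm w) * norm z"
      using z1 by (intro mult_mono) auto
    also have "\<dots> \<le> quad_form A w z" using quad_form_lower[of z w] by (simp add: power2_eq_square algebra_simps)
    finally have "quad_form A w y \<le> quad_form A w z" by linarith
    then show ?thesis using x(2)[OF yR] by linarith
  qed
  then show ?thesis using x(1) by (auto simp: is_min_on_def)
qed

text \<open>Adding the growth inequalities of the two minimizers cancels everything except the
  difference of the linear terms. The map from the linear term to the minimizer is therefore single-valued and
  continuous, so that it can be applied to a weakly convergent sequence.\<close>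

lemma quad_form_min_lipschitz:
  assumes S: "convex S" and x: "is_min_on (quad_form A w) S x" and x': "is_min_on (quad_form A w') S x'"
  shows "norm (x - x') \<le> norm (w - w') / c"
proof -
  have "quad_form A w x + c / 2 * (norm (x' - x))\<^sup>2 \<le> quad_form A w x'"
    "quad_form A w' x' + c / 2 * (norm (x - x'))\<^sup>2 \<le> quad_form A w' x"
    using quad_form_growth[OF S x] quad_form_growth[OF S x'] x x' by (auto simp: is_min_on_def)
  then have "c * (norm (x - x'))\<^sup>2 \<le> (w - w') \<bullet> (x' - x)"
    by (simp add: quad_form_def inner_diff_left inner_diff_right norm_minus_commute algebra_simps)
  also have "\<dots> \<le> norm (w - w') * norm (x - x')"
    using norm_cauchy_schwarz[of "w - w'" "x' - x"] by (simp add: norm_minus_commute)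
  finally have "c * norm (x - x') * norm (x - x') \<le> norm (w - w') * norm (x - x')"
    by (simp add: power2_eq_square mult_ac)
  then have "c * norm (x - x') \<le> norm (w - w')"
    by (cases "x = x'") (auto simp: mult_le_cancel_right)
  then show ?thesis using c_pos by (simp add: field_simps)
qed

text \<open>The deterministic core of the theorem. \<open>Z\<close> is the rescaled objective, \<open>S\<close> the rescaled
  box and \<open>r\<close> the square root of the sample size. If the minimizer \<open>x\<close> of \<open>Z\<close> were far from \<open>x0\<close>, convexity
  would produce a point \<open>h\<close> at distance exactly \<open>\<eta>\<close> from \<open>x0\<close> with \<open>Z h \<le> Z x0\<close>, and there \<open>Z\<close> is close to the
  quadratic form plus the penalty \<open>- r * (\<delta> \<bullet> h)\<close>. The penalty is nonnegative on \<open>S\<close> and for large \<open>r\<close> outweighs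
  the price of replacing the coordinates of \<open>h\<close> in \<open>I\<close> by zero; the point so obtained lies in \<open>C\<close>, where strong
  convexity keeps it near \<open>x0\<close>.\<close>

lemma constrained_argmin_stability:
  fixes I J :: "'n set" and \<delta> :: "real^'n"
  defines "C \<equiv> {h::real^'n. (\<forall>i\<in>I. h $ i = 0) \<and> (\<forall>i\<in>J. h $ i \<le> 0)}"
  assumes \<delta>_I: "\<And>i. i \<in> I \<Longrightarrow> \<delta> $ i > 0" and \<delta>_0: "\<And>i. i \<notin> I \<Longrightarrow> \<delta> $ i = 0"
    and K: "K \<ge> 0" and \<eta>: "\<eta> > 0"
  shows "\<exists>e>0. \<exists>\<rho> r0. \<forall>r w Z S x x0.
    r \<ge> r0 \<and> norm w \<le> K \<and> convex S \<and> (\<forall>h\<in>S. \<forall>i\<in>I \<union> J. h $ i \<le> 0) \<and> C \<inter> cball 0 \<rho> \<subseteq> S \<and> convex_on S Z \<and>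
    (\<forall>h\<in>S. norm h \<le> \<rho> \<longrightarrow> \<bar>Z h - (quad_form A w h - r * (\<delta> \<bullet> h))\<bar> \<le> e) \<and>
    is_min_on Z S x \<and> is_min_on (quad_form A w) C x0 \<longrightarrow> norm (x - x0) \<le> \<eta>"
proof -
  define \<rho> where "\<rho> = 2 * K / c + \<eta>"
  have \<rho>: "\<rho> > 0" using K \<eta> c_pos by (simp add: \<rho>_def add_nonneg_pos)
  obtain a where a: "a > 0" "\<And>h. norm (A *v h) \<le> norm h * a"
    using bounded_linear.pos_bounded[OF matrix_vector_mul_bounded_linear[of A]] by blast
  define L where "L = K + \<rho> * a"
  define m where "m = Min (insert 1 ((\<lambda>i. \<delta> $ i) ` I))"
  have m: "m > 0" "\<And>i. i \<in> I \<Longrightarrow> m \<le> \<delta> $ i" using \<delta>_I by (auto simp: m_def)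
  \<comment> \<open>With this \<open>e\<close> both parts of the distance from \<open>x0\<close>, along and across the penalized coordinates,
      are at most \<open>\<eta> / 4\<close>.\<close>
  define e where "e = min (\<eta> / 8) (c * \<eta>\<^sup>2 / 64)"
  have e: "e > 0" "2 * e \<le> \<eta> / 4" "4 * e / c \<le> (\<eta> / 4)\<^sup>2"
    using \<eta> c_pos by (auto simp: e_def min_def field_simps power2_eq_square)
  show ?thesis
  proof (rule exI[of _ e], rule conjI, fact, rule exI[of _ \<rho>], rule exI[of _ "(L + 1) / m"], intro allI impI)
    fix r w Z S x x0
    assume "(L + 1) / m \<le> r \<and> norm w \<le> K \<and> convex S \<and> (\<forall>h\<in>S. \<forall>i\<in>I \<union> J. h $ i \<le> 0) \<and>
      C \<inter> cball 0 \<rho> \<subseteq> S \<and> convex_on S Z \<and>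
      (\<forall>h\<in>S. norm h \<le> \<rho> \<longrightarrow> \<bar>Z h - (quad_form A w h - r * (\<delta> \<bullet> h))\<bar> \<le> e) \<and>
      is_min_on Z S x \<and> is_min_on (quad_form A w) C x0"
    then have r: "r \<ge> (L + 1) / m" and w: "norm w \<le> K" and S: "convex S"
      and SIJ: "\<forall>h\<in>S. \<forall>i\<in>I \<union> J. h $ i \<le> 0"
      and CS: "C \<inter> cball 0 \<rho> \<subseteq> S" and Z: "convex_on S Z"
      and close: "\<And>h. h \<in> S \<Longrightarrow> norm h \<le> \<rho> \<Longrightarrow> \<bar>Z h - (quad_form A w h - r * (\<delta> \<bullet> h))\<bar> \<le> e"
      and x: "is_min_on Z S x" and x0: "is_min_on (quad_form A w) C x0"
      by simp_all
    have SI: "h $ i \<le> 0" if "h \<in> S" "i \<in> I" for h i using SIJ that by blast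
    have SJ: "h $ i \<le> 0" if "h \<in> S" "i \<in> J" for h i using SIJ that by blast
    have C: "convex C"
      unfolding C_def convex_def by (auto intro!: add_nonpos_nonpos mult_nonneg_nonpos)
    have x0C: "x0 \<in> C" using x0 by (simp add: is_min_on_def)
    have "quad_form A w x0 \<le> quad_form A w 0" using x0 by (simp add: is_min_on_def C_def)
    then have "c / 2 * (norm x0)\<^sup>2 \<le> norm w * norm x0"
      using quad_form_lower[of x0 w] by (simp add: quad_form_def)
    also have "\<dots> \<le> K * norm x0" using w by (simp add: mult_right_mono)
    finally have "norm x0 * (c / 2 * norm x0) \<le> norm x0 * K" by (simp add: power2_eq_square mult_ac)
    then have "norm x0 = 0 \<or> c / 2 * norm x0 \<le> K" by (cases "x0 = 0") (auto simp: mult_le_cancel_left_pos)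
    then have x0K: "norm x0 \<le> 2 * K / c" using K c_pos by (auto simp: field_simps)
    then have x0S: "x0 \<in> S" using CS x0C \<eta> by (auto simp: \<rho>_def)
    show "norm (x - x0) \<le> \<eta>"
    proof (rule ccontr)
      assume far: "\<not> norm (x - x0) \<le> \<eta>"
      define s where "s = \<eta> / norm (x - x0)"
      have "norm (x - x0) > \<eta>" using far by simp
      then have s: "0 < s" "s < 1" "s * norm (x - x0) = \<eta>"
        unfolding s_def using \<eta> by (auto intro!: divide_pos_pos simp del: zero_less_norm_iff)
      define h where "h = (1 - s) *\<^sub>R x0 + s *\<^sub>R x"
      have hx0: "norm (h - x0) = \<eta>"
      proof -
        have "h - x0 = s *\<^sub>R (x - x0)" by (simp add: h_def algebra_simps)
        then show ?thesis using s by simp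
      qed
      have xS: "x \<in> S" "Z x \<le> Z x0" using x x0S by (auto simp: is_min_on_def)
      have hS: "h \<in> S" unfolding h_def using S s x0S xS by (intro convexD) auto
      have "Z h \<le> (1 - s) * Z x0 + s * Z x"
        unfolding h_def using Z s x0S xS by (intro convex_onD) auto
      also have "\<dots> \<le> (1 - s) * Z x0 + s * Z x0" using s xS by (intro add_left_mono mult_left_mono) auto
      finally have Zh: "Z h \<le> Z x0" by (simp add: algebra_simps)
      have h\<rho>: "norm h \<le> \<rho>" using norm_triangle_sub[of h x0] hx0 x0K by (simp add: \<rho>_def)
      have "\<delta> \<bullet> x0 = 0" using x0C \<delta>_0 by (auto simp: inner_vec_def C_def intro!: sum.neutral)
      then have main: "quad_form A w h - r * (\<delta> \<bullet> h) \<le> quad_form A w x0 + 2 * e"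
        using close[OF hS h\<rho>] close[OF x0S] x0K \<eta> Zh by (simp add: \<rho>_def)
      \<comment> \<open>The competitor in \<open>C\<close> obtained by giving up the penalized coordinates.\<close>
      define g where "g = (\<chi> i. if i \<in> I then 0 else h $ i)"
      have gC: "g \<in> C" using SJ[OF hS] by (auto simp: C_def g_def)
      have g\<rho>: "norm g \<le> \<rho>"
    proof -
        have "norm g \<le> norm h" by (rule norm_le_componentwise_cart) (simp add: g_def)
        then show ?thesis using h\<rho> by simp
      qed
      have pen: "m * norm (h - g) \<le> - (\<delta> \<bullet> h)"
      proof -
        have "m * norm (h - g) \<le> m * (\<Sum>i\<in>UNIV. \<bar>(h - g) $ i\<bar>)"
          using norm_le_l1_cart[of "h - g"] m by (intro mult_left_mono) auto
        also have "\<dots> = (\<Sum>i\<in>UNIV. m * \<bar>(h - g) $ i\<bar>)" by (rule sum_distrib_left)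
        also have "\<dots> \<le> (\<Sum>i\<in>UNIV. - (\<delta> $ i * h $ i))"
        proof (rule sum_mono)
          fix i
          show "m * \<bar>(h - g) $ i\<bar> \<le> - (\<delta> $ i * h $ i)"
          proof (cases "i \<in> I")
            case True
            have "m * (- h $ i) \<le> \<delta> $ i * (- h $ i)"
              using SI[OF hS True] m(2)[OF True] by (intro mult_right_mono) auto
            then show ?thesis using True SI[OF hS True] by (simp add: g_def)
          qed (auto simp: g_def \<delta>_0)
        qed
        finally show ?thesis by (simp add: inner_vec_def sum_negf)
      qed
      have "L \<ge> 0" using K \<rho> a by (simp add: L_def)
      then have r0: "r \<ge> 0" using r m by (meson divide_nonneg_pos add_nonneg_nonneg order_trans zero_le_one)
      have "(L + 1) * norm (h - g) \<le> (r * m) * norm (h - g)"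
        using r m by (intro mult_right_mono) (auto simp: field_simps)
      also have "\<dots> \<le> r * - (\<delta> \<bullet> h)" using mult_left_mono[OF pen r0] by (simp add: mult_ac)
      finally have pen': "(L + 1) * norm (h - g) \<le> - (r * (\<delta> \<bullet> h))" by simp
      have "- ((w + A *v g) \<bullet> (h - g)) \<le> norm (w + A *v g) * norm (h - g)"
        using Cauchy_Schwarz_ineq2[of "w + A *v g" "h - g"] by (simp add: abs_le_iff)
      also have "\<dots> \<le> L * norm (h - g)"
      proof (rule mult_right_mono)
        have "norm (w + A *v g) \<le> norm w + norm g * a" using norm_triangle_ineq a(2)[of g] by (meson add_left_mono order_trans)
        also have "\<dots> \<le> L" unfolding L_def using w g\<rho> a(1) by (intro add_mono mult_right_mono) auto
        finally show "norm (w + A *v g) \<le> L" .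
      qed simp
      finally have lin: "- ((w + A *v g) \<bullet> (h - g)) \<le> L * norm (h - g)" .
      have nn: "0 \<le> (h - g) \<bullet> (A *v (h - g))"
        using coercive[of "h - g"] c_pos by (auto intro: order_trans[rotated])
      have "quad_form A w h = quad_form A w g + (w + A *v g) \<bullet> (h - g) + ((h - g) \<bullet> (A *v (h - g))) / 2"
        using quad_form_expand[of w g "h - g"] by simp
      then have "quad_form A w h \<ge> quad_form A w g - L * norm (h - g)" using lin nn by linarith
      moreover have "quad_form A w x0 + c / 2 * (norm (g - x0))\<^sup>2 \<le> quad_form A w g"
        using quad_form_growth[OF C x0 gC] .
      ultimately have fin: "norm (h - g) + c / 2 * (norm (g - x0))\<^sup>2 \<le> 2 * e"
        using main pen' by (simp add: algebra_simps)
      have 1: "norm (h - g) \<le> \<eta> / 4"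
        using fin e(2) c_pos by (smt (verit) divide_nonneg_nonneg mult_nonneg_nonneg zero_le_power2)
      have "c / 2 * (norm (g - x0))\<^sup>2 \<le> 2 * e" using fin norm_ge_zero[of "h - g"] by linarith
      then have "(norm (g - x0))\<^sup>2 \<le> 4 * e / c" using c_pos by (simp add: field_simps)
      then have "(norm (g - x0))\<^sup>2 \<le> (\<eta> / 4)\<^sup>2" using e(3) by linarith
      then have 2: "norm (g - x0) \<le> \<eta> / 4" using \<eta> by (simp add: power2_le_iff_abs_le)
      have "\<eta> \<le> norm (h - g) + norm (g - x0)"
        using norm_triangle_ineq[of "h - g" "g - x0"] hx0 by simp
      then show False using 1 2 \<eta> by linarith
    qed
  qed
qed

end

section \<open>Gradients, Hessians and second differences\<close>

lemma grad_eq: "GDERIV f x :> D \<Longrightarrow> grad f x = D"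
  unfolding grad_def
proof (rule the_equality)
  fix D' assume "GDERIV f x :> D" "GDERIV f x :> D'"
  then have "(\<lambda>h. h \<bullet> D) = (\<lambda>h. h \<bullet> D')" unfolding gderiv_def by (rule has_derivative_unique)
  then show "D' = D" by (metis vector_eq_ldot)
qed

lemma GDERIV_has_derivative_line:
  assumes "GDERIV f (x + s *\<^sub>R h) :> D"
  shows "((\<lambda>s. f (x + s *\<^sub>R h)) has_real_derivative (D \<bullet> h)) (at s)"
proof -
  have "((\<lambda>s. x + s *\<^sub>R h) has_derivative (\<lambda>s. s *\<^sub>R h)) (at s)"
    by (auto intro!: derivative_eq_intros)
  then have "((\<lambda>s. f (x + s *\<^sub>R h)) has_derivative (\<lambda>s. (s *\<^sub>R h) \<bullet> D)) (at s)"
    using assms unfolding gderiv_def by (rule has_derivative_compose)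
  then show ?thesis
    unfolding has_field_derivative_def
    by (rule has_derivative_eq_rhs) (auto simp: fun_eq_iff inner_commute)
qed

lemma GDERIV_quotient_limit:
  assumes "GDERIV f x :> D"
  shows "((\<lambda>s. (f (x + s *\<^sub>R h) - f x) / s) \<longlongrightarrow> D \<bullet> h) (at_right 0)"
proof -
  have "((\<lambda>s. f (x + s *\<^sub>R h)) has_real_derivative (D \<bullet> h)) (at 0)"
    using assms by (intro GDERIV_has_derivative_line) simp
  then have "((\<lambda>s. (f (x + s *\<^sub>R h) - f x) / s) \<longlongrightarrow> D \<bullet> h) (at 0)"
    by (simp add: has_field_derivative_iff)
  then show ?thesis by (rule tendsto_mono[OF at_le[OF subset_UNIV]])
qed

lemma GDERIV_second_difference:
  assumes "GDERIV f x :> D"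
  shows "((\<lambda>s. (f (x + s *\<^sub>R h) + f (x - s *\<^sub>R h) - 2 * f x) / s) \<longlongrightarrow> 0) (at_right 0)"
proof -
  have "((\<lambda>s. (f (x + s *\<^sub>R h) - f x) / s + (f (x + s *\<^sub>R (- h)) - f x) / s) \<longlongrightarrow> D \<bullet> h + D \<bullet> (- h)) (at_right 0)"
    using assms by (intro tendsto_add GDERIV_quotient_limit)
  then show ?thesis by (simp add: add_divide_distrib[symmetric] algebra_simps)
qed

text \<open>Second-order expansion along a line, by L'Hopital's rule from the differentiability of the
  gradient at the single point \<open>x\<close>.\<close>

lemma second_order_expansion:
  fixes f :: "real^'n::finite \<Rightarrow> real" and A :: "real^'n^'n"
  assumes U: "open U" "x \<in> U" and g: "\<And>y. y \<in> U \<Longrightarrow> GDERIV f y :> g y"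
    and A: "(g has_derivative (\<lambda>h. A *v h)) (at x)"
  shows "((\<lambda>s. (f (x + s *\<^sub>R h) - f x - s * (g x \<bullet> h)) / s\<^sup>2) \<longlongrightarrow> (h \<bullet> (A *v h)) / 2) (at_right 0)"
proof (rule lhopital_right_0[where f' = "\<lambda>s. (g (x + s *\<^sub>R h) - g x) \<bullet> h" and g' = "\<lambda>s. 2 * s"])
  have "((\<lambda>s. x + s *\<^sub>R h) \<longlongrightarrow> x + 0 *\<^sub>R h) (at_right 0)" by (intro tendsto_intros)
  then have ev: "eventually (\<lambda>s. x + s *\<^sub>R h \<in> U) (at_right 0)"
    using U by (intro topological_tendstoD) auto
  show "eventually (\<lambda>s. ((\<lambda>s. f (x + s *\<^sub>R h) - f x - s * (g x \<bullet> h)) has_real_derivative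
      (g (x + s *\<^sub>R h) - g x) \<bullet> h) (at s)) (at_right 0)"
    using ev
  proof eventually_elim
    case (elim s)
    show ?case
      using GDERIV_has_derivative_line[OF g[OF elim]]
      by (auto intro!: derivative_eq_intros simp: inner_diff_left)
  qed
  show "eventually (\<lambda>s. ((\<lambda>s. s\<^sup>2) has_real_derivative 2 * s) (at s)) (at_right 0)"
    by (intro always_eventually allI) (auto intro!: derivative_eq_intros)
  have "((\<lambda>s. f (x + s *\<^sub>R h)) \<longlongrightarrow> f (x + 0 *\<^sub>R h)) (at 0)"
    using GDERIV_has_derivative_line[of f x 0 h "g x"] g[OF U(2)] by (intro isContD DERIV_isCont) auto
  then have "((\<lambda>s. f (x + s *\<^sub>R h)) \<longlongrightarrow> f (x + 0 *\<^sub>R h)) (at_right 0)"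
    by (rule tendsto_mono[OF at_le[OF subset_UNIV]])
  then have "((\<lambda>s. f (x + s *\<^sub>R h)) \<longlongrightarrow> f x) (at_right 0)" by simp
  then show "((\<lambda>s. f (x + s *\<^sub>R h) - f x - s * (g x \<bullet> h)) \<longlongrightarrow> 0) (at_right 0)"
    by (auto intro!: tendsto_eq_intros)
  show "((\<lambda>s::real. s\<^sup>2) \<longlongrightarrow> 0) (at_right 0)" by (auto intro!: tendsto_eq_intros)
  show "eventually (\<lambda>s::real. s\<^sup>2 \<noteq> 0) (at_right 0)" "eventually (\<lambda>s::real. 2 * s \<noteq> 0) (at_right 0)"
    by (auto simp: eventually_at_filter)
  have "((\<lambda>s. x + s *\<^sub>R h) has_derivative (\<lambda>s. s *\<^sub>R h)) (at 0)"
    by (auto intro!: derivative_eq_intros)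
  moreover have "(g has_derivative (\<lambda>h. A *v h)) (at (x + 0 *\<^sub>R h))" using A by simp
  ultimately have "((\<lambda>s. g (x + s *\<^sub>R h)) has_derivative (\<lambda>s. A *v (s *\<^sub>R h))) (at 0)"
    by (rule has_derivative_compose)
  then have "((\<lambda>s. g (x + s *\<^sub>R h) \<bullet> h) has_derivative (\<lambda>s. (A *v (s *\<^sub>R h)) \<bullet> h)) (at 0)"
    by (auto intro!: derivative_eq_intros)
  then have "((\<lambda>s. g (x + s *\<^sub>R h) \<bullet> h) has_real_derivative ((A *v h) \<bullet> h)) (at 0)"
    by (simp add: has_field_derivative_def matrix_vector_mult_scaleR mult_commute_abs)
  then have "((\<lambda>s. (g (x + s *\<^sub>R h) \<bullet> h - g x \<bullet> h) / s) \<longlongrightarrow> (A *v h) \<bullet> h) (at 0)"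
    by (simp add: has_field_derivative_iff)
  then have "((\<lambda>s. (g (x + s *\<^sub>R h) \<bullet> h - g x \<bullet> h) / s) \<longlongrightarrow> (A *v h) \<bullet> h) (at_right 0)"
    by (rule tendsto_mono[OF at_le[OF subset_UNIV]])
  then have "((\<lambda>s. (g (x + s *\<^sub>R h) \<bullet> h - g x \<bullet> h) / s / 2) \<longlongrightarrow> ((A *v h) \<bullet> h) / 2) (at_right 0)"
    by (rule tendsto_divide[OF _ tendsto_const]) simp
  then show "((\<lambda>s. (g (x + s *\<^sub>R h) - g x) \<bullet> h / (2 * s)) \<longlongrightarrow> (h \<bullet> (A *v h)) / 2) (at_right 0)"
    by (simp add: inner_diff_left inner_commute[of h] mult.commute)
qed

text \<open>Apply the mean value theorem to the difference in the direction \<open>u\<close>, as a function of the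
  displacement along \<open>v\<close>.\<close>

lemma mixed_difference_limit:
  fixes f :: "real^'n::finite \<Rightarrow> real" and A :: "real^'n^'n"
  assumes U: "open U" "x \<in> U" and g: "\<And>y. y \<in> U \<Longrightarrow> GDERIV f y :> g y"
    and A: "(g has_derivative (\<lambda>h. A *v h)) (at x)"
  shows "((\<lambda>s. (f (x + s *\<^sub>R u + s *\<^sub>R v) - f (x + s *\<^sub>R u) - f (x + s *\<^sub>R v) + f x) / s\<^sup>2)
      \<longlongrightarrow> v \<bullet> (A *v u)) (at_right 0)"
proof (rule tendstoI)
  let ?\<Delta> = "\<lambda>s. f (x + s *\<^sub>R u + s *\<^sub>R v) - f (x + s *\<^sub>R u) - f (x + s *\<^sub>R v) + f x"
  fix e :: real assume e: "e > 0"
  define c where "c = (norm u + 2 * norm v) * norm v + 1"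
  have c: "c > 0" by (simp add: c_def add_nonneg_pos)
  define e' where "e' = e / c"
  have e': "e' > 0" using e c by (simp add: e'_def)
  obtain d1 where d1: "d1 > 0" "\<And>y. norm (y - x) < d1 \<Longrightarrow> norm (g y - g x - A *v (y - x)) \<le> e' * norm (y - x)"
    using A e' unfolding has_derivative_at_alt by blast
  obtain d2 where d2: "d2 > 0" "ball x d2 \<subseteq> U" using U by (auto simp: open_contains_ball)
  define d where "d = min d1 d2 / (norm u + norm v + 1)"
  have d: "d > 0" using d1 d2 by (auto simp: d_def add_nonneg_pos)
  have small: "norm (a *\<^sub>R u + r *\<^sub>R v) < min d1 d2" if "\<bar>a\<bar> < d" "\<bar>r\<bar> < d" for a r
  proof -
    have "norm (a *\<^sub>R u + r *\<^sub>R v) \<le> \<bar>a\<bar> * norm u + \<bar>r\<bar> * norm v" using norm_triangle_ineq[of "a *\<^sub>R u" "r *\<^sub>R v"] by simp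
    also have "\<dots> \<le> d * norm u + d * norm v" using that by (intro add_mono mult_right_mono) auto
    also have "\<dots> < d * (norm u + norm v + 1)" using d by (simp add: algebra_simps)
    also have "\<dots> = min d1 d2" unfolding d_def by (simp add: add_nonneg_eq_0_iff)
    finally show ?thesis .
  qed
  have "dist (?\<Delta> s / s\<^sup>2) (v \<bullet> (A *v u)) < e"
    if s: "0 < s" "s < d" for s
  proof -
    define \<psi> where "\<psi> r = f ((x + s *\<^sub>R u) + r *\<^sub>R v) - f (x + r *\<^sub>R v)" for r
    have inU: "x + s *\<^sub>R u + r *\<^sub>R v \<in> U" "x + r *\<^sub>R v \<in> U" if "0 \<le> r" "r \<le> s" for r
      using small[of s r] small[of 0 r] s that d2(2) d by (auto simp: dist_norm subset_iff norm_minus_commute[of x] add.assoc)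
    define \<psi>' where "\<psi>' r = g (x + s *\<^sub>R u + r *\<^sub>R v) \<bullet> v - g (x + r *\<^sub>R v) \<bullet> v" for r
    have "(\<psi> has_real_derivative \<psi>' r) (at r)"
      if "0 \<le> r" "r \<le> s" for r
      unfolding \<psi>_def[abs_def] \<psi>'_def using inU[OF that] g
      by (intro DERIV_diff GDERIV_has_derivative_line) auto
    then obtain z where z: "0 < z" "z < s"
      and mvt: "\<psi> s - \<psi> 0 = (s - 0) * \<psi>' z"
      using MVT2[OF s(1), of \<psi> \<psi>'] by blast
    define E where "E y = g y - g x - A *v (y - x)" for y
    have E1: "norm (E (x + s *\<^sub>R u + z *\<^sub>R v)) \<le> e' * (s * (norm u + norm v))"
    proof -
      have "norm (E (x + s *\<^sub>R u + z *\<^sub>R v)) \<le> e' * norm (s *\<^sub>R u + z *\<^sub>R v)"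
        using d1(2)[of "x + s *\<^sub>R u + z *\<^sub>R v"] small[of s z] s z by (simp add: E_def add.assoc)
      also have "norm (s *\<^sub>R u + z *\<^sub>R v) \<le> s * norm u + z * norm v"
        using norm_triangle_ineq[of "s *\<^sub>R u" "z *\<^sub>R v"] s z by simp
      also have "\<dots> \<le> s * (norm u + norm v)"
        using z by (simp add: distrib_left mult_right_mono)
      finally show ?thesis using e' by simp
    qed
    have E2: "norm (E (x + z *\<^sub>R v)) \<le> e' * (s * norm v)"
    proof -
      have "norm (E (x + z *\<^sub>R v)) \<le> e' * norm (z *\<^sub>R v)"
        using d1(2)[of "x + z *\<^sub>R v"] small[of 0 z] s z d by (simp add: E_def)
      also have "\<dots> \<le> e' * (s * norm v)" using z e' by (intro mult_left_mono) (auto intro: mult_right_mono)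
      finally show ?thesis .
    qed
    have "g (x + s *\<^sub>R u + z *\<^sub>R v) - g (x + z *\<^sub>R v)
        = s *\<^sub>R (A *v u) + (E (x + s *\<^sub>R u + z *\<^sub>R v) - E (x + z *\<^sub>R v))"
      by (simp add: E_def algebra_simps matrix_vector_mult_scaleR matrix_vector_right_distrib)
    then have diff: "\<psi>' z = s * (v \<bullet> (A *v u)) + (E (x + s *\<^sub>R u + z *\<^sub>R v) - E (x + z *\<^sub>R v)) \<bullet> v"
      unfolding \<psi>'_def inner_diff_left[symmetric] by (simp add: inner_add_left inner_commute[of v])
    have "?\<Delta> s = \<psi> s - \<psi> 0"
      by (simp add: \<psi>_def)
    then have "?\<Delta> s / s\<^sup>2 - v \<bullet> (A *v u)
        = ((E (x + s *\<^sub>R u + z *\<^sub>R v) - E (x + z *\<^sub>R v)) \<bullet> v) / s"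
      using s unfolding mvt diff by (simp add: power2_eq_square field_simps)
    also have "\<bar>\<dots>\<bar> \<le> (norm (E (x + s *\<^sub>R u + z *\<^sub>R v)) + norm (E (x + z *\<^sub>R v))) * norm v / s"
    proof -
      have "\<bar>(E (x + s *\<^sub>R u + z *\<^sub>R v) - E (x + z *\<^sub>R v)) \<bullet> v\<bar>
          \<le> norm (E (x + s *\<^sub>R u + z *\<^sub>R v) - E (x + z *\<^sub>R v)) * norm v" by (rule Cauchy_Schwarz_ineq2)
      also have "\<dots> \<le> (norm (E (x + s *\<^sub>R u + z *\<^sub>R v)) + norm (E (x + z *\<^sub>R v))) * norm v"
        by (intro mult_right_mono norm_triangle_ineq4) auto
      finally show ?thesis using s by (simp add: divide_right_mono)
    qed
    also have "\<dots> \<le> (e' * (s * (norm u + norm v)) + e' * (s * norm v)) * norm v / s"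
      using E1 E2 s by (intro divide_right_mono mult_right_mono add_mono) auto
    also have "\<dots> = e' * (c - 1)" using s by (simp add: c_def field_simps)
    also have "\<dots> < e' * c" using e' by simp
    also have "\<dots> = e" using c by (simp add: e'_def)
    finally show ?thesis by (simp add: dist_real_def)
  qed
  then show "eventually (\<lambda>s. dist (?\<Delta> s / s\<^sup>2)
      (v \<bullet> (A *v u)) < e) (at_right 0)"
    unfolding eventually_at_right_field using d by blast
qed

text \<open>The mixed difference is symmetric in the two directions, its limit is not visibly so. Symmetry is
  what makes the linear part of \<open>sq_norm\<close> at a shifted argument equal to twice the inner product with the shift.\<close>

lemma hessian_symmetric:
  fixes f :: "real^'n::finite \<Rightarrow> real" and A :: "real^'n^'n"
  assumes "open U" "x \<in> U" "\<And>y. y \<in> U \<Longrightarrow> GDERIV f y :> g y"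
    and "(g has_derivative (\<lambda>h. A *v h)) (at x)"
  shows "v \<bullet> (A *v u) = u \<bullet> (A *v v)"
proof (rule tendsto_unique)
  let ?q = "\<lambda>u v s. (f (x + s *\<^sub>R u + s *\<^sub>R v) - f (x + s *\<^sub>R u) - f (x + s *\<^sub>R v) + f x) / s\<^sup>2"
  show "(?q u v \<longlongrightarrow> v \<bullet> (A *v u)) (at_right 0)"
    by (rule mixed_difference_limit[OF assms])
  have "(?q v u \<longlongrightarrow> u \<bullet> (A *v v)) (at_right 0)"
    by (rule mixed_difference_limit[OF assms])
  then show "(?q u v \<longlongrightarrow> u \<bullet> (A *v v)) (at_right 0)"
    by (simp add: algebra_simps)
qed simp

lemma hessian_eq:
  fixes f :: "real^'n::finite \<Rightarrow> real" and A :: "real^'n^'n"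
  assumes U: "open U" "x \<in> U" and g: "\<And>y. y \<in> U \<Longrightarrow> GDERIV f y :> g y"
    and A: "(g has_derivative (\<lambda>h. A *v h)) (at x)"
  shows "hessian f x = A"
proof -
  have "(grad f has_derivative (\<lambda>h. A *v h)) (at x)"
    by (rule has_derivative_transform_within_open[OF A U]) (simp add: grad_eq[OF g])
  then have "frechet_derivative (grad f) (at x) = (\<lambda>h. A *v h)"
    by (metis frechet_derivative_at)
  then show ?thesis unfolding hessian_def by simp
qed

section \<open>Convex objectives with a logarithmic barrier\<close>

definition pos_orthant :: "(real^'n::finite) set" where
  "pos_orthant = {\<beta>. \<forall>i. 0 < \<beta> $ i}"

lemma open_pos_orthant: "open (pos_orthant :: (real^'n::finite) set)"
proof -
  have "pos_orthant = (\<Inter>i. {\<beta>::real^'n. 0 < \<beta> $ i})" by (auto simp: pos_orthant_def)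
  also have "open \<dots>" by (intro open_INT) (auto intro!: open_Collect_less continuous_intros)
  finally show ?thesis .
qed

lemma convex_pos_orthant: "convex (pos_orthant :: (real^'n::finite) set)"
proof (rule convexI)
  fix x y :: "real^'n" and u v :: real
  assume xy: "x \<in> pos_orthant" "y \<in> pos_orthant" and uv: "0 \<le> u" "0 \<le> v" "u + v = 1"
  have "0 < u * x $ i + v * y $ i" for i
  proof (cases "u = 0")
    case False
    then show ?thesis using xy uv by (intro add_pos_nonneg mult_pos_pos mult_nonneg_nonneg)
      (auto simp: pos_orthant_def less_imp_le)
  qed (use xy uv in \<open>auto simp: pos_orthant_def\<close>)
  then show "u *\<^sub>R x + v *\<^sub>R y \<in> pos_orthant" by (simp add: pos_orthant_def)
qed

lemma pacing_box_subset: "pacing_box \<subseteq> (pos_orthant :: (real^'n::finite) set)"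
  by (auto simp: pacing_box_def pos_orthant_def)

text \<open>Quantitative concavity of the logarithm, scale invariant; it reduces to \<open>ln z \<le> z - 1\<close> at
  \<open>z = 4 * x * y / (x + y)\<^sup>2\<close>.\<close>

lemma ln_midpoint:
  fixes x y :: real
  assumes "x > 0" "y > 0"
  shows "ln x + ln y + (x - y)\<^sup>2 / (x + y)\<^sup>2 \<le> 2 * ln ((x + y) / 2)"
proof -
  define z where "z = 4 * x * y / (x + y)\<^sup>2"
  have z: "z > 0" using assms by (simp add: z_def)
  have "ln z = ln 4 + ln x + ln y - 2 * ln (x + y)"
    using assms by (simp add: z_def ln_div ln_mult ln_realpow add_pos_pos)
  moreover have "ln (4::real) = 2 * ln 2" using ln_realpow[of 2 2] by simp
  moreover have "ln ((x + y) / 2) = ln (x + y) - ln 2" using assms by (simp add: ln_div)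
  moreover have "ln z \<le> z - 1" by (rule ln_le_minus_one[OF z])
  moreover have "z - 1 = - ((x - y)\<^sup>2 / (x + y)\<^sup>2)"
  proof -
    have "4 * x * y = (x + y)\<^sup>2 - (x - y)\<^sup>2" by (simp add: power2_eq_square algebra_simps)
    moreover have "(x + y)\<^sup>2 \<noteq> 0" using assms by simp
    ultimately show ?thesis by (simp add: z_def diff_divide_distrib)
  qed
  ultimately show ?thesis by simp
qed

text \<open>Both the limit objective and the sample objectives have this form, with \<open>m\<close> the mean of the
  highest paced value. The logarithm alone supplies coercivity at the boundary of the orthant and strong convexity
  on the box, hence existence, uniqueness and stability of minimizers.\<close>

locale log_barrier =
  fixes b :: "'n::finite \<Rightarrow> real" and m :: "real^'n \<Rightarrow> real"
  assumes b_pos: "b i > 0"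
    and m_convex: "convex_on pos_orthant m"
    and m_nonneg: "\<beta> \<in> pos_orthant \<Longrightarrow> m \<beta> \<ge> 0"
begin

definition obj :: "real^'n \<Rightarrow> real" where
  "obj \<beta> = m \<beta> - (\<Sum>i\<in>UNIV. b i * ln (\<beta> $ i))"

lemma obj_midpoint:
  assumes x: "x \<in> pos_orthant" and y: "y \<in> pos_orthant"
  shows "2 * obj ((1/2) *\<^sub>R (x + y)) + (\<Sum>i\<in>UNIV. b i * ((x $ i - y $ i)\<^sup>2 / (x $ i + y $ i)\<^sup>2))
      \<le> obj x + obj y"
proof -
  have "m ((1 - 1/2) *\<^sub>R x + (1/2) *\<^sub>R y) \<le> (1 - 1/2) * m x + (1/2) * m y"
    using m_convex x y by (intro convex_onD) auto
  then have m: "2 * m ((1/2) *\<^sub>R (x + y)) \<le> m x + m y" by (simp add: scaleR_add_right)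
  have "(\<Sum>i\<in>UNIV. b i * ln (x $ i) + b i * ln (y $ i) + b i * ((x $ i - y $ i)\<^sup>2 / (x $ i + y $ i)\<^sup>2))
      \<le> (\<Sum>i\<in>UNIV. 2 * (b i * ln (((1/2) *\<^sub>R (x + y)) $ i)))"
  proof (rule sum_mono)
    fix i
    have "b i * (ln (x $ i) + ln (y $ i) + (x $ i - y $ i)\<^sup>2 / (x $ i + y $ i)\<^sup>2)
        \<le> b i * (2 * ln ((x $ i + y $ i) / 2))"
      using x y b_pos[of i] by (intro mult_left_mono ln_midpoint) (auto simp: pos_orthant_def)
    then show "b i * ln (x $ i) + b i * ln (y $ i) + b i * ((x $ i - y $ i)\<^sup>2 / (x $ i + y $ i)\<^sup>2)
        \<le> 2 * (b i * ln (((1/2) *\<^sub>R (x + y)) $ i))"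
      by (simp add: distrib_left add_divide_distrib)
  qed
  then show ?thesis using m by (simp add: obj_def sum.distrib sum_distrib_left[symmetric])
qed

lemma continuous_obj: "continuous_on pos_orthant obj"
proof -
  have "continuous_on pos_orthant m" by (rule convex_on_continuous[OF open_pos_orthant m_convex])
  then show ?thesis
    unfolding obj_def[abs_def]
    by (intro continuous_intros) (auto simp: pos_orthant_def, metis less_irrefl)
qed

definition b_min :: real where "b_min = Min (range b)"

lemma b_min: "b_min > 0" "b_min \<le> b i"
  using b_pos by (auto simp: b_min_def)

text \<open>Compare with the midpoint of \<open>x\<close> and \<open>y\<close>. The growth is uniform over all admissible \<open>m\<close>, which is
  what makes the random minimizer measurable.\<close>

lemma obj_growth:
  assumes x: "is_min_on obj pacing_box x" and y: "y \<in> pacing_box"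
  shows "obj x + b_min / 4 * (norm (y - x))\<^sup>2 \<le> obj y"
proof -
  have xb: "x \<in> pacing_box" using x by (simp add: is_min_on_def)
  have "(1/2) *\<^sub>R (x + y) \<in> pacing_box"
    using xb y by (simp add: pacing_box_def) (smt (verit))
  then have mid: "obj x \<le> obj ((1/2) *\<^sub>R (x + y))" using x by (simp add: is_min_on_def)
  have "(norm (y - x))\<^sup>2 = (\<Sum>i\<in>UNIV. (y $ i - x $ i)\<^sup>2)"
    unfolding power2_norm_eq_inner by (simp add: inner_vec_def power2_eq_square)
  then have "b_min / 4 * (norm (y - x))\<^sup>2 = (\<Sum>i\<in>UNIV. b_min / 4 * (y $ i - x $ i)\<^sup>2)"
    by (simp only: sum_distrib_left)
  also have "\<dots> \<le> (\<Sum>i\<in>UNIV. b i * ((x $ i - y $ i)\<^sup>2 / (x $ i + y $ i)\<^sup>2))"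
  proof (rule sum_mono)
    fix i
    have p: "0 < x $ i" "x $ i \<le> 1" "0 < y $ i" "y $ i \<le> 1" using xb y by (auto simp: pacing_box_def)
    then have "(x $ i + y $ i)\<^sup>2 \<le> 2\<^sup>2" by (intro power_mono) auto
    then have "(x $ i - y $ i)\<^sup>2 / 2\<^sup>2 \<le> (x $ i - y $ i)\<^sup>2 / (x $ i + y $ i)\<^sup>2"
      using p by (intro divide_left_mono) (auto intro!: mult_pos_pos simp: add_pos_pos)
    then have "b_min * ((x $ i - y $ i)\<^sup>2 / 2\<^sup>2) \<le> b i * ((x $ i - y $ i)\<^sup>2 / (x $ i + y $ i)\<^sup>2)"
      using b_min(1) b_min(2)[of i] by (intro mult_mono) auto
    then show "b_min / 4 * (y $ i - x $ i)\<^sup>2 \<le> b i * ((x $ i - y $ i)\<^sup>2 / (x $ i + y $ i)\<^sup>2)"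
      by (simp add: power2_commute)
  qed
  also have "\<dots> \<le> obj x + obj y - 2 * obj ((1/2) *\<^sub>R (x + y))"
    using obj_midpoint[OF subsetD[OF pacing_box_subset xb] subsetD[OF pacing_box_subset y]] by linarith
  finally show ?thesis using mid by linarith
qed

text \<open>A coordinate below \<open>exp (- K / b i)\<close> already costs more than the value \<open>K\<close> at the corner
  \<open>(1, \<dots>, 1)\<close>, so the search can be restricted to a compact box.\<close>

lemma obj_min_exists: "\<exists>x. is_min_on obj pacing_box x"
proof -
  define one :: "real^'n" where "one = (\<chi> i. 1)"
  define K where "K = obj one"
  have "one \<in> pos_orthant" by (simp add: one_def pos_orthant_def)
  then have K: "K \<ge> 0" using m_nonneg by (simp add: K_def obj_def one_def)
  define l :: "real^'n" where "l = (\<chi> i. exp (- K / b i))"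
  have l: "0 < l $ i" "l $ i \<le> 1" for i
    using K b_pos[of i] by (auto simp: l_def divide_nonneg_pos)
  have box: "cbox l one \<subseteq> pacing_box"
    unfolding mem_box_cart pacing_box_def one_def subset_iff
    by (auto intro!: less_le_trans[OF l(1)])
  have one: "one \<in> cbox l one" using l by (simp add: mem_box_cart one_def)
  have "continuous_on (cbox l one) obj"
    using box pacing_box_subset by (intro continuous_on_subset[OF continuous_obj]) auto
  then obtain x where x: "x \<in> cbox l one" "\<And>y. y \<in> cbox l one \<Longrightarrow> obj x \<le> obj y"
    using continuous_attains_inf[OF compact_cbox] one by (metis empty_iff)
  have "obj x \<le> obj y" if y: "y \<in> pacing_box" for y
  proof (cases "y \<in> cbox l one")
    case False
    then obtain i where "\<not> (l $ i \<le> y $ i \<and> y $ i \<le> 1)" by (auto simp: mem_box_cart one_def)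
    then have i: "y $ i < l $ i" using y by (simp add: pacing_box_def)
    have neg: "b j * ln (y $ j) \<le> 0" for j
      using y b_pos[of j] by (auto simp: pacing_box_def intro!: mult_nonneg_nonpos)
    have "ln (y $ i) \<le> ln (l $ i)" using i y l(1)[of i] by (simp add: pacing_box_def)
    then have "b i * ln (y $ i) \<le> b i * ln (l $ i)" using b_pos[of i] by simp
    also have "\<dots> = - K" using b_pos[of i] by (simp add: l_def)
    finally have "b i * ln (y $ i) \<le> - K" .
    moreover have "(\<Sum>j\<in>UNIV. b j * ln (y $ j)) = b i * ln (y $ i) + (\<Sum>j\<in>UNIV - {i}. b j * ln (y $ j))"
      by (intro sum.remove) auto
    moreover have "(\<Sum>j\<in>UNIV - {i}. b j * ln (y $ j)) \<le> 0" using neg by (intro sum_nonpos) auto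
    moreover have "m y \<ge> 0" using y pacing_box_subset by (intro m_nonneg) auto
    ultimately have "K \<le> obj y" by (simp add: obj_def)
    then show ?thesis using x(2)[OF one] by (simp add: K_def)
  qed (use x in auto)
  then show ?thesis using x(1) box by (auto simp: is_min_on_def)
qed

lemma convex_obj: "convex_on pos_orthant obj"
proof -
  have "convex_on pos_orthant (\<lambda>\<beta>. m \<beta> + (\<Sum>i\<in>UNIV. b i * - ln (\<beta> $ i)))"
  proof (intro convex_on_add m_convex)
    have ln: "convex_on pos_orthant (\<lambda>\<beta>. - ln (\<beta> $ i))" for i :: 'n
    proof (rule convex_onI[OF _ convex_pos_orthant])
      fix t :: real and x y :: "real^'n"
      assume "0 < t" "t < 1" "x \<in> pos_orthant" "y \<in> pos_orthant"
      moreover have "convex_on {0<..} (\<lambda>x::real. - ln x)"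
        using ln_concave by (simp add: concave_on_def)
      ultimately show "- ln (((1 - t) *\<^sub>R x + t *\<^sub>R y) $ i) \<le> (1 - t) * - ln (x $ i) + t * - ln (y $ i)"
        using convex_onD[of "{0<..}" "\<lambda>x::real. - ln x" t "x $ i" "y $ i"] by (simp add: pos_orthant_def)
    qed
    have "convex_on pos_orthant (\<lambda>\<beta>. \<Sum>i\<in>I. b i * - ln (\<beta> $ i))" if "finite I" for I :: "'n set"
      using that
    proof induction
      case empty
      then show ?case by (simp add: convex_on_const convex_pos_orthant)
    next
      case (insert i I)
      have "convex_on pos_orthant (\<lambda>\<beta>. b i * - ln (\<beta> $ i) + (\<Sum>i\<in>I. b i * - ln (\<beta> $ i)))"
        using b_pos[of i] by (intro convex_on_add convex_on_cmul ln insert.IH) simp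
      then show ?case using insert.hyps by (simp add: sum.insert[OF insert.hyps] del: mult_minus_right)
    qed
    then show "convex_on pos_orthant (\<lambda>\<beta>. \<Sum>i\<in>UNIV. b i * - ln (\<beta> $ i))" by simp
  qed
  then show ?thesis by (simp add: obj_def[abs_def] sum_negf)
qed

end

text \<open>Best point among the first \<open>n + 1\<close> members of an enumeration. Unlike the true minimizer it is
  visibly a measurable function of a random objective.\<close>

primrec running_argmin :: "('b \<Rightarrow> real) \<Rightarrow> (nat \<Rightarrow> 'b) \<Rightarrow> nat \<Rightarrow> 'b" where
  "running_argmin f d 0 = d 0"
| "running_argmin f d (Suc n) =
     (if f (d (Suc n)) < f (running_argmin f d n) then d (Suc n) else running_argmin f d n)"

lemma running_argmin_in: "running_argmin f d n \<in> range d"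
  by (induction n) auto

lemma running_argmin_le: "k \<le> n \<Longrightarrow> f (running_argmin f d n) \<le> f (d k)"
proof (induction n)
  case (Suc n)
  then show ?case by (cases "k = Suc n") (auto simp: le_Suc_eq)
qed simp

text \<open>The minimizer is the pointwise limit of the running minimizers over a dense sequence:
  their values converge to the minimum by continuity, and the growth condition transfers this to the points.\<close>

lemma measurable_well_posed_argmin:
  fixes f :: "'w \<Rightarrow> 'b::euclidean_space \<Rightarrow> real" and x :: "'w \<Rightarrow> 'b"
  assumes meas: "\<And>y. y \<in> S \<Longrightarrow> (\<lambda>\<omega>. f \<omega> y) \<in> borel_measurable M"
    and cont: "\<And>\<omega>. \<omega> \<in> space M \<Longrightarrow> continuous_on S (f \<omega>)"
    and c: "c > 0" and xS: "\<And>\<omega>. \<omega> \<in> space M \<Longrightarrow> x \<omega> \<in> S"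
    and growth: "\<And>\<omega> y. \<omega> \<in> space M \<Longrightarrow> y \<in> S \<Longrightarrow> f \<omega> (x \<omega>) + c * (norm (y - x \<omega>))\<^sup>2 \<le> f \<omega> y"
  shows "x \<in> borel_measurable M"
proof (cases "space M = {}")
  case True
  then show ?thesis by (simp add: measurable_def)
next
  case False
  then have "S \<noteq> {}" using xS by blast
  obtain T where T: "countable T" "T \<subseteq> S" "S \<subseteq> closure T" using separable by blast
  then have "T \<noteq> {}" using \<open>S \<noteq> {}\<close> by auto
  define d where "d = from_nat_into T"
  have d: "range d = T" using T \<open>T \<noteq> {}\<close> by (simp add: d_def)
  define r where "r n \<omega> = running_argmin (f \<omega>) d n" for n \<omega>
  have r_meas: "r n \<in> borel_measurable M \<and> (\<lambda>\<omega>. f \<omega> (r n \<omega>)) \<in> borel_measurable M" for n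
  proof (induction n)
    case 0
    then show ?case using meas[of "d 0"] T d by (auto simp: r_def)
  next
    case (Suc n)
    then have [measurable]: "r n \<in> borel_measurable M" "(\<lambda>\<omega>. f \<omega> (r n \<omega>)) \<in> borel_measurable M" by auto
    have [measurable]: "(\<lambda>\<omega>. f \<omega> (d (Suc n))) \<in> borel_measurable M" using meas T d by auto
    have "r (Suc n) = (\<lambda>\<omega>. if f \<omega> (d (Suc n)) < f \<omega> (r n \<omega>) then d (Suc n) else r n \<omega>)"
      "(\<lambda>\<omega>. f \<omega> (r (Suc n) \<omega>)) =
        (\<lambda>\<omega>. if f \<omega> (d (Suc n)) < f \<omega> (r n \<omega>) then f \<omega> (d (Suc n)) else f \<omega> (r n \<omega>))"
      by (auto simp: r_def fun_eq_iff)
    then show ?case by simp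
  qed
  show ?thesis
  proof (rule borel_measurable_LIMSEQ_metric)
    show "r n \<in> borel_measurable M" for n using r_meas by simp
    fix \<omega> assume \<omega>: "\<omega> \<in> space M"
    show "(\<lambda>n. r n \<omega>) \<longlonglongrightarrow> x \<omega>"
    proof (rule metric_LIMSEQ_I)
      fix e :: real assume e: "e > 0"
      obtain \<delta> where \<delta>: "\<delta> > 0" "\<And>y. y \<in> S \<Longrightarrow> dist y (x \<omega>) < \<delta> \<Longrightarrow> dist (f \<omega> y) (f \<omega> (x \<omega>)) < c * e\<^sup>2"
        using cont[OF \<omega>] xS[OF \<omega>] c e unfolding continuous_on_iff
        by (metis mult_pos_pos zero_less_power)
      obtain y where y: "y \<in> T" "dist y (x \<omega>) < \<delta>"
        using T(3) xS[OF \<omega>] \<delta>(1) closure_approachable by blast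
      then obtain k where k: "y = d k" using d by auto
      have "dist (r n \<omega>) (x \<omega>) < e" if "n \<ge> k" for n
      proof -
        have "r n \<omega> \<in> S" using running_argmin_in[of "f \<omega>" d n] d T by (auto simp: r_def)
        then have "f \<omega> (x \<omega>) + c * (norm (r n \<omega> - x \<omega>))\<^sup>2 \<le> f \<omega> (r n \<omega>)" by (rule growth[OF \<omega>])
        also have "\<dots> \<le> f \<omega> y" using running_argmin_le[OF that, of "f \<omega>" d] by (simp add: r_def k)
        also have "\<dots> < f \<omega> (x \<omega>) + c * e\<^sup>2"
          using \<delta>(2)[of y] y T by (auto simp: dist_real_def)
        finally have "(norm (r n \<omega> - x \<omega>))\<^sup>2 < e\<^sup>2" using c by simp
        then show ?thesis using e by (simp add: dist_norm power2_less_imp_less)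
      qed
      then show "\<exists>k. \<forall>n\<ge>k. dist (r n \<omega>) (x \<omega>) < e" by blast
    qed
  qed
qed

section \<open>Weak convergence of random vectors\<close>

text \<open>Finite sums of the functions \<open>x \<mapsto> c * cis (a \<bullet> x)\<close>. Their expectations are
  determined by the characteristic function.\<close>

inductive_set trig_polys :: "('b::real_inner \<Rightarrow> complex) set" where
  frequency: "(\<lambda>x. c * cis (a \<bullet> x)) \<in> trig_polys"
| add: "p \<in> trig_polys \<Longrightarrow> q \<in> trig_polys \<Longrightarrow> (\<lambda>x. p x + q x) \<in> trig_polys"

lemma trig_polys_const: "(\<lambda>x. c) \<in> trig_polys"
  using trig_polys.frequency[of c 0] by simp

lemma trig_polys_mult:
  assumes "p \<in> trig_polys" "q \<in> trig_polys"
  shows "(\<lambda>x. p x * q x) \<in> trig_polys"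
  using assms(1)
proof induction
  case (frequency c a)
  show ?case using assms(2)
  proof induction
    case (frequency d e)
    have "(\<lambda>x. c * cis (a \<bullet> x) * (d * cis (e \<bullet> x))) = (\<lambda>x. (c * d) * cis ((a + e) \<bullet> x))"
      by (simp add: fun_eq_iff inner_add_left cis_mult[symmetric] mult_ac)
    then show ?case by (simp only: trig_polys.frequency)
  next
    case (add p q)
    then show ?case using trig_polys.add by (fastforce simp: algebra_simps)
  qed
next
  case (add p p')
  then show ?case using trig_polys.add by (fastforce simp: algebra_simps)
qed

lemma trig_polys_sum:
  assumes "finite I" "\<And>i. i \<in> I \<Longrightarrow> p i \<in> trig_polys"
  shows "(\<lambda>x. \<Sum>i\<in>I. p i x) \<in> trig_polys"
  using assms by induction (auto intro: trig_polys.add trig_polys_const)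

lemma trig_polys_sin: "(\<lambda>x. of_real (c * sin (a \<bullet> x))) \<in> trig_polys"
proof -
  have "of_real (c * sin (a \<bullet> x)) = (c / (2*\<i>)) * cis (a \<bullet> x) + (- c / (2*\<i>)) * cis ((-a) \<bullet> x)" for x
    by (simp add: complex_eq_iff field_simps Re_divide Im_divide)
  then have "(\<lambda>x. of_real (c * sin (a \<bullet> x))) =
      (\<lambda>x. (c / (2*\<i>)) * cis (a \<bullet> x) + (- c / (2*\<i>)) * cis ((-a) \<bullet> x))"
    by blast
  then show ?thesis by (simp only: trig_polys.intros)
qed

text \<open>A map into a bounded set, close to the identity on any fixed ball if \<open>N\<close> is large, and such that
  polynomials become trigonometric polynomials after composition. A polynomial approximation that is
  good on the range then yields a trigonometric approximation that is bounded on the whole space, without a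
  detour through periodic functions on a torus.\<close>

definition sine_squash :: "real \<Rightarrow> 'b::euclidean_space \<Rightarrow> 'b" where
  "sine_squash N x = (\<Sum>b\<in>Basis. (N * sin ((x \<bullet> b) / N)) *\<^sub>R b)"

lemma norm_sine_squash:
  fixes x :: "'b::euclidean_space"
  assumes "N \<ge> 0"
  shows "norm (sine_squash N x) \<le> N * DIM('b)"
proof -
  have "norm (sine_squash N x) \<le> (\<Sum>b\<in>(Basis::'b set). norm ((N * sin ((x \<bullet> b) / N)) *\<^sub>R b))"
    unfolding sine_squash_def by (rule norm_sum)
  also have "\<dots> \<le> (\<Sum>b\<in>(Basis::'b set). N)"
    using assms by (intro sum_mono) (auto simp: abs_mult mult_left_le)
  finally show ?thesis by (simp add: mult.commute)
qed

lemma dist_sine_squash: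
  fixes x :: "'b::euclidean_space"
  assumes "N > 0"
  shows "norm (sine_squash N x - x) \<le> DIM('b) * (norm x)\<^sup>2 / N"
proof -
  have "sine_squash N x - x = (\<Sum>b\<in>Basis. (N * sin ((x \<bullet> b) / N) - x \<bullet> b) *\<^sub>R b)"
    unfolding sine_squash_def by (simp add: scaleR_diff_left sum_subtractf euclidean_representation)
  also have "norm \<dots> \<le> (\<Sum>b\<in>(Basis::'b set). norm ((N * sin ((x \<bullet> b) / N) - x \<bullet> b) *\<^sub>R b))"
    by (rule norm_sum)
  also have "\<dots> \<le> (\<Sum>b\<in>(Basis::'b set). (norm x)\<^sup>2 / N)"
  proof (intro sum_mono)
    fix b :: 'b assume b: "b \<in> Basis"
    let ?u = "(x \<bullet> b) / N"
    have u: "\<bar>sin ?u - ?u\<bar> \<le> ?u\<^sup>2"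
      using Maclaurin_sin_bound[of ?u 2] zero_le_power2[of ?u] by (simp add: eval_nat_numeral sin_coeff_def)
    have "\<bar>N * sin ?u - x \<bullet> b\<bar> = N * \<bar>sin ?u - ?u\<bar>"
    proof -
      have "N * sin ?u - x \<bullet> b = N * (sin ?u - ?u)" using assms by (simp add: field_simps)
      then show ?thesis using assms by (simp add: abs_mult)
    qed
    also have "\<dots> \<le> N * ?u\<^sup>2" using u assms by simp
    also have "\<dots> = (x \<bullet> b)\<^sup>2 / N" using assms by (simp add: power2_eq_square)
    also have "\<dots> \<le> (norm x)\<^sup>2 / N"
      using assms b Basis_le_norm[of b x] by (intro divide_right_mono) (auto simp: abs_le_square_iff[symmetric])
    finally show "norm ((N * sin ?u - x \<bullet> b) *\<^sub>R b) \<le> (norm x)\<^sup>2 / N" using b by simp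
  qed
  finally show ?thesis by (simp add: mult_ac)
qed

lemma polynomial_sine_squash_trig:
  fixes p :: "'b::euclidean_space \<Rightarrow> real"
  assumes "real_polynomial_function p"
  shows "(\<lambda>x. of_real (p (sine_squash N x))) \<in> trig_polys"
  using assms
proof induction
  case (linear f)
  interpret bounded_linear f by (rule linear)
  have "f (sine_squash N x) = (\<Sum>b\<in>Basis. (f b * N) * sin ((b /\<^sub>R N) \<bullet> x))" for x :: 'b
    unfolding sine_squash_def sum scaleR
    by (intro sum.cong) (auto simp: inner_commute divide_inverse mult_ac)
  then have "(\<lambda>x. complex_of_real (f (sine_squash N x))) =
      (\<lambda>x. \<Sum>b\<in>Basis. of_real ((f b * N) * sin ((b /\<^sub>R N) \<bullet> x)))"
    by (simp only: of_real_sum)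
  then show ?case by (simp only: trig_polys_sum[OF finite_Basis trig_polys_sin])
next
  case (mult f g)
  then show ?case using trig_polys_mult by (simp add: trig_polys_mult)
qed (simp_all add: trig_polys_const trig_polys.add)

lemma bounded_trig_poly:
  assumes "p \<in> trig_polys" shows "bounded (range p)"
  using assms
proof induction
  case (frequency c a)
  show ?case by (intro boundedI[of _ "norm c"]) (auto simp: norm_mult)
next
  case (add p q)
  then show ?case using bounded_plus_comp[of p UNIV q] by simp
qed

lemma continuous_trig_poly:
  assumes "p \<in> trig_polys" shows "continuous_on UNIV p"
  using assms by induction (auto intro!: continuous_intros)

lemma (in prob_space) integrable_bounded_comp:
  fixes f :: "'b::topological_space \<Rightarrow> 'c::{banach, second_countable_topology}"
  assumes "continuous_on UNIV f" "bounded (range f)" "X \<in> borel_measurable M"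
  shows "integrable M (\<lambda>\<omega>. f (X \<omega>))"
proof -
  obtain B where "\<And>x. norm (f x) \<le> B" using assms(2) by (auto simp: bounded_iff)
  then show ?thesis
    using assms borel_measurable_continuous_onI[OF assms(1)]
    by (intro integrable_const_bound[of _ B]) auto
qed

lemma (in prob_space) expectation_close:
  fixes u w :: "'a \<Rightarrow> real"
  assumes "integrable M u" "integrable M w" "A \<in> events" "e \<ge> 0" "prob A \<le> p"
    and far: "\<And>\<omega>. \<omega> \<in> space M \<Longrightarrow> \<bar>u \<omega> - w \<omega>\<bar> \<le> C"
    and near: "\<And>\<omega>. \<omega> \<in> space M - A \<Longrightarrow> \<bar>u \<omega> - w \<omega>\<bar> \<le> e"
  shows "\<bar>expectation u - expectation w\<bar> \<le> e + C * p"
proof -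
  have C: "C \<ge> 0" using far not_empty by fastforce
  have "\<bar>expectation u - expectation w\<bar> = \<bar>expectation (\<lambda>\<omega>. u \<omega> - w \<omega>)\<bar>" using assms by simp
  also have "\<dots> \<le> expectation (\<lambda>\<omega>. \<bar>u \<omega> - w \<omega>\<bar>)" by (rule integral_abs_bound)
  also have "\<dots> \<le> expectation (\<lambda>\<omega>. e + C * indicator A \<omega>)"
  proof (rule integral_mono)
    show "integrable M (\<lambda>\<omega>. e + C * indicator A \<omega>)" using assms by (auto simp: emeasure_eq_measure)
    fix \<omega> assume w: "\<omega> \<in> space M"
    show "\<bar>u \<omega> - w \<omega>\<bar> \<le> e + C * indicator A \<omega>"
      using far[OF w] near[of \<omega>] w \<open>e \<ge> 0\<close> by (cases "\<omega> \<in> A") (auto simp: indicator_def)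
  qed (use assms in auto)
  also have "\<dots> = e + C * prob A" using assms by (simp add: prob_space emeasure_eq_measure)
  also have "\<dots> \<le> e + C * p" using C assms by (simp add: mult_left_mono)
  finally show ?thesis .
qed

lemma (in prob_space) random_vector_tail:
  fixes Y :: "'a \<Rightarrow> 'b::euclidean_space"
  assumes [measurable]: "Y \<in> borel_measurable M" and "e > 0"
  shows "\<exists>K. prob {\<omega>\<in>space M. norm (Y \<omega>) > K} \<le> e"
proof -
  let ?A = "\<lambda>n. {\<omega>\<in>space M. norm (Y \<omega>) > real n}"
  have "(\<lambda>n. prob (?A n)) \<longlonglongrightarrow> prob (\<Inter>n. ?A n)"
    by (rule finite_Lim_measure_decseq) (auto simp: decseq_def)
  moreover have "(\<Inter>n. ?A n) = {}"
  proof -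
    have "\<exists>n. \<omega> \<notin> ?A n" for \<omega>
      using reals_Archimedean2[of "norm (Y \<omega>)"] by (auto simp: not_less intro: less_imp_le)
    then show ?thesis by blast
  qed
  ultimately have "(\<lambda>n. prob (?A n)) \<longlonglongrightarrow> 0" by simp
  then have "eventually (\<lambda>n. prob (?A n) < e) sequentially"
    using assms by (intro order_tendstoD(2)) auto
  then show ?thesis by (auto simp: eventually_sequentially intro: less_imp_le)
qed

text \<open>For a bounded continuous \<open>f\<close>, approximate \<open>f\<close> on the range of
  \<open>sine_squash N\<close> by a polynomial; composed with \<open>sine_squash N\<close> it differs from \<open>f\<close> by little on a ball
  carrying almost all mass and by a bounded amount elsewhere.\<close>

lemma conv_in_distribution_char:
  fixes X :: "nat \<Rightarrow> 'w \<Rightarrow> 'b::euclidean_space"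
  assumes P: "prob_space P" and Q: "prob_space Q"
    and X [measurable]: "\<And>t. X t \<in> borel_measurable P" and Y [measurable]: "Y \<in> borel_measurable Q"
    and tight: "\<And>e. e > 0 \<Longrightarrow> \<exists>K. \<forall>t. measure P {\<omega>\<in>space P. norm (X t \<omega>) > K} \<le> e"
    and char: "\<And>a. (\<lambda>t. \<integral>\<omega>. cis (a \<bullet> X t \<omega>) \<partial>P) \<longlonglongrightarrow> (\<integral>\<omega>. cis (a \<bullet> Y \<omega>) \<partial>Q)"
  shows "conv_in_distribution P X Q Y"
  unfolding conv_in_distribution_def
proof (intro conjI allI impI X Y)
  interpret P: prob_space P by fact
  interpret Q: prob_space Q by fact
  have trig: "(\<lambda>t. \<integral>\<omega>. p (X t \<omega>) \<partial>P) \<longlonglongrightarrow> (\<integral>\<omega>. p (Y \<omega>) \<partial>Q)" if "p \<in> trig_polys" for p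
    using that
  proof induction
    case (frequency c a)
    show ?case using tendsto_mult_left[OF char[of a], of c] by simp
  next
    case (add p q)
    have "integrable P (\<lambda>\<omega>. p (X t \<omega>))" "integrable P (\<lambda>\<omega>. q (X t \<omega>))" for t
      using add.hyps by (simp_all add: P.integrable_bounded_comp continuous_trig_poly bounded_trig_poly)
    moreover have "integrable Q (\<lambda>\<omega>. p (Y \<omega>))" "integrable Q (\<lambda>\<omega>. q (Y \<omega>))"
      using add.hyps by (simp_all add: Q.integrable_bounded_comp continuous_trig_poly bounded_trig_poly)
    ultimately show ?case using tendsto_add[OF add.IH] by simp
  qed
  fix f :: "'b \<Rightarrow> real" assume f: "continuous_on UNIV f \<and> bounded (range f)"
  then obtain B where B: "\<And>x. \<bar>f x\<bar> \<le> B" by (auto simp: bounded_iff)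
  have B0: "B \<ge> 0" using B[of undefined] by linarith
  have [measurable]: "f \<in> borel_measurable borel" using f by (auto intro: borel_measurable_continuous_onI)
  show "(\<lambda>t. \<integral>\<omega>. f (X t \<omega>) \<partial>P) \<longlonglongrightarrow> (\<integral>\<omega>. f (Y \<omega>) \<partial>Q)"
  proof (rule LIMSEQ_I)
    fix r :: real assume r: "r > 0"
    \<comment> \<open>The total error below is \<open>7 * e + 4 * B * e\<close>.\<close>
    define e where "e = min 1 (r / (10 * (B + 1)))"
    have e: "e > 0" "e \<le> 1" using r B0 by (auto simp: e_def)
    have "(10 * (B + 1)) * e \<le> (10 * (B + 1)) * (r / (10 * (B + 1)))"
      unfolding e_def using B0 by (intro mult_left_mono) auto
    also have "\<dots> = r" using B0 by simp
    finally have "(10 * (B + 1)) * e \<le> r" .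
    define c where "c = e + e + (1 + 2 * B) * e"
    have e_r: "2 * c + e < r"
      unfolding c_def using \<open>(10 * (B + 1)) * e \<le> r\<close> e(1) mult_nonneg_nonneg[OF B0 less_imp_le[OF e(1)]] by (simp add: algebra_simps)
    obtain K1 K2 where "\<And>t. P.prob {\<omega>\<in>space P. norm (X t \<omega>) > K1} \<le> e"
      "Q.prob {\<omega>\<in>space Q. norm (Y \<omega>) > K2} \<le> e"
      using tight[OF e(1)] Q.random_vector_tail[OF Y e(1)] by blast
    moreover define K where "K = max 0 (max K1 K2)"
    have "P.prob {\<omega>\<in>space P. norm (X t \<omega>) > K} \<le> P.prob {\<omega>\<in>space P. norm (X t \<omega>) > K1}" for t
      by (rule P.finite_measure_mono) (auto simp: K_def)
    moreover have "Q.prob {\<omega>\<in>space Q. norm (Y \<omega>) > K} \<le> Q.prob {\<omega>\<in>space Q. norm (Y \<omega>) > K2}"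
      by (rule Q.finite_measure_mono) (auto simp: K_def)
    ultimately have K: "\<And>t. P.prob {\<omega>\<in>space P. norm (X t \<omega>) > K} \<le> e"
      "Q.prob {\<omega>\<in>space Q. norm (Y \<omega>) > K} \<le> e" and K0: "K \<ge> 0"
      by (auto intro: order_trans simp: K_def)
    have "uniformly_continuous_on (cball 0 (K + 1)) f"
      using f by (intro compact_uniformly_continuous) (auto intro: continuous_on_subset)
    then obtain d where d: "d > 0"
      "\<And>x y. norm x \<le> K + 1 \<Longrightarrow> norm y \<le> K + 1 \<Longrightarrow> dist y x < d \<Longrightarrow> \<bar>f y - f x\<bar> < e"
      using e unfolding uniformly_continuous_on_def by (metis dist_real_def mem_cball_0)
    define N where "N = DIM('b) * K\<^sup>2 / (min d 1 / 2) + 1"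
    have N: "N > 0" using d K0 by (simp add: N_def add_nonneg_pos)
    have close: "\<bar>f (sine_squash N x) - f x\<bar> \<le> e" if x: "norm x \<le> K" for x
    proof -
      have "norm (sine_squash N x - x) \<le> DIM('b) * (norm x)\<^sup>2 / N" by (rule dist_sine_squash[OF N])
      also have "\<dots> \<le> DIM('b) * K\<^sup>2 / N"
        using x N by (intro divide_right_mono mult_left_mono power_mono) auto
      also have "\<dots> < min d 1"
      proof -
        have "DIM('b) * K\<^sup>2 = (N - 1) * (min d 1 / 2)" using d by (simp add: N_def)
        also have "\<dots> < N * min d 1"
          using mult_pos_pos[of "N + 1" "min d 1"] d(1) N by (simp add: algebra_simps del: min_less_iff_conj)
        finally show ?thesis unfolding pos_divide_less_eq[OF N] by (simp only: mult.commute)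
      qed
      finally have *: "norm (sine_squash N x - x) < min d 1" .
      then have "norm (sine_squash N x) \<le> K + 1"
        using x norm_triangle_sub[of "sine_squash N x" x] by linarith
      then show ?thesis using d(2)[of x "sine_squash N x"] * x by (simp add: dist_norm less_imp_le)
    qed
    obtain p where p: "real_polynomial_function p"
      "\<And>x. x \<in> cball 0 (N * DIM('b)) \<Longrightarrow> \<bar>f x - p x\<bar> < e"
      using Stone_Weierstrass_real_polynomial_function[of "cball 0 (N * DIM('b))" f e] f e
      by (auto intro: continuous_on_subset)
    define T where "T x = p (sine_squash N x)" for x
    have T: "\<bar>f (sine_squash N x) - T x\<bar> \<le> e" for x
      using p(2)[of "sine_squash N x"] norm_sine_squash[of N x] N by (auto simp: T_def less_imp_le)
    have T_trig: "(\<lambda>x. of_real (T x)) \<in> trig_polys"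
      unfolding T_def by (rule polynomial_sine_squash_trig[OF p(1)])
    have T_cont: "continuous_on UNIV T"
      using continuous_on_Re[OF continuous_trig_poly[OF T_trig]] by simp
    have T_bd: "bounded (range T)"
      using bounded_trig_poly[OF T_trig] by (auto simp: bounded_iff)
    have T_far: "\<bar>f x - T x\<bar> \<le> 1 + 2 * B" for x
      using e T[of x] B[of x] B[of "sine_squash N x"] by linarith
    have T_near: "\<bar>f x - T x\<bar> \<le> e + e" if "norm x \<le> K" for x
      using T[of x] close[OF that] by linarith
    let ?FX = "\<lambda>t. P.expectation (\<lambda>\<omega>. f (X t \<omega>))" and ?TX = "\<lambda>t. P.expectation (\<lambda>\<omega>. T (X t \<omega>))"
      and ?FY = "Q.expectation (\<lambda>\<omega>. f (Y \<omega>))" and ?TY = "Q.expectation (\<lambda>\<omega>. T (Y \<omega>))"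
    have TX: "integrable P (\<lambda>\<omega>. T (X t \<omega>))" "integrable P (\<lambda>\<omega>. f (X t \<omega>))" for t
      using f P.integrable_bounded_comp[OF T_cont T_bd X] P.integrable_bounded_comp[OF _ _ X] by blast+
    have TY: "integrable Q (\<lambda>\<omega>. T (Y \<omega>))" "integrable Q (\<lambda>\<omega>. f (Y \<omega>))"
      using f Q.integrable_bounded_comp[OF T_cont T_bd Y] Q.integrable_bounded_comp[OF _ _ Y] by blast+
    have a: "\<bar>?FX t - ?TX t\<bar> \<le> c" for t
      unfolding c_def
      by (rule P.expectation_close[OF TX(2,1) _ _ K(1)[of t]]) (use e T_far T_near in auto)
    have b: "\<bar>?FY - ?TY\<bar> \<le> c"
      unfolding c_def
      by (rule Q.expectation_close[OF TY(2,1) _ _ K(2)]) (use e T_far T_near in auto)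
    have "(\<lambda>t. complex_of_real (?TX t)) \<longlonglongrightarrow> complex_of_real (?TY)"
      using trig[OF T_trig] TX TY by simp
    then have "(\<lambda>t. ?TX t) \<longlonglongrightarrow> ?TY"
      by (simp only: tendsto_of_real_iff)
    then obtain n0 where n0: "\<And>t. t \<ge> n0 \<Longrightarrow> \<bar>?TX t - ?TY\<bar> < e"
      using LIMSEQ_D[OF _ e(1)] by (metis real_norm_def)
    show "\<exists>n0. \<forall>t\<ge>n0. norm (?FX t - ?FY) < r"
      unfolding real_norm_def
    proof (intro exI[of _ n0] allI impI)
      fix t assume "t \<ge> n0"
      from n0[OF this] a[of t] b e_r
      show "\<bar>?FX t - ?FY\<bar> < r" by linarith
    qed
  qed
qed

text \<open>Continuous mapping and Slutsky in one step. Tightness confines \<open>W t\<close> to a ball,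
  where \<open>\<phi>\<close> is bounded and \<open>f\<close> is uniformly continuous on a neighbourhood of its image.\<close>

lemma conv_in_distribution_transfer:
  fixes W :: "nat \<Rightarrow> 'w \<Rightarrow> 'b::euclidean_space" and X :: "nat \<Rightarrow> 'w \<Rightarrow> 'c::euclidean_space"
  assumes P: "prob_space P"
    and conv: "conv_in_distribution P W Q Y"
    and tight: "\<And>e. e > 0 \<Longrightarrow> \<exists>K. \<forall>t. measure P {\<omega>\<in>space P. norm (W t \<omega>) > K} \<le> e"
    and X [measurable]: "\<And>t. X t \<in> borel_measurable P"
    and phi: "continuous_on UNIV \<phi>"
    and close: "\<And>\<eta>. \<eta> > 0 \<Longrightarrow> (\<lambda>t. measure P {\<omega>\<in>space P. dist (X t \<omega>) (\<phi> (W t \<omega>)) > \<eta>}) \<longlonglongrightarrow> 0"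
  shows "conv_in_distribution P X Q (\<lambda>\<omega>. \<phi> (Y \<omega>))"
  unfolding conv_in_distribution_def
proof (intro conjI allI impI X)
  interpret P: prob_space P by fact
  have W [measurable]: "\<And>t. W t \<in> borel_measurable P"
    and Y [measurable]: "Y \<in> borel_measurable Q"
    using conv by (auto simp: conv_in_distribution_def)
  have [measurable]: "\<phi> \<in> borel_measurable borel" using phi by (rule borel_measurable_continuous_onI)
  show "(\<lambda>\<omega>. \<phi> (Y \<omega>)) \<in> borel_measurable Q" by measurable
  fix f :: "'c \<Rightarrow> real" assume f: "continuous_on UNIV f \<and> bounded (range f)"
  then obtain B where B: "\<And>x. \<bar>f x\<bar> \<le> B" by (auto simp: bounded_iff)
  have B0: "B \<ge> 0" using B[of undefined] by linarith
  have f\<phi>: "continuous_on UNIV (\<lambda>x. f (\<phi> x))" "bounded (range (\<lambda>x. f (\<phi> x)))"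
    using f phi by (auto intro: continuous_on_compose2 simp: bounded_iff)
  let ?gap = "\<lambda>t. P.expectation (\<lambda>\<omega>. f (X t \<omega>)) - P.expectation (\<lambda>\<omega>. f (\<phi> (W t \<omega>)))"
  have "(\<lambda>t. ?gap t) \<longlonglongrightarrow> 0"
  proof (rule LIMSEQ_I)
    fix r :: real assume r: "r > 0"
    define e where "e = r / (2 + 4 * B)"
    have e: "e > 0" using r B0 by (simp add: e_def)
    obtain K where K: "\<And>t. P.prob {\<omega>\<in>space P. norm (W t \<omega>) > K} \<le> e/2"
      using tight[of "e/2"] e by auto
    have "compact (\<phi> ` cball 0 K)"
      using phi by (intro compact_continuous_image) (auto intro: continuous_on_subset)
    then obtain L where L: "\<And>x. norm x \<le> K \<Longrightarrow> norm (\<phi> x) \<le> L"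
      using compact_imp_bounded by (force simp: bounded_iff)
    have "uniformly_continuous_on (cball 0 (L + 1)) f"
      using f by (intro compact_uniformly_continuous) (auto intro: continuous_on_subset)
    then obtain d where d: "d > 0"
      "\<And>x y. norm x \<le> L + 1 \<Longrightarrow> norm y \<le> L + 1 \<Longrightarrow> dist y x < d \<Longrightarrow> \<bar>f y - f x\<bar> < e"
      using e unfolding uniformly_continuous_on_def by (metis dist_real_def mem_cball_0)
    define \<eta> where "\<eta> = min d 1 / 2"
    have \<eta>: "\<eta> > 0" "\<eta> < d" "\<eta> < 1" using d by (auto simp: \<eta>_def)
    obtain n0 where n0: "\<And>t. t \<ge> n0 \<Longrightarrow> P.prob {\<omega>\<in>space P. dist (X t \<omega>) (\<phi> (W t \<omega>)) > \<eta>} < e/2"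
      using LIMSEQ_D[OF close[OF \<eta>(1)], of "e/2"] e by auto
    have "\<bar>?gap t\<bar> < r" if t: "t \<ge> n0" for t
    proof -
      let ?A = "{\<omega>\<in>space P. norm (W t \<omega>) > K} \<union> {\<omega>\<in>space P. dist (X t \<omega>) (\<phi> (W t \<omega>)) > \<eta>}"
      have "P.prob ?A \<le> e/2 + e/2"
        using measure_Un_le[of "{\<omega>\<in>space P. norm (W t \<omega>) > K}" P "{\<omega>\<in>space P. dist (X t \<omega>) (\<phi> (W t \<omega>)) > \<eta>}"]
          K[of t] n0[OF t] by simp
      then have pA: "P.prob ?A \<le> e" by simp
      have "\<bar>?gap t\<bar> \<le> e + (2 * B) * e"
      proof (rule P.expectation_close[OF _ _ _ _ pA])
        show "integrable P (\<lambda>\<omega>. f (X t \<omega>))" using f P.integrable_bounded_comp[OF _ _ X] by blast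
        show "integrable P (\<lambda>\<omega>. f (\<phi> (W t \<omega>)))"
          using P.integrable_bounded_comp[OF f\<phi> W] .
        show "\<bar>f (X t \<omega>) - f (\<phi> (W t \<omega>))\<bar> \<le> 2 * B" for \<omega>
          using B[of "X t \<omega>"] B[of "\<phi> (W t \<omega>)"] by linarith
        fix \<omega> assume "\<omega> \<in> space P - ?A"
        then have *: "norm (W t \<omega>) \<le> K" "dist (X t \<omega>) (\<phi> (W t \<omega>)) \<le> \<eta>" by auto
        have "norm (X t \<omega>) \<le> L + 1"
          using L[OF *(1)] *(2) \<eta> norm_triangle_sub[of "X t \<omega>" "\<phi> (W t \<omega>)"] by (simp add: dist_norm)
        then show "\<bar>f (X t \<omega>) - f (\<phi> (W t \<omega>))\<bar> \<le> e"
          using d(2)[of "\<phi> (W t \<omega>)" "X t \<omega>"] L[OF *(1)] * \<eta> by (simp add: less_imp_le)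
      qed (use e in auto)
      also have "\<dots> < r"
      proof -
        have "(2 + 4 * B) * e = r" using B0 by (simp add: e_def)
        then show ?thesis using e mult_nonneg_nonneg[OF B0 less_imp_le[OF e]] by (simp add: algebra_simps)
      qed
      finally show ?thesis .
    qed
    then show "\<exists>n0. \<forall>t\<ge>n0. norm (?gap t - 0) < r"
      by auto
  qed
  moreover have "(\<lambda>t. P.expectation (\<lambda>\<omega>. f (\<phi> (W t \<omega>)))) \<longlonglongrightarrow> (\<integral>\<omega>. f (\<phi> (Y \<omega>)) \<partial>Q)"
    using conv f\<phi> unfolding conv_in_distribution_def by blast
  ultimately show "(\<lambda>t. P.expectation (\<lambda>\<omega>. f (X t \<omega>))) \<longlonglongrightarrow> (\<integral>\<omega>. f (\<phi> (Y \<omega>)) \<partial>Q)"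
    using tendsto_add by fastforce
qed

section \<open>Characteristic functions of normalized sums\<close>

lemma measurable_cis [measurable]: "cis \<in> borel_measurable borel"
  by (intro borel_measurable_continuous_onI continuous_intros)

text \<open>The central limit theorem counts summands from zero, the draws are counted from one.\<close>

lemma (in prob_space) indep_vars_Suc:
  assumes "indep_vars (\<lambda>_. K) X {1..}"
  shows "indep_vars (\<lambda>_. K) (\<lambda>i. X (Suc i)) UNIV"
  unfolding indep_vars_def2
proof
  show "\<forall>i\<in>UNIV. random_variable K (X (Suc i))" using assms unfolding indep_vars_def2 by auto
  define F where "F i = {X i -` A \<inter> space M | A. A \<in> sets K}" for i
  have F: "indep_sets F {1..}" using assms unfolding indep_vars_def2 F_def by simp
  have "indep_sets (\<lambda>i. F (Suc i)) UNIV"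
  proof (rule indep_setsI)
    show "F (Suc i) \<subseteq> events" for i using F by (auto simp: indep_sets_def)
    fix A J assume J: "J \<noteq> {}" "J \<subseteq> UNIV" "finite J" and A: "\<forall>j\<in>J. A j \<in> F (Suc j)"
    have "prob (\<Inter>k\<in>Suc ` J. A (k - 1)) = (\<Prod>k\<in>Suc ` J. prob (A (k - 1)))"
      using J A by (intro indep_setsD[OF F]) auto
    then show "prob (\<Inter>j\<in>J. A j) = (\<Prod>j\<in>J. prob (A j))"
      by (simp add: prod.reindex)
  qed
  then show "indep_sets (\<lambda>i. {X (Suc i) -` A \<inter> space M |A. A \<in> sets K}) UNIV" by (simp add: F_def)
qed

lemma (in prob_space) sum_second_moment:
  fixes X :: "nat \<Rightarrow> 'a \<Rightarrow> real"
  assumes indep: "indep_vars (\<lambda>_. borel) X I" and I: "finite I"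
    and mean: "\<And>i. i \<in> I \<Longrightarrow> expectation (X i) = 0"
    and sq: "\<And>i. i \<in> I \<Longrightarrow> integrable M (\<lambda>x. (X i x)\<^sup>2)"
    and var: "\<And>i. i \<in> I \<Longrightarrow> expectation (\<lambda>x. (X i x)\<^sup>2) = V"
  shows "integrable M (\<lambda>x. (\<Sum>i\<in>I. X i x)\<^sup>2)" and "expectation (\<lambda>x. (\<Sum>i\<in>I. X i x)\<^sup>2) = real (card I) * V"
proof -
  have rv: "X i \<in> borel_measurable M" if "i \<in> I" for i using indep that unfolding indep_vars_def2 by auto
  have int: "integrable M (X i)" if "i \<in> I" for i
    by (rule square_integrable_imp_integrable[OF rv[OF that] sq[OF that]])
  have "integrable M (\<lambda>x. X i x * X j x) \<and> expectation (\<lambda>x. X i x * X j x) = (if i = j then V else 0)"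
    if "i \<in> I" "j \<in> I" for i j
  proof (cases "i = j")
    case True
    then show ?thesis using sq[OF that(1)] var[OF that(1)] by (simp add: power2_eq_square)
  next
    case False
    have "indep_vars (\<lambda>_. borel) X {i, j}" using indep_vars_subset[OF indep, of "{i, j}"] that by simp
    then have "integrable M (\<lambda>x. \<Prod>k\<in>{i, j}. X k x)"
      "expectation (\<lambda>x. \<Prod>k\<in>{i, j}. X k x) = (\<Prod>k\<in>{i, j}. expectation (X k))"
      using int that by (auto intro!: indep_vars_integrable indep_vars_lebesgue_integral simp del: prod.insert)
    then show ?thesis using False mean[OF that(1)] by simp
  qed
  then have ij: "integrable M (\<lambda>x. X i x * X j x)" "expectation (\<lambda>x. X i x * X j x) = (if i = j then V else 0)"
    if "i \<in> I" "j \<in> I" for i j using that by auto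
  have sum: "(\<lambda>x. (\<Sum>i\<in>I. X i x)\<^sup>2) = (\<lambda>x. \<Sum>i\<in>I. \<Sum>j\<in>I. X i x * X j x)"
    by (simp add: power2_eq_square sum_product)
  show "integrable M (\<lambda>x. (\<Sum>i\<in>I. X i x)\<^sup>2)"
    unfolding sum using ij(1) by (intro Bochner_Integration.integrable_sum) auto
  have "expectation (\<lambda>x. (\<Sum>i\<in>I. X i x)\<^sup>2) = (\<Sum>i\<in>I. \<Sum>j\<in>I. if i = j then V else 0)"
    unfolding sum using ij by (simp add: Bochner_Integration.integral_sum cong: sum.cong)
  also have "\<dots> = real (card I) * V" using I by (simp add: sum.delta)
  finally show "expectation (\<lambda>x. (\<Sum>i\<in>I. X i x)\<^sup>2) = real (card I) * V" .
qed

text \<open>The degenerate case \<open>V = 0\<close> has to be split off, since the central limit theorem divides by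
  the standard deviation.\<close>

lemma (in prob_space) char_normalized_sum:
  fixes X :: "nat \<Rightarrow> 'a \<Rightarrow> real"
  assumes indep: "indep_vars (\<lambda>_. borel) X {1..}"
    and mean: "\<And>i. i \<ge> 1 \<Longrightarrow> expectation (X i) = 0"
    and sq: "\<And>i. i \<ge> 1 \<Longrightarrow> integrable M (\<lambda>x. (X i x)\<^sup>2)"
    and var: "\<And>i. i \<ge> 1 \<Longrightarrow> expectation (\<lambda>x. (X i x)\<^sup>2) = V"
    and law: "\<And>i. i \<ge> 1 \<Longrightarrow> distr M borel (X i) = \<mu>"
  shows "(\<lambda>t. expectation (\<lambda>x. cis ((\<Sum>i=1..t. X i x) / sqrt (real t)))) \<longlonglongrightarrow> exp (- V / 2)"
proof (cases "V = 0")
  case True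
  have rv: "X i \<in> borel_measurable M" if "i \<ge> 1" for i using indep that unfolding indep_vars_def2 by auto
  have AE0: "AE x in M. X i x = 0" if "i \<ge> 1" for i
    using integral_nonneg_eq_0_iff_AE[OF sq[OF that]] var[OF that] True by simp
  have "AE x in M. \<forall>i\<in>{1..}. X i x = 0" using AE0 by (subst AE_ball_countable) auto
  then have ae: "AE x in M. cis ((\<Sum>i=1..t. X i x) / sqrt (real t)) = 1" for t
    by eventually_elim simp
  have m: "(\<lambda>x. (\<Sum>i=1..t. X i x) / sqrt (real t)) \<in> borel_measurable M" for t
    using rv by (intro borel_measurable_divide borel_measurable_sum borel_measurable_const) simp
  have "expectation (\<lambda>x. cis ((\<Sum>i=1..t. X i x) / sqrt (real t))) = expectation (\<lambda>x. 1)" for t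
    by (rule integral_cong_AE[OF measurable_compose[OF m measurable_cis] _ ae]) simp
  then show ?thesis using True by (simp add: prob_space)
next
  case False
  have "0 \<le> expectation (\<lambda>x. (X 1 x)\<^sup>2)" by (rule integral_nonneg_AE) simp
  then have "V \<ge> 0" unfolding var[OF order_refl] .
  then have V: "V > 0" using False by simp
  define Y where "Y i = X (Suc i)" for i
  have Y: "indep_vars (\<lambda>_. borel) Y UNIV" unfolding Y_def by (rule indep_vars_Suc[OF indep])
  have Ym: "Y i \<in> borel_measurable M" for i using Y unfolding indep_vars_def2 by auto
  have conv: "weak_conv_m (\<lambda>n. distr M borel (\<lambda>x. (\<Sum>i<n. Y i x) / sqrt (real n * (sqrt V)\<^sup>2))) std_normal_distribution"
    by (rule central_limit_theorem_zero_mean[where \<mu> = \<mu>, OF Y])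
      (use V mean sq var law in \<open>auto simp: Y_def\<close>)
  have sum: "(\<Sum>i<t. Y i x) = (\<Sum>i=1..t. X i x)" for t x
    unfolding Y_def by (simp add: sum.atLeast1_atMost_eq lessThan_atLeast0)
  have Sm: "(\<lambda>x. (\<Sum>i<n. Y i x) / sqrt (real n * (sqrt V)\<^sup>2)) \<in> borel_measurable M" for n
    using Ym by auto
  have "(\<lambda>n. char (distr M borel (\<lambda>x. (\<Sum>i<n. Y i x) / sqrt (real n * (sqrt V)\<^sup>2))) (sqrt V)) \<longlonglongrightarrow>
      char std_normal_distribution (sqrt V)"
    by (rule levy_continuity1[OF _ _ conv]) (auto intro!: real_distribution_distr Sm real_dist_normal_dist)
  moreover have "char (distr M borel (\<lambda>x. (\<Sum>i<n. Y i x) / sqrt (real n * (sqrt V)\<^sup>2))) (sqrt V)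
      = expectation (\<lambda>x. cis ((\<Sum>i=1..n. X i x) / sqrt (real n)))" for n
  proof -
    have "char (distr M borel (\<lambda>x. (\<Sum>i<n. Y i x) / sqrt (real n * (sqrt V)\<^sup>2))) (sqrt V)
       = expectation (\<lambda>x. cis (sqrt V * ((\<Sum>i<n. Y i x) / sqrt (real n * (sqrt V)\<^sup>2))))"
      using Sm[of n] by (simp add: char_def integral_distr cis_conv_exp mult_ac)
    also have "\<dots> = expectation (\<lambda>x. cis ((\<Sum>i=1..n. X i x) / sqrt (real n)))"
      using V by (simp add: sum real_sqrt_mult)
    finally show ?thesis .
  qed
  ultimately show ?thesis using V by (simp add: char_std_normal_distribution)
qed

lemma (in prob_space) char_normal_law:
  fixes X :: "'a \<Rightarrow> real"
  assumes X [measurable]: "X \<in> borel_measurable M" and V: "V \<ge> 0" and law: "distr M borel X = normal_law 0 V"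
  shows "expectation (\<lambda>x. cis (X x)) = exp (- V / 2)"
proof (cases "V = 0")
  case True
  have "expectation (\<lambda>x. cis (X x)) = (\<integral>y. cis y \<partial>distr M borel X)"
    by (intro integral_distr[symmetric]) auto
  also have "\<dots> = cis 0" unfolding law using True by (simp add: normal_law_def integral_return)
  finally show ?thesis using True by simp
next
  case False
  then have V: "V > 0" using \<open>V \<ge> 0\<close> by simp
  have "distr M lborel X = distr M borel X" by (intro distr_cong) auto
  then have "distributed M lborel X (normal_density 0 (sqrt V))"
    unfolding distributed_def law using False by (auto simp: normal_law_def)
  then have "distributed M lborel (\<lambda>x. (X x - 0) / sqrt V) std_normal_density"
    using V by (subst (asm) normal_standard_normal_convert) auto
  then have "distr M lborel (\<lambda>x. X x / sqrt V) = std_normal_distribution"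
    using distributed_distr_eq_density by fastforce
  moreover have "distr M lborel (\<lambda>x. X x / sqrt V) = distr M borel (\<lambda>x. X x / sqrt V)" by (intro distr_cong) auto
  ultimately have "distr M borel (\<lambda>x. X x / sqrt V) = std_normal_distribution" by simp
  then have "char (distr M borel (\<lambda>x. X x / sqrt V)) (sqrt V) = exp (- V / 2)"
    using V by (simp add: char_std_normal_distribution)
  moreover have "char (distr M borel (\<lambda>x. X x / sqrt V)) (sqrt V) = expectation (\<lambda>x. cis (X x))"
    using V by (simp add: char_def integral_distr cis_conv_exp)
  ultimately show ?thesis by simp
qed

section \<open>Differentiability of the pacing objective\<close>

definition top_bid :: "('n::finite \<Rightarrow> 'a \<Rightarrow> real) \<Rightarrow> 'a \<Rightarrow> real^'n \<Rightarrow> real" where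
  "top_bid v x \<beta> = (MAX i. \<beta> $ i * v i x)"

lemma pacing_F_top_bid: "pacing_F b v x \<beta> = top_bid v x \<beta> - (\<Sum>i\<in>UNIV. b i * ln (\<beta> $ i))"
  by (simp add: pacing_F_def top_bid_def)

lemma top_bid_ge: "\<beta> $ i * v i x \<le> top_bid v x \<beta>"
  unfolding top_bid_def by (rule Max_ge) auto

lemma top_bid_attained: "\<exists>i. top_bid v x \<beta> = \<beta> $ i * v i x"
proof -
  have "Max (range (\<lambda>i. \<beta> $ i * v i x)) \<in> range (\<lambda>i. \<beta> $ i * v i x)" by (rule Max_in) auto
  then show ?thesis unfolding top_bid_def by (simp add: image_iff)
qed

lemma top_bid_le_iff: "top_bid v x \<beta> \<le> c \<longleftrightarrow> (\<forall>i. \<beta> $ i * v i x \<le> c)"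
  unfolding top_bid_def by (subst Max_le_iff) auto

lemma top_bid_eqI: "(\<And>i. \<beta> $ i * v i x \<le> \<beta> $ j * v j x) \<Longrightarrow> top_bid v x \<beta> = \<beta> $ j * v j x"
  by (meson order_antisym top_bid_ge top_bid_le_iff)

lemma convex_top_bid:
  fixes v :: "'n::finite \<Rightarrow> 'a \<Rightarrow> real"
  shows "convex_on UNIV (top_bid v x)"
proof (rule convex_onI)
  fix t :: real and \<beta> \<beta>' :: "real^'n"
  assume t: "0 < t" "t < 1"
  show "top_bid v x ((1 - t) *\<^sub>R \<beta> + t *\<^sub>R \<beta>') \<le> (1 - t) * top_bid v x \<beta> + t * top_bid v x \<beta>'"
    unfolding top_bid_le_iff
  proof
    fix i
    have "((1 - t) *\<^sub>R \<beta> + t *\<^sub>R \<beta>') $ i * v i x = (1 - t) * (\<beta> $ i * v i x) + t * (\<beta>' $ i * v i x)"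
      by (simp add: algebra_simps)
    also have "\<dots> \<le> (1 - t) * top_bid v x \<beta> + t * top_bid v x \<beta>'"
      using t by (intro add_mono mult_left_mono top_bid_ge) auto
    finally show "((1 - t) *\<^sub>R \<beta> + t *\<^sub>R \<beta>') $ i * v i x \<le> (1 - t) * top_bid v x \<beta> + t * top_bid v x \<beta>'" .
  qed
qed simp

lemma top_bid_second_difference_nonneg:
  "0 \<le> top_bid v x (\<beta> + u) + top_bid v x (\<beta> - u) - 2 * top_bid v x \<beta>"
proof -
  have "top_bid v x ((1 - 1/2) *\<^sub>R (\<beta> + u) + (1/2) *\<^sub>R (\<beta> - u))
      \<le> (1 - 1/2) * top_bid v x (\<beta> + u) + (1/2) * top_bid v x (\<beta> - u)"
    by (intro convex_onD[OF convex_top_bid]) auto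
  moreover have "(1 - 1/2) *\<^sub>R (\<beta> + u) + (1/2) *\<^sub>R (\<beta> - u) = \<beta>"
    by (simp add: algebra_simps scaleR_add_left[symmetric])
  ultimately show ?thesis by simp
qed

text \<open>For nonnegative valuations and positive multipliers these are the items at which the highest paced
  value is differentiable in the multipliers.\<close>

definition clear_winner :: "('n::finite \<Rightarrow> 'a \<Rightarrow> real) \<Rightarrow> real^'n \<Rightarrow> 'a \<Rightarrow> bool" where
  "clear_winner v \<beta> x \<longleftrightarrow> (\<forall>k. v k x = 0) \<or> (\<exists>j. \<forall>k. k \<noteq> j \<longrightarrow> \<beta> $ k * v k x < \<beta> $ j * v j x)"

definition winner_value :: "('n::finite \<Rightarrow> 'a \<Rightarrow> real) \<Rightarrow> real^'n \<Rightarrow> 'a \<Rightarrow> real^'n" where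
  "winner_value v \<beta> x = (\<chi> i. if \<forall>k. k \<noteq> i \<longrightarrow> \<beta> $ k * v k x < \<beta> $ i * v i x then v i x else 0)"

text \<open>The size of the kink of the maximum in the direction of buyer \<open>j\<close>, bounded from below.
  At positive multipliers some \<open>j\<close> has a positive tie value whenever there is no clear winner.\<close>

definition tie_value :: "('n::finite \<Rightarrow> 'a \<Rightarrow> real) \<Rightarrow> real^'n \<Rightarrow> 'n \<Rightarrow> 'a \<Rightarrow> real" where
  "tie_value v \<beta> j x =
     (if \<beta> $ j * v j x = top_bid v x \<beta> \<and> (\<exists>k. k \<noteq> j \<and> \<beta> $ k * v k x = top_bid v x \<beta>) then v j x else 0)"

text \<open>Raising \<open>\<beta> $ j\<close> raises the maximum by \<open>s * v j x\<close>, while lowering it leaves the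
  maximum to the tied competitor.\<close>

lemma tie_value_le_second_difference:
  assumes "s \<ge> 0"
  shows "s * tie_value v \<beta> j x
    \<le> top_bid v x (\<beta> + s *\<^sub>R axis j 1) + top_bid v x (\<beta> - s *\<^sub>R axis j 1) - 2 * top_bid v x \<beta>"
proof (cases "\<beta> $ j * v j x = top_bid v x \<beta> \<and> (\<exists>k. k \<noteq> j \<and> \<beta> $ k * v k x = top_bid v x \<beta>)")
  case True
  then obtain k where k: "k \<noteq> j" "\<beta> $ k * v k x = top_bid v x \<beta>" by blast
  have "(\<beta> + s *\<^sub>R axis j 1) $ j * v j x \<le> top_bid v x (\<beta> + s *\<^sub>R axis j 1)" by (rule top_bid_ge)
  moreover have "(\<beta> - s *\<^sub>R axis j 1) $ k * v k x \<le> top_bid v x (\<beta> - s *\<^sub>R axis j 1)" by (rule top_bid_ge)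
  ultimately show ?thesis using True k by (simp add: tie_value_def axis_def algebra_simps)
next
  case False
  then have "tie_value v \<beta> j x = 0" unfolding tie_value_def by (rule if_not_P)
  then show ?thesis using top_bid_second_difference_nonneg[of v x \<beta> "s *\<^sub>R axis j 1"] by simp
qed

lemma not_clear_winner_tie:
  assumes \<beta>: "\<beta> \<in> pos_orthant" and v: "\<And>i. v i x \<ge> 0" and tie: "\<not> clear_winner v \<beta> x"
  shows "\<exists>j. tie_value v \<beta> j x > 0"
proof -
  obtain j where j: "top_bid v x \<beta> = \<beta> $ j * v j x" using top_bid_attained[of v x \<beta>] by blast
  obtain i where "v i x \<noteq> 0" using tie by (auto simp: clear_winner_def)
  then have "0 < \<beta> $ i * v i x" using \<beta> v[of i] by (auto simp: pos_orthant_def less_le)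
  also have "\<dots> \<le> top_bid v x \<beta>" by (rule top_bid_ge)
  finally have "v j x \<noteq> 0" using j by auto
  then have vj: "v j x > 0" using v[of j] by simp
  obtain k where k: "k \<noteq> j" "\<not> \<beta> $ k * v k x < \<beta> $ j * v j x" using tie by (auto simp: clear_winner_def)
  then have "\<beta> $ k * v k x = top_bid v x \<beta>" using top_bid_ge[of \<beta> k v x] j by linarith
  then have "tie_value v \<beta> j x = v j x" using j k(1) by (auto simp: tie_value_def)
  then show ?thesis using vj by (intro exI[of _ j]) simp
qed

lemma GDERIV_top_bid:
  assumes "clear_winner v \<beta> x"
  shows "GDERIV (top_bid v x) \<beta> :> winner_value v \<beta> x"
proof (cases "\<forall>k. v k x = 0")
  case True
  then have "top_bid v x = (\<lambda>_. 0)" "winner_value v \<beta> x = 0"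
    by (auto simp: top_bid_def winner_value_def vec_eq_iff fun_eq_iff)
  then show ?thesis by (simp add: GDERIV_const)
next
  case False
  then obtain j where j: "\<And>k. k \<noteq> j \<Longrightarrow> \<beta> $ k * v k x < \<beta> $ j * v j x"
    using assms by (auto simp: clear_winner_def)
  define U where "U = (\<Inter>k\<in>UNIV - {j}. {\<gamma>::real^'a. \<gamma> $ k * v k x < \<gamma> $ j * v j x})"
  have U: "open U" unfolding U_def
    by (intro open_INT ballI open_Collect_less continuous_intros) auto
  have "winner_value v \<beta> x = v j x *\<^sub>R axis j 1"
    using j by (auto simp: winner_value_def vec_eq_iff axis_def) (metis less_asym)
  then have "(\<lambda>h. h \<bullet> winner_value v \<beta> x) = (\<lambda>h. h $ j * v j x)"
    by (simp add: fun_eq_iff inner_axis mult.commute)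
  moreover have "((\<lambda>\<gamma>::real^'a. \<gamma> $ j * v j x) has_derivative (\<lambda>h. h $ j * v j x)) (at \<beta>)"
    by (intro bounded_linear_imp_has_derivative bounded_linear_mult_const bounded_linear_vec_nth)
  ultimately have "((\<lambda>\<gamma>. \<gamma> $ j * v j x) has_derivative (\<lambda>h. h \<bullet> winner_value v \<beta> x)) (at \<beta>)" by simp
  then have "(top_bid v x has_derivative (\<lambda>h. h \<bullet> winner_value v \<beta> x)) (at \<beta>)"
  proof (rule has_derivative_transform_within_open[OF _ U])
    show "\<beta> \<in> U" using j by (auto simp: U_def)
    fix \<gamma> assume "\<gamma> \<in> U"
    then have "\<gamma> $ k * v k x \<le> \<gamma> $ j * v j x" for k by (cases "k = j") (auto simp: U_def less_imp_le)
    then show "\<gamma> $ j * v j x = top_bid v x \<gamma>" by (rule top_bid_eqI[symmetric])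
  qed
  then show ?thesis by (simp add: gderiv_def)
qed

lemma GDERIV_log_budget:
  assumes "\<beta> \<in> pos_orthant"
  shows "GDERIV (\<lambda>\<beta>. \<Sum>i\<in>UNIV. b i * ln (\<beta> $ i)) \<beta> :> (\<chi> i. b i / \<beta> $ i)"
proof -
  have "((\<lambda>\<beta>. \<Sum>i\<in>UNIV. b i * ln (\<beta> $ i)) has_derivative (\<lambda>h. \<Sum>i\<in>UNIV. b i * (h $ i / \<beta> $ i))) (at \<beta>)"
  proof (intro has_derivative_sum)
    fix i
    have "((\<lambda>\<beta>::real^'a. \<beta> $ i) has_derivative (\<lambda>h. h $ i)) (at \<beta>)"
      by (intro bounded_linear_imp_has_derivative bounded_linear_vec_nth)
    moreover have pos: "\<beta> $ i > 0" using assms by (simp add: pos_orthant_def)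
    have "(ln has_derivative (\<lambda>h. h / \<beta> $ i)) (at (\<beta> $ i))"
      using DERIV_ln[OF pos] unfolding has_field_derivative_def
      by (rule has_derivative_eq_rhs) (simp add: fun_eq_iff divide_inverse)
    ultimately have "((\<lambda>\<beta>. ln (\<beta> $ i)) has_derivative (\<lambda>h. h $ i / \<beta> $ i)) (at \<beta>)"
      by (rule has_derivative_compose)
    then show "((\<lambda>\<beta>. b i * ln (\<beta> $ i)) has_derivative (\<lambda>h. b i * (h $ i / \<beta> $ i))) (at \<beta>)"
      by (rule has_derivative_mult_right)
  qed
  moreover have "(\<lambda>h. \<Sum>i\<in>UNIV. b i * (h $ i / \<beta> $ i)) = (\<lambda>h. h \<bullet> (\<chi> i. b i / \<beta> $ i))"
    by (simp add: fun_eq_iff inner_vec_def mult_ac)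
  ultimately show ?thesis by (simp add: gderiv_def)
qed

lemma GDERIV_pacing_F:
  assumes "\<beta> \<in> pos_orthant" "clear_winner v \<beta> x"
  shows "GDERIV (pacing_F b v x) \<beta> :> winner_value v \<beta> x - (\<chi> i. b i / \<beta> $ i)"
proof -
  have "GDERIV (\<lambda>\<beta>. top_bid v x \<beta> - (\<Sum>i\<in>UNIV. b i * ln (\<beta> $ i))) \<beta> :> winner_value v \<beta> x - (\<chi> i. b i / \<beta> $ i)"
    using assms by (intro GDERIV_diff GDERIV_top_bid GDERIV_log_budget)
  then show ?thesis by (simp add: pacing_F_top_bid[abs_def])
qed

lemma not_GDERIV_pacing_F:
  assumes \<beta>: "\<beta> \<in> pos_orthant" and "\<And>i. v i x \<ge> 0" "\<not> clear_winner v \<beta> x"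
  shows "\<not> GDERIV (pacing_F b v x) \<beta> :> D"
proof
  assume "GDERIV (pacing_F b v x) \<beta> :> D"
  then have "GDERIV (\<lambda>\<beta>. pacing_F b v x \<beta> + (\<Sum>i\<in>UNIV. b i * ln (\<beta> $ i))) \<beta> :> D + (\<chi> i. b i / \<beta> $ i)"
    using \<beta> by (intro GDERIV_add GDERIV_log_budget)
  then have D: "GDERIV (top_bid v x) \<beta> :> D + (\<chi> i. b i / \<beta> $ i)" by (simp add: pacing_F_top_bid)
  obtain j where j: "tie_value v \<beta> j x > 0" using not_clear_winner_tie[OF \<beta> assms(2,3)] by blast
  have "tie_value v \<beta> j x \<le> 0"
  proof (rule tendsto_lowerbound[OF GDERIV_second_difference[OF D, of "axis j 1"]])
    show "eventually (\<lambda>s. tie_value v \<beta> j x \<le> (top_bid v x (\<beta> + s *\<^sub>R axis j 1)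
        + top_bid v x (\<beta> - s *\<^sub>R axis j 1) - 2 * top_bid v x \<beta>) / s) (at_right 0)"
      using eventually_at_right_less[of 0]
    proof eventually_elim
      case (elim s)
      then show ?case using tie_value_le_second_difference[of s v \<beta> j x] by (simp add: field_simps)
    qed
  qed simp
  then show False using j by simp
qed

text \<open>The value at non-differentiable items matters: the covariance is a Bochner integral, so
  the gradient must be measurable on the whole item space and not only outside a null set.\<close>

lemma grad_pacing_F:
  assumes "\<beta> \<in> pos_orthant" "\<And>i. v i x \<ge> 0"
  shows "grad (pacing_F b v x) \<beta> =
    (if clear_winner v \<beta> x then winner_value v \<beta> x - (\<chi> i. b i / \<beta> $ i) else (THE D. False))"
proof (cases "clear_winner v \<beta> x")
  case True
  then show ?thesis using grad_eq[OF GDERIV_pacing_F[OF assms(1) True]] by simp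
next
  case False
  have "\<not> GDERIV (pacing_F b v x) \<beta> :> D" for D
    by (rule not_GDERIV_pacing_F[OF assms False])
  then show ?thesis using False by (simp add: grad_def)
qed

lemma borel_measurable_vecI:
  fixes f :: "'a \<Rightarrow> real^'n::finite"
  assumes "\<And>i. (\<lambda>x. f x $ i) \<in> borel_measurable M"
  shows "f \<in> borel_measurable M"
  by (rule borel_measurable_euclidean_space[THEN iffD2]) (use assms in \<open>auto simp: Basis_vec_def inner_axis\<close>)

lemma measurable_vec_nth [measurable]:
  fixes f :: "'a \<Rightarrow> real^'n::finite"
  assumes [measurable]: "f \<in> borel_measurable M"
  shows "(\<lambda>x. f x $ i) \<in> borel_measurable M"
proof -
  have "(\<lambda>x. f x \<bullet> axis i 1) \<in> borel_measurable M" by measurable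
  then show ?thesis by (simp add: inner_axis)
qed

lemma measurable_top_bid [measurable]:
  assumes [measurable]: "\<And>i. v i \<in> borel_measurable M"
  shows "(\<lambda>x. top_bid v x \<beta>) \<in> borel_measurable M"
  unfolding top_bid_def by (intro borel_measurable_Max) auto

lemma measurable_pacing_F [measurable]:
  assumes [measurable]: "\<And>i. v i \<in> borel_measurable M"
  shows "(\<lambda>x. pacing_F b v x \<beta>) \<in> borel_measurable M"
  unfolding pacing_F_top_bid by measurable

lemma measurable_grad_pacing_F:
  assumes [measurable]: "\<And>i. v i \<in> borel_measurable M"
    and "\<beta> \<in> pos_orthant" "\<And>i x. x \<in> space M \<Longrightarrow> v i x \<ge> 0"
  shows "(\<lambda>x. grad (pacing_F b v x) \<beta>) \<in> borel_measurable M"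
proof -
  have [measurable]: "winner_value v \<beta> \<in> borel_measurable M"
    by (rule borel_measurable_vecI) (simp add: winner_value_def)
  have [measurable]: "Measurable.pred M (clear_winner v \<beta>)"
    unfolding clear_winner_def[abs_def] by measurable
  have "(\<lambda>x. if clear_winner v \<beta> x then winner_value v \<beta> x - (\<chi> i. b i / \<beta> $ i) else (THE D. False))
      \<in> borel_measurable M"
    by measurable
  then show ?thesis
    by (rule measurable_cong[THEN iffD2, rotated]) (simp add: grad_pacing_F assms)
qed

section \<open>The limit market\<close>

text \<open>\<open>N\<close> is the law of a single draw, that is, the measure with density \<open>s\<close>.\<close>

locale pacing_market = prob_space N for N :: "'a measure" +
  fixes b :: "'n::finite \<Rightarrow> real" and v :: "'n \<Rightarrow> 'a \<Rightarrow> real" and B :: real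
  assumes budget_pos: "b i > 0"
    and v_measurable [measurable]: "v i \<in> borel_measurable N"
    and v_nonneg: "x \<in> space N \<Longrightarrow> v i x \<ge> 0"
    and v_le: "x \<in> space N \<Longrightarrow> v i x \<le> B"
begin

definition mean_bid :: "real^'n \<Rightarrow> real" where
  "mean_bid \<beta> = expectation (\<lambda>x. top_bid v x \<beta>)"

definition H :: "real^'n \<Rightarrow> real" where
  "H \<beta> = expectation (\<lambda>x. pacing_F b v x \<beta>)"

lemma B_nonneg: "B \<ge> 0"
proof -
  obtain x where "x \<in> space N" using not_empty by blast
  then show ?thesis using v_nonneg[of x undefined] v_le[of x undefined] by linarith
qed

lemma top_bid_lipschitz:
  assumes x: "x \<in> space N"
  shows "\<bar>top_bid v x \<beta> - top_bid v x \<beta>'\<bar> \<le> B * norm (\<beta> - \<beta>')"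
proof -
  have "top_bid v x \<beta> \<le> top_bid v x \<beta>' + B * norm (\<beta> - \<beta>')" for \<beta> \<beta>' :: "real^'n"
    unfolding top_bid_le_iff
  proof
    fix i
    have "(\<beta> - \<beta>') $ i * v i x \<le> \<bar>(\<beta> - \<beta>') $ i\<bar> * v i x"
      using v_nonneg[OF x] by (intro mult_right_mono) auto
    also have "\<dots> \<le> norm (\<beta> - \<beta>') * B"
      using v_nonneg[OF x] v_le[OF x] component_le_norm_cart[of "\<beta> - \<beta>'" i] by (intro mult_mono) auto
    finally show "\<beta> $ i * v i x \<le> top_bid v x \<beta>' + B * norm (\<beta> - \<beta>')"
      using top_bid_ge[of \<beta>' i v x] by (simp add: algebra_simps)
  qed
  from this[of \<beta> \<beta>'] this[of \<beta>' \<beta>] show ?thesis by (simp add: norm_minus_commute abs_le_iff)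
qed

lemma top_bid_bound:
  assumes "x \<in> space N" shows "\<bar>top_bid v x \<beta>\<bar> \<le> B * norm \<beta>"
proof -
  have "top_bid v x 0 = 0" by (simp add: top_bid_def)
  then show ?thesis using top_bid_lipschitz[OF assms, of \<beta> 0] by simp
qed

lemma integrable_top_bid [simp]: "integrable N (\<lambda>x. top_bid v x \<beta>)"
  by (rule integrable_const_bound[of _ "B * norm \<beta>"]) (auto intro!: AE_I2 top_bid_bound)

lemma integrable_pacing_F [simp]: "integrable N (\<lambda>x. pacing_F b v x \<beta>)"
  unfolding pacing_F_top_bid by simp

lemma top_bid_nonneg: "x \<in> space N \<Longrightarrow> \<beta> \<in> pos_orthant \<Longrightarrow> 0 \<le> top_bid v x \<beta>"
  using top_bid_ge[of \<beta> undefined v x] v_nonneg[of x undefined]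
  by (auto simp: pos_orthant_def intro: order_trans[OF mult_nonneg_nonneg] less_imp_le)

sublocale limit: log_barrier b mean_bid
proof
  show "convex_on pos_orthant mean_bid"
  proof (rule convex_onI[OF _ convex_pos_orthant])
    fix t :: real and \<beta> \<beta>' :: "real^'n" assume t: "0 < t" "t < 1"
    have "mean_bid ((1 - t) *\<^sub>R \<beta> + t *\<^sub>R \<beta>') \<le> expectation (\<lambda>x. (1 - t) * top_bid v x \<beta> + t * top_bid v x \<beta>')"
      unfolding mean_bid_def using t by (intro integral_mono convex_onD[OF convex_top_bid]) auto
    then show "mean_bid ((1 - t) *\<^sub>R \<beta> + t *\<^sub>R \<beta>') \<le> (1 - t) * mean_bid \<beta> + t * mean_bid \<beta>'"
      by (simp add: mean_bid_def)
  qed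
  show "0 \<le> mean_bid \<beta>" if "\<beta> \<in> pos_orthant" for \<beta>
    unfolding mean_bid_def by (intro integral_nonneg_AE AE_I2 top_bid_nonneg that)
qed (rule budget_pos)

lemma H_obj: "H = limit.obj"
  by (simp add: H_def limit.obj_def mean_bid_def pacing_F_top_bid prob_space fun_eq_iff)

text \<open>Differentiability of the mean forces differentiability of almost every summand. The second difference
  quotient of the mean tends to 0 and dominates the expected tie value, which is nonnegative.\<close>

lemma AE_clear_winner:
  assumes \<beta>: "\<beta> \<in> pos_orthant" and D: "GDERIV H \<beta> :> D"
  shows "AE x in N. clear_winner v \<beta> x"
proof -
  have "GDERIV (\<lambda>\<beta>. H \<beta> + (\<Sum>i\<in>UNIV. b i * ln (\<beta> $ i))) \<beta> :> D + (\<chi> i. b i / \<beta> $ i)"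
    using \<beta> D by (intro GDERIV_add GDERIV_log_budget)
  then have mean: "GDERIV mean_bid \<beta> :> D + (\<chi> i. b i / \<beta> $ i)" by (simp add: H_obj limit.obj_def)
  have tie_meas [measurable]: "tie_value v \<beta> j \<in> borel_measurable N" for j
    unfolding tie_value_def[abs_def] by measurable
  have tie_nonneg: "0 \<le> tie_value v \<beta> j x" if "x \<in> space N" for j x
    using v_nonneg[OF that] by (simp add: tie_value_def)
  have tie_int: "integrable N (tie_value v \<beta> j)" for j
    by (rule integrable_const_bound[of _ B])
      (auto intro!: AE_I2 simp: tie_value_def v_nonneg v_le B_nonneg)
  have "AE x in N. tie_value v \<beta> j x = 0" for j
  proof -
    have "expectation (tie_value v \<beta> j) \<le> 0"
    proof (rule tendsto_lowerbound[OF GDERIV_second_difference[OF mean, of "axis j 1"]])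
      show "eventually (\<lambda>s. expectation (tie_value v \<beta> j) \<le> (mean_bid (\<beta> + s *\<^sub>R axis j 1)
          + mean_bid (\<beta> - s *\<^sub>R axis j 1) - 2 * mean_bid \<beta>) / s) (at_right 0)"
        using eventually_at_right_less[of 0]
      proof eventually_elim
        case (elim s)
        have "s * expectation (tie_value v \<beta> j) = expectation (\<lambda>x. s * tie_value v \<beta> j x)" by simp
        also have "\<dots> \<le> expectation (\<lambda>x. top_bid v x (\<beta> + s *\<^sub>R axis j 1)
            + top_bid v x (\<beta> - s *\<^sub>R axis j 1) - 2 * top_bid v x \<beta>)"
          using elim tie_int by (intro integral_mono tie_value_le_second_difference) auto
        also have "\<dots> = mean_bid (\<beta> + s *\<^sub>R axis j 1) + mean_bid (\<beta> - s *\<^sub>R axis j 1) - 2 * mean_bid \<beta>"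
          by (simp add: mean_bid_def)
        finally show ?case using elim by (simp add: field_simps)
      qed
    qed simp
    moreover have "expectation (tie_value v \<beta> j) \<ge> 0" by (intro integral_nonneg_AE AE_I2 tie_nonneg)
    ultimately have "expectation (tie_value v \<beta> j) = 0" by simp
    then show ?thesis
      by (subst (asm) integral_nonneg_eq_0_iff_AE[OF tie_int]) (auto intro: tie_nonneg)
  qed
  then have "AE x in N. \<forall>j. tie_value v \<beta> j x = 0" by (simp add: AE_all_countable)
  then show ?thesis
  proof (rule AE_mp[OF _ AE_I2[OF impI]])
    fix x assume "x \<in> space N" "\<forall>j. tie_value v \<beta> j x = 0"
    then show "clear_winner v \<beta> x"
      using not_clear_winner_tie[OF \<beta>, of v x] v_nonneg by fastforce
  qed
qed

end

locale smooth_pacing_market = pacing_market N b v B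
  for N :: "'a measure" and b :: "'n::finite \<Rightarrow> real" and v :: "'n \<Rightarrow> 'a \<Rightarrow> real" and B :: real +
  fixes \<beta> D :: "real^'n"
  assumes \<beta>_pos: "\<beta> \<in> pos_orthant" and D: "GDERIV H \<beta> :> D"
begin

text \<open>At items without a gradient this is the unspecified value of \<open>grad\<close>; it is harmless because such items
  form a null set and the value is a constant.\<close>

definition g :: "'a \<Rightarrow> real^'n" where
  "g x = grad (pacing_F b v x) \<beta>"

definition remainder :: "real^'n \<Rightarrow> 'a \<Rightarrow> real" where
  "remainder u x = pacing_F b v x (\<beta> + u) - pacing_F b v x \<beta> - g x \<bullet> u"

lemma AE_GDERIV_g: "AE x in N. GDERIV (pacing_F b v x) \<beta> :> g x"
  using AE_clear_winner[OF \<beta>_pos D]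
proof eventually_elim
  case (elim x)
  show ?case
    unfolding g_def grad_eq[OF GDERIV_pacing_F[OF \<beta>_pos elim]] by (rule GDERIV_pacing_F[OF \<beta>_pos elim])
qed

lemma measurable_g [measurable]: "g \<in> borel_measurable N"
  unfolding g_def[abs_def] by (intro measurable_grad_pacing_F v_measurable \<beta>_pos v_nonneg)

lemma g_bounded: "\<exists>C. \<forall>x\<in>space N. norm (g x) \<le> C"
proof (intro exI ballI)
  fix x assume x: "x \<in> space N"
  have "norm (winner_value v \<beta> x) \<le> (\<Sum>i\<in>UNIV. \<bar>winner_value v \<beta> x $ i\<bar>)" by (rule norm_le_l1_cart)
  also have "\<dots> \<le> (\<Sum>i\<in>(UNIV::'n set). B)"
    using v_nonneg[OF x] v_le[OF x] B_nonneg by (intro sum_mono) (auto simp: winner_value_def)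
  finally have "norm (winner_value v \<beta> x) \<le> real CARD('n) * B" by simp
  then have "norm (winner_value v \<beta> x - (\<chi> i. b i / \<beta> $ i)) \<le> real CARD('n) * B + norm (\<chi> i. b i / \<beta> $ i)"
    using norm_triangle_ineq4 by (rule order_trans[rotated, OF add_right_mono])
  then show "norm (g x) \<le> max (norm (THE D::real^'n. False)) (real CARD('n) * B + norm (\<chi> i. b i / \<beta> $ i))"
    by (auto simp: g_def grad_pacing_F[of \<beta> v x b, OF \<beta>_pos v_nonneg[OF x]])
qed

lemma integrable_g_comp:
  "integrable N (\<lambda>x. g x \<bullet> h)" "integrable N g"
proof -
  obtain C where C: "\<And>x. x \<in> space N \<Longrightarrow> norm (g x) \<le> C" using g_bounded by blast
  show "integrable N g" by (rule integrable_const_bound[of _ C]) (auto intro!: AE_I2 C)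
  then show "integrable N (\<lambda>x. g x \<bullet> h)" by simp
qed

lemma measurable_remainder [measurable]: "remainder u \<in> borel_measurable N"
  unfolding remainder_def[abs_def] by measurable

lemma pacing_F_increment_bound:
  "\<exists>C r0. r0 > 0 \<and> (\<forall>x\<in>space N. \<forall>u. norm u \<le> r0 \<longrightarrow> \<bar>pacing_F b v x (\<beta> + u) - pacing_F b v x \<beta>\<bar> \<le> C * norm u)"
proof -
  define L where "L = (\<lambda>\<beta>::real^'n. \<Sum>i\<in>UNIV. b i * ln (\<beta> $ i))"
  define d :: "real^'n" where "d = (\<chi> i. b i / \<beta> $ i)"
  have "(L has_derivative (\<lambda>h. h \<bullet> d)) (at \<beta>)"
    using GDERIV_log_budget[OF \<beta>_pos] unfolding gderiv_def L_def d_def .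
  then obtain r where r: "r > 0" "\<And>y. norm (y - \<beta>) < r \<Longrightarrow> norm (L y - L \<beta> - (y - \<beta>) \<bullet> d) \<le> 1 * norm (y - \<beta>)"
    unfolding has_derivative_at_alt using zero_less_one by blast
  have "\<bar>pacing_F b v x (\<beta> + u) - pacing_F b v x \<beta>\<bar> \<le> (B + 1 + norm d) * norm u"
    if "x \<in> space N" "norm u \<le> r / 2" for x u
  proof -
    have "\<bar>L (\<beta> + u) - L \<beta> - u \<bullet> d\<bar> \<le> norm u" using r(2)[of "\<beta> + u"] that r(1) by simp
    moreover have "\<bar>u \<bullet> d\<bar> \<le> norm u * norm d" by (rule Cauchy_Schwarz_ineq2)
    moreover have "\<bar>top_bid v x (\<beta> + u) - top_bid v x \<beta>\<bar> \<le> B * norm u"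
      using top_bid_lipschitz[OF that(1), of "\<beta> + u" \<beta>] by simp
    moreover have "pacing_F b v x (\<beta> + u) - pacing_F b v x \<beta>
        = (top_bid v x (\<beta> + u) - top_bid v x \<beta>) - (L (\<beta> + u) - L \<beta> - u \<bullet> d) - u \<bullet> d"
      by (simp add: pacing_F_top_bid L_def)
    ultimately show ?thesis by (simp add: algebra_simps)
  qed
  then show ?thesis using r(1) by (intro exI[of _ "B + 1 + norm d"] exI[of _ "r / 2"]) auto
qed

lemma eventually_small_at_top:
  fixes h :: "real^'n"
  assumes "r > 0" shows "eventually (\<lambda>k. norm (h /\<^sub>R k) \<le> r) at_top"
proof -
  have "((\<lambda>k. norm (h /\<^sub>R k)) \<longlongrightarrow> norm (0 *\<^sub>R h)) at_top"
    by (intro tendsto_intros tendsto_inverse_0_at_top filterlim_ident)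
  then have "eventually (\<lambda>k. norm (h /\<^sub>R k) < r) at_top" using assms by (intro order_tendstoD(2)) auto
  then show ?thesis by eventually_elim simp
qed

text \<open>Difference quotients are indexed by the reciprocal step \<open>k\<close>, which later becomes the square root of
  the sample size.\<close>

lemma difference_quotient_at_top:
  assumes "GDERIV f \<beta> :> D'"
  shows "((\<lambda>k. k * (f (\<beta> + h /\<^sub>R k) - f \<beta>)) \<longlongrightarrow> D' \<bullet> h) at_top"
  using GDERIV_quotient_limit[OF assms, of h]
  unfolding filterlim_at_right_to_top by (simp add: divide_inverse mult.commute)

text \<open>Differentiation under the integral, with the Lipschitz bound of the objective as dominating function.\<close>

lemma expectation_g: "expectation g = D"
proof -
  obtain C r0 where r0: "r0 > 0"
    and C: "\<And>x u. x \<in> space N \<Longrightarrow> norm u \<le> r0 \<Longrightarrow> \<bar>pacing_F b v x (\<beta> + u) - pacing_F b v x \<beta>\<bar> \<le> C * norm u"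
    using pacing_F_increment_bound by blast
  have "expectation (\<lambda>x. g x \<bullet> h) = D \<bullet> h" for h
  proof (rule tendsto_unique)
    let ?\<Delta> = "\<lambda>k x. pacing_F b v x (\<beta> + h /\<^sub>R k) - pacing_F b v x \<beta>"
    have "((\<lambda>k. expectation (\<lambda>x. k * ?\<Delta> k x)) \<longlongrightarrow> expectation (\<lambda>x. g x \<bullet> h)) at_top"
    proof (rule integral_dominated_convergence_at_top[where w = "\<lambda>_. C * norm h"])
      show "AE x in N. ((\<lambda>k. k * ?\<Delta> k x) \<longlongrightarrow> g x \<bullet> h) at_top"
        using AE_GDERIV_g by eventually_elim (rule difference_quotient_at_top)
      show "eventually (\<lambda>k. AE x in N. norm (k * ?\<Delta> k x) \<le> C * norm h) at_top"
        using eventually_small_at_top[OF r0, of h] eventually_gt_at_top[of 0]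
      proof eventually_elim
        case (elim k)
        have "norm (k * ?\<Delta> k x) \<le> C * norm h" if "x \<in> space N" for x
        proof -
          have "norm (k * ?\<Delta> k x)
              = k * \<bar>?\<Delta> k x\<bar>"
            using elim unfolding real_norm_def abs_mult by simp
          also have "\<dots> \<le> k * (C * norm (h /\<^sub>R k))"
            using elim C[OF that elim(1)] by (intro mult_left_mono) auto
          also have "\<dots> = C * norm h" using elim by simp
          finally show ?thesis .
        qed
        then show ?case by (intro AE_I2)
      qed
    qed auto
    then show "((\<lambda>k. k * (H (\<beta> + h /\<^sub>R k) - H \<beta>)) \<longlongrightarrow> expectation (\<lambda>x. g x \<bullet> h)) at_top"
      by (simp add: H_def)
    show "((\<lambda>k. k * (H (\<beta> + h /\<^sub>R k) - H \<beta>)) \<longlongrightarrow> D \<bullet> h) at_top"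
      by (rule difference_quotient_at_top[OF D])
  qed simp
  then have "expectation g \<bullet> h = D \<bullet> h" for h
    using integral_inner_left[where c = h and M = N and f = g] integrable_g_comp(2) by metis
  then show ?thesis by (rule vector_eq_rdot[THEN iffD1, OF allI])
qed

lemma remainder_bound:
  "\<exists>C r0. C \<ge> 0 \<and> r0 > 0 \<and> (\<forall>x\<in>space N. \<forall>u. norm u \<le> r0 \<longrightarrow> \<bar>remainder u x\<bar> \<le> C * norm u)"
proof -
  obtain C r0 where r0: "r0 > 0"
    and C: "\<And>x u. x \<in> space N \<Longrightarrow> norm u \<le> r0 \<Longrightarrow> \<bar>pacing_F b v x (\<beta> + u) - pacing_F b v x \<beta>\<bar> \<le> C * norm u"
    using pacing_F_increment_bound by blast
  obtain Cg where Cg: "\<And>x. x \<in> space N \<Longrightarrow> norm (g x) \<le> Cg" using g_bounded by blast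
  have "\<bar>remainder u x\<bar> \<le> max 0 (C + Cg) * norm u" if "x \<in> space N" "norm u \<le> r0" for x u
  proof -
    have "\<bar>g x \<bullet> u\<bar> \<le> Cg * norm u"
      using Cauchy_Schwarz_ineq2[of "g x" u] mult_right_mono[OF Cg[OF that(1)], of "norm u"] by auto
    then have "\<bar>remainder u x\<bar> \<le> (C + Cg) * norm u"
      using C[OF that] by (simp add: remainder_def algebra_simps)
    also have "\<dots> \<le> max 0 (C + Cg) * norm u" by (intro mult_right_mono) auto
    finally show ?thesis .
  qed
  then show ?thesis using r0 by (intro exI[of _ "max 0 (C + Cg)"] exI[of _ r0]) auto
qed

lemma integrable_remainder: "integrable N (remainder u)"
  unfolding remainder_def[abs_def] using integrable_g_comp by simp

lemma expectation_remainder: "expectation (remainder u) = H (\<beta> + u) - H \<beta> - D \<bullet> u"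
proof -
  have "expectation (\<lambda>x. g x \<bullet> u) = D \<bullet> u"
    using integrable_g_comp(2) expectation_g by (cases "u = 0") auto
  then show ?thesis
    unfolding remainder_def[abs_def] using integrable_g_comp by (simp add: H_def)
qed

text \<open>The remainder is of smaller order than its argument almost everywhere and at most linear
  uniformly in the item, so dominated convergence applies. The limit controls the
  variance of the sample remainder.\<close>

lemma remainder_square_limit:
  "((\<lambda>k. expectation (\<lambda>x. (k * remainder (h /\<^sub>R k) x)\<^sup>2)) \<longlongrightarrow> 0) at_top"
proof -
  obtain C r0 where r0: "r0 > 0" and C0: "C \<ge> 0"
    and C: "\<And>x u. x \<in> space N \<Longrightarrow> norm u \<le> r0 \<Longrightarrow> \<bar>remainder u x\<bar> \<le> C * norm u"
    using remainder_bound by blast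
  have "((\<lambda>k. expectation (\<lambda>x. (k * remainder (h /\<^sub>R k) x)\<^sup>2)) \<longlongrightarrow> expectation (\<lambda>x. 0)) at_top"
  proof (rule integral_dominated_convergence_at_top[where w = "\<lambda>_. (C * norm h)\<^sup>2"])
    show "AE x in N. ((\<lambda>k. (k * remainder (h /\<^sub>R k) x)\<^sup>2) \<longlongrightarrow> 0) at_top"
      using AE_GDERIV_g
    proof eventually_elim
      case (elim x)
      have "((\<lambda>k. k * (pacing_F b v x (\<beta> + h /\<^sub>R k) - pacing_F b v x \<beta>) - g x \<bullet> h) \<longlongrightarrow> g x \<bullet> h - g x \<bullet> h) at_top"
        by (intro tendsto_diff difference_quotient_at_top[OF elim] tendsto_const)
      then have "((\<lambda>k. k * remainder (h /\<^sub>R k) x) \<longlongrightarrow> g x \<bullet> h - g x \<bullet> h) at_top"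
      proof (rule Lim_transform_eventually)
        show "eventually (\<lambda>k. k * (pacing_F b v x (\<beta> + h /\<^sub>R k) - pacing_F b v x \<beta>) - g x \<bullet> h
            = k * remainder (h /\<^sub>R k) x) at_top"
          using eventually_gt_at_top[of 0]
          by eventually_elim (simp add: remainder_def field_simps)
      qed
      then have "((\<lambda>k. (k * remainder (h /\<^sub>R k) x)\<^sup>2) \<longlongrightarrow> (g x \<bullet> h - g x \<bullet> h)\<^sup>2) at_top"
        by (intro tendsto_intros)
      then show ?case by simp
    qed
    show "eventually (\<lambda>k. AE x in N. norm ((k * remainder (h /\<^sub>R k) x)\<^sup>2) \<le> (C * norm h)\<^sup>2) at_top"
      using eventually_small_at_top[OF r0, of h] eventually_gt_at_top[of 0]
    proof eventually_elim
      case (elim k)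
      have "norm ((k * remainder (h /\<^sub>R k) x)\<^sup>2) \<le> (C * norm h)\<^sup>2" if "x \<in> space N" for x
      proof -
        have "k * \<bar>remainder (h /\<^sub>R k) x\<bar> \<le> k * (C * norm (h /\<^sub>R k))"
          using elim C[OF that elim(1)] by (intro mult_left_mono) auto
        then have "\<bar>k * remainder (h /\<^sub>R k) x\<bar> \<le> C * norm h" using elim by (simp add: abs_mult field_simps)
        then have "\<bar>k * remainder (h /\<^sub>R k) x\<bar>\<^sup>2 \<le> (C * norm h)\<^sup>2" by (intro power_mono) auto
        then show ?thesis by simp
      qed
      then show ?case by (intro AE_I2)
    qed
  qed auto
  then show ?thesis by simp
qed

end

section \<open>Sampled markets\<close>

lemma (in pacing_market) sample_log_barrier:
  assumes x: "\<And>\<tau>. \<tau> \<in> {1..t} \<Longrightarrow> x \<tau> \<in> space N" and t: "t \<ge> 1"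
  shows "log_barrier b (\<lambda>\<beta>. 1 / real t * (\<Sum>\<tau>=1..t. top_bid v (x \<tau>) \<beta>))"
    and "sample_H b v x t = log_barrier.obj b (\<lambda>\<beta>. 1 / real t * (\<Sum>\<tau>=1..t. top_bid v (x \<tau>) \<beta>))"
proof -
  show lb: "log_barrier b (\<lambda>\<beta>. 1 / real t * (\<Sum>\<tau>=1..t. top_bid v (x \<tau>) \<beta>))"
  proof
    have "convex_on UNIV (\<lambda>\<beta>. \<Sum>\<tau>\<in>I. top_bid v (x \<tau>) \<beta>)" if "finite I" for I
      using that by induction (auto simp: convex_on_const intro!: convex_on_add convex_top_bid)
    then have "convex_on UNIV (\<lambda>\<beta>. \<Sum>\<tau>=1..t. top_bid v (x \<tau>) \<beta>)" by simp
    then show "convex_on pos_orthant (\<lambda>\<beta>. 1 / real t * (\<Sum>\<tau>=1..t. top_bid v (x \<tau>) \<beta>))"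
      by (intro convex_on_cmul) (auto intro: convex_on_subset convex_pos_orthant)
    show "0 \<le> 1 / real t * (\<Sum>\<tau>=1..t. top_bid v (x \<tau>) \<beta>)" if "\<beta> \<in> pos_orthant" for \<beta>
      using that x by (intro mult_nonneg_nonneg sum_nonneg top_bid_nonneg) auto
  qed (rule budget_pos)
  show "sample_H b v x t = log_barrier.obj b (\<lambda>\<beta>. 1 / real t * (\<Sum>\<tau>=1..t. top_bid v (x \<tau>) \<beta>))"
    unfolding fun_eq_iff log_barrier.obj_def[OF lb] using t
    by (simp add: sample_H_def pacing_F_top_bid sum_subtractf right_diff_distrib diff_divide_distrib)
qed

locale pacing_sample = smooth_pacing_market N b v B \<beta> D + P: prob_space P
  for N :: "'a measure" and b :: "'n::finite \<Rightarrow> real" and v :: "'n \<Rightarrow> 'a \<Rightarrow> real" and B :: real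
    and \<beta> D :: "real^'n" and P :: "'w measure" +
  fixes \<theta> :: "nat \<Rightarrow> 'w \<Rightarrow> 'a"
  assumes draws_indep: "P.indep_vars (\<lambda>_. N) \<theta> {1..}"
    and draws_law: "\<tau> \<ge> 1 \<Longrightarrow> distr P N (\<theta> \<tau>) = N"
begin

lemma draw_measurable: "\<tau> \<ge> 1 \<Longrightarrow> \<theta> \<tau> \<in> measurable P N"
  using draws_indep unfolding P.indep_vars_def2 by auto

lemma draw_in_space: "\<tau> \<ge> 1 \<Longrightarrow> \<omega> \<in> space P \<Longrightarrow> \<theta> \<tau> \<omega> \<in> space N"
  using draw_measurable by (rule measurable_space)

lemma expectation_draw:
  fixes u :: "'a \<Rightarrow> 'c::{banach, second_countable_topology}"
  assumes "\<tau> \<ge> 1" "u \<in> borel_measurable N"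
  shows "P.expectation (\<lambda>\<omega>. u (\<theta> \<tau> \<omega>)) = expectation u"
  using integral_distr[OF draw_measurable[OF assms(1)] assms(2)] draws_law[OF assms(1)] by simp

lemma integrable_draw:
  fixes u :: "'a \<Rightarrow> 'c::{banach, second_countable_topology}"
  assumes "\<tau> \<ge> 1" "u \<in> borel_measurable N"
  shows "integrable P (\<lambda>\<omega>. u (\<theta> \<tau> \<omega>)) \<longleftrightarrow> integrable N u"
  using integrable_distr_eq[OF draw_measurable[OF assms(1)] assms(2)] draws_law[OF assms(1)] by simp

lemma centred_draws:
  fixes u :: "'a \<Rightarrow> real"
  assumes u: "u \<in> borel_measurable N" and sq: "integrable N (\<lambda>x. (u x)\<^sup>2)"
  defines "X \<equiv> \<lambda>\<tau> \<omega>. u (\<theta> \<tau> \<omega>) - expectation u" and "V \<equiv> expectation (\<lambda>x. (u x - expectation u)\<^sup>2)"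
  shows "P.indep_vars (\<lambda>_. borel) X {1..}"
    and "\<tau> \<ge> 1 \<Longrightarrow> P.expectation (X \<tau>) = 0"
    and "\<tau> \<ge> 1 \<Longrightarrow> integrable P (\<lambda>\<omega>. (X \<tau> \<omega>)\<^sup>2)"
    and "\<tau> \<ge> 1 \<Longrightarrow> P.expectation (\<lambda>\<omega>. (X \<tau> \<omega>)\<^sup>2) = V"
    and "\<tau> \<ge> 1 \<Longrightarrow> distr P borel (X \<tau>) = distr N borel (\<lambda>x. u x - expectation u)"
proof -
  note [measurable] = u
  have u_int: "integrable N u" by (rule square_integrable_imp_integrable[OF u sq])
  have c_sq: "integrable N (\<lambda>x. (u x - expectation u)\<^sup>2)"
    using sq u_int by (simp add: power2_diff)
  show "P.indep_vars (\<lambda>_. borel) X {1..}"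
    unfolding X_def by (rule P.indep_vars_compose2[OF draws_indep]) simp
  assume \<tau>: "\<tau> \<ge> 1"
  show "P.expectation (X \<tau>) = 0"
    unfolding X_def using expectation_draw[OF \<tau>, of "\<lambda>x. u x - expectation u"] u_int by (simp add: prob_space)
  show "integrable P (\<lambda>\<omega>. (X \<tau> \<omega>)\<^sup>2)"
    unfolding X_def using integrable_draw[OF \<tau>, of "\<lambda>x. (u x - expectation u)\<^sup>2"] c_sq by simp
  show "P.expectation (\<lambda>\<omega>. (X \<tau> \<omega>)\<^sup>2) = V"
    unfolding X_def V_def using expectation_draw[OF \<tau>, of "\<lambda>x. (u x - expectation u)\<^sup>2"] by simp
  have "distr (distr P N (\<theta> \<tau>)) borel (\<lambda>x. u x - expectation u) = distr P borel (X \<tau>)"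
    unfolding X_def using draw_measurable[OF \<tau>] by (subst distr_distr) (auto simp: comp_def)
  then show "distr P borel (X \<tau>) = distr N borel (\<lambda>x. u x - expectation u)"
    by (simp add: draws_law[OF \<tau>])
qed

lemma centred_sum_second_moment:
  fixes u :: "'a \<Rightarrow> real" and t :: nat
  assumes u: "u \<in> borel_measurable N" and sq: "integrable N (\<lambda>x. (u x)\<^sup>2)"
  shows "integrable P (\<lambda>\<omega>. (\<Sum>\<tau>=1..t. u (\<theta> \<tau> \<omega>) - expectation u)\<^sup>2)"
    and "P.expectation (\<lambda>\<omega>. (\<Sum>\<tau>=1..t. u (\<theta> \<tau> \<omega>) - expectation u)\<^sup>2)
      = real t * expectation (\<lambda>x. (u x - expectation u)\<^sup>2)"
proof -
  have ind: "P.indep_vars (\<lambda>_. borel) (\<lambda>\<tau> \<omega>. u (\<theta> \<tau> \<omega>) - expectation u) {1..t}"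
    by (rule P.indep_vars_subset[OF centred_draws(1)[OF u sq]]) auto
  note * = P.sum_second_moment[OF ind finite_atLeastAtMost, of "expectation (\<lambda>x. (u x - expectation u)\<^sup>2)"]
  show "integrable P (\<lambda>\<omega>. (\<Sum>\<tau>=1..t. u (\<theta> \<tau> \<omega>) - expectation u)\<^sup>2)"
    using centred_draws(2-4)[OF u sq] by (intro *(1)) auto
  show "P.expectation (\<lambda>\<omega>. (\<Sum>\<tau>=1..t. u (\<theta> \<tau> \<omega>) - expectation u)\<^sup>2)
      = real t * expectation (\<lambda>x. (u x - expectation u)\<^sup>2)"
    using centred_draws(2-4)[OF u sq] by (subst *(2)) auto
qed

definition score :: "nat \<Rightarrow> 'w \<Rightarrow> real^'n" where
  "score t \<omega> = (1 / sqrt (real t)) *\<^sub>R (\<Sum>\<tau>=1..t. g (\<theta> \<tau> \<omega>) - D)"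

lemma measurable_score [measurable]: "score t \<in> borel_measurable P"
  unfolding score_def[abs_def]
  by (intro borel_measurable_scaleR borel_measurable_const borel_measurable_sum borel_measurable_diff
      measurable_compose[OF draw_measurable measurable_g]) auto

lemma g_square_integrable: "integrable N (\<lambda>x. (a \<bullet> g x)\<^sup>2)"
proof -
  obtain C where C: "\<And>x. x \<in> space N \<Longrightarrow> norm (g x) \<le> C" using g_bounded by blast
  show ?thesis
  proof (rule integrable_const_bound[of _ "(norm a * C)\<^sup>2"])
    have "\<bar>a \<bullet> g x\<bar>\<^sup>2 \<le> (norm a * C)\<^sup>2" if "x \<in> space N" for x
      using Cauchy_Schwarz_ineq2[of a "g x"] mult_left_mono[OF C[OF that], of "norm a"]
      by (intro power_mono) auto
    then show "AE x in N. norm ((a \<bullet> g x)\<^sup>2) \<le> (norm a * C)\<^sup>2" by (intro AE_I2) simp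
  qed measurable
qed

definition score_var :: "real^'n \<Rightarrow> real" where
  "score_var a = expectation (\<lambda>x. (a \<bullet> g x - a \<bullet> D)\<^sup>2)"

lemma score_var_nonneg: "score_var a \<ge> 0"
  unfolding score_var_def by (rule integral_nonneg_AE) simp

lemma expectation_inner_g: "expectation (\<lambda>x. a \<bullet> g x) = a \<bullet> D"
  using integral_inner_right[where c = a and M = N and f = g] integrable_g_comp(2) expectation_g by metis

lemma inner_score:
  "a \<bullet> score t \<omega> = (\<Sum>\<tau>=1..t. a \<bullet> g (\<theta> \<tau> \<omega>) - expectation (\<lambda>x. a \<bullet> g x)) / sqrt (real t)"
  by (simp add: score_def expectation_inner_g inner_sum_right inner_diff_right)

lemma score_char: "(\<lambda>t. P.expectation (\<lambda>\<omega>. cis (a \<bullet> score t \<omega>))) \<longlonglongrightarrow> exp (- score_var a / 2)"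
proof -
  have m: "(\<lambda>x. a \<bullet> g x) \<in> borel_measurable N" by measurable
  note c = centred_draws[OF m g_square_integrable]
  show ?thesis
    unfolding inner_score
    by (rule P.char_normalized_sum[OF c(1)]) (use c(2-5) in \<open>auto simp: score_var_def expectation_inner_g\<close>)
qed

lemma score_second_moment:
  "integrable P (\<lambda>\<omega>. (a \<bullet> score t \<omega>)\<^sup>2)" "P.expectation (\<lambda>\<omega>. (a \<bullet> score t \<omega>)\<^sup>2) \<le> score_var a"
proof -
  have m: "(\<lambda>x. a \<bullet> g x) \<in> borel_measurable N" by measurable
  note c = centred_sum_second_moment[OF m g_square_integrable, of t]
  show "integrable P (\<lambda>\<omega>. (a \<bullet> score t \<omega>)\<^sup>2)"
    unfolding inner_score power_divide using c(1) by simp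
  show "P.expectation (\<lambda>\<omega>. (a \<bullet> score t \<omega>)\<^sup>2) \<le> score_var a"
    unfolding inner_score power_divide using c(2) score_var_nonneg[of a] by (simp add: score_var_def expectation_inner_g)
qed

lemma score_tight:
  assumes e: "e > 0"
  shows "\<exists>K. \<forall>t. P.prob {\<omega>\<in>space P. norm (score t \<omega>) > K} \<le> e"
proof -
  define T where "T = (\<Sum>i\<in>Basis. score_var i) + 1"
  have T: "T > 0" unfolding T_def by (intro add_nonneg_pos sum_nonneg score_var_nonneg) simp
  define K where "K = sqrt (T / e)"
  have K: "K > 0" "K\<^sup>2 = T / e" using T e by (auto simp: K_def)
  have "P.prob {\<omega>\<in>space P. norm (score t \<omega>) > K} \<le> e" for t
  proof -
    have sq: "(norm (score t \<omega>))\<^sup>2 = (\<Sum>i\<in>Basis. (i \<bullet> score t \<omega>)\<^sup>2)" for \<omega>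
      unfolding power2_norm_eq_inner by (subst euclidean_inner) (simp add: power2_eq_square inner_commute)
    have int: "integrable P (\<lambda>\<omega>. (norm (score t \<omega>))\<^sup>2)"
      unfolding sq by (intro Bochner_Integration.integrable_sum score_second_moment)
    have "P.prob {\<omega>\<in>space P. norm (score t \<omega>) > K} \<le> P.prob {\<omega>\<in>space P. (norm (score t \<omega>))\<^sup>2 \<ge> K\<^sup>2}"
      using K(1) by (intro P.finite_measure_mono) (auto intro!: power_mono)
    also have "\<dots> \<le> P.expectation (\<lambda>\<omega>. (norm (score t \<omega>))\<^sup>2) / K\<^sup>2"
      using K(1) int by (intro integral_Markov_inequality_measure[where A = "{}"]) auto
    also have "P.expectation (\<lambda>\<omega>. (norm (score t \<omega>))\<^sup>2) = (\<Sum>i\<in>Basis. P.expectation (\<lambda>\<omega>. (i \<bullet> score t \<omega>)\<^sup>2))"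
      unfolding sq by (intro Bochner_Integration.integral_sum score_second_moment)
    also have "\<dots> / K\<^sup>2 \<le> T / K\<^sup>2"
      unfolding T_def using score_second_moment(2)
      by (intro divide_right_mono) (auto intro!: sum_mono add_increasing2)
    also have "\<dots> = e" using K T e by simp
    finally show ?thesis .
  qed
  then show ?thesis by blast
qed

definition sample_remainder :: "nat \<Rightarrow> real^'n \<Rightarrow> 'w \<Rightarrow> real" where
  "sample_remainder t h \<omega> = (\<Sum>\<tau>=1..t. remainder (h /\<^sub>R sqrt (real t)) (\<theta> \<tau> \<omega>))"

lemma measurable_sample_remainder [measurable]: "sample_remainder t h \<in> borel_measurable P"
  unfolding sample_remainder_def[abs_def]
  by (intro borel_measurable_sum measurable_compose[OF draw_measurable measurable_remainder]) auto

text \<open>An exact identity, without any almost-sure qualification: the remainder is defined from the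
  same vectors \<open>g\<close> that enter the score.\<close>

lemma local_objective_expansion:
  assumes t: "t \<ge> 1"
  shows "real t * (sample_H b v (\<lambda>\<tau>. \<theta> \<tau> \<omega>) t (\<beta> + h /\<^sub>R sqrt (real t)) - sample_H b v (\<lambda>\<tau>. \<theta> \<tau> \<omega>) t \<beta>)
    = score t \<omega> \<bullet> h + sqrt (real t) * (D \<bullet> h) + sample_remainder t h \<omega>"
proof -
  define u where "u = h /\<^sub>R sqrt (real t)"
  have st: "sqrt (real t) > 0" "sqrt (real t) * sqrt (real t) = real t" using t by auto
  have h: "h = sqrt (real t) *\<^sub>R u" using st by (simp add: u_def)
  have "real t * (sample_H b v (\<lambda>\<tau>. \<theta> \<tau> \<omega>) t (\<beta> + u) - sample_H b v (\<lambda>\<tau>. \<theta> \<tau> \<omega>) t \<beta>)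
      = (\<Sum>\<tau>=1..t. pacing_F b v (\<theta> \<tau> \<omega>) (\<beta> + u) - pacing_F b v (\<theta> \<tau> \<omega>) \<beta>)"
    using t by (simp add: sample_H_def sum_subtractf right_diff_distrib)
  also have "\<dots> = (\<Sum>\<tau>=1..t. (g (\<theta> \<tau> \<omega>) - D) \<bullet> u) + real t * (D \<bullet> u) + (\<Sum>\<tau>=1..t. remainder u (\<theta> \<tau> \<omega>))"
    by (simp add: remainder_def sum_subtractf sum.distrib inner_diff_left)
  also have "(\<Sum>\<tau>=1..t. (g (\<theta> \<tau> \<omega>) - D) \<bullet> u) = score t \<omega> \<bullet> h"
    using st by (simp add: score_def h inner_sum_left)
  also have "real t * (D \<bullet> u) = sqrt (real t) * (D \<bullet> h)" using st(2) by (simp add: h mult.assoc[symmetric])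
  finally show ?thesis by (simp add: sample_remainder_def u_def)
qed

lemma remainder_square_integrable: "integrable N (\<lambda>x. (remainder u x)\<^sup>2)"
proof -
  obtain Cg where Cg: "\<And>x. x \<in> space N \<Longrightarrow> norm (g x) \<le> Cg" using g_bounded by blast
  define L where "L = (\<lambda>\<beta>::real^'n. \<Sum>i\<in>UNIV. b i * ln (\<beta> $ i))"
  define C where "C = B * norm u + \<bar>L (\<beta> + u) - L \<beta>\<bar> + Cg * norm u"
  have "\<bar>remainder u x\<bar> \<le> C" if "x \<in> space N" for x
  proof -
    have "remainder u x = (top_bid v x (\<beta> + u) - top_bid v x \<beta>) - (L (\<beta> + u) - L \<beta>) - g x \<bullet> u"
      by (simp add: remainder_def pacing_F_top_bid L_def)
    moreover have "\<bar>top_bid v x (\<beta> + u) - top_bid v x \<beta>\<bar> \<le> B * norm u"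
      using top_bid_lipschitz[OF that, of "\<beta> + u" \<beta>] by simp
    moreover have "\<bar>g x \<bullet> u\<bar> \<le> Cg * norm u"
      using Cauchy_Schwarz_ineq2[of "g x" u] mult_right_mono[OF Cg[OF that], of "norm u"] by auto
    ultimately show ?thesis unfolding C_def by linarith
  qed
  then have "\<bar>remainder u x\<bar>\<^sup>2 \<le> C\<^sup>2" if "x \<in> space N" for x
    using that by (intro power_mono) auto
  then show ?thesis by (intro integrable_const_bound[of _ "C\<^sup>2"] AE_I2) auto
qed

text \<open>Chebyshev: by the assumed second-order expansion the mean of the sample remainder tends to \<open>q\<close>, and its
  variance is at most the second moment of the scaled single-item remainder.\<close>

lemma sample_remainder_limit:
  assumes lim: "((\<lambda>s. (H (\<beta> + s *\<^sub>R h) - H \<beta> - s * (D \<bullet> h)) / s\<^sup>2) \<longlongrightarrow> q) (at_right 0)" and e: "e > 0"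
  shows "(\<lambda>t. P.prob {\<omega>\<in>space P. \<bar>sample_remainder t h \<omega> - q\<bar> > e}) \<longlonglongrightarrow> 0"
proof -
  let ?dev = "\<lambda>t. {\<omega>\<in>space P. \<bar>sample_remainder t h \<omega> - q\<bar> > e}"
  define u where "u t = h /\<^sub>R sqrt (real t)" for t
  define mu where "mu t = real t * expectation (remainder (u t))" for t
  define sec where "sec t = expectation (\<lambda>x. (sqrt (real t) * remainder (u t) x)\<^sup>2)" for t
  have sqrt_top: "filterlim (\<lambda>t. sqrt (real t)) at_top sequentially"
    by (intro filterlim_compose[OF sqrt_at_top filterlim_real_sequentially])
  have sec: "sec \<longlonglongrightarrow> 0"
    unfolding sec_def u_def by (rule filterlim_compose[OF remainder_square_limit sqrt_top])
  have "((\<lambda>k. (H (\<beta> + inverse k *\<^sub>R h) - H \<beta> - inverse k * (D \<bullet> h)) / (inverse k)\<^sup>2) \<longlongrightarrow> q) at_top"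
    using lim unfolding filterlim_at_right_to_top .
  from filterlim_compose[OF this sqrt_top]
  have "(\<lambda>t. (H (\<beta> + inverse (sqrt (real t)) *\<^sub>R h) - H \<beta> - inverse (sqrt (real t)) * (D \<bullet> h))
      / (inverse (sqrt (real t)))\<^sup>2) \<longlonglongrightarrow> q" .
  moreover have "(H (\<beta> + inverse (sqrt (real t)) *\<^sub>R h) - H \<beta> - inverse (sqrt (real t)) * (D \<bullet> h))
      / (inverse (sqrt (real t)))\<^sup>2 = mu t" for t
    by (simp add: mu_def expectation_remainder u_def power_inverse divide_inverse)
  ultimately have mu: "mu \<longlonglongrightarrow> q" by simp
  have bound: "P.prob (?dev t) \<le> sec t / (e/2)\<^sup>2"
    if t: "\<bar>mu t - q\<bar> < e/2" for t
  proof -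
    note c = centred_sum_second_moment[OF measurable_remainder[of "u t"] remainder_square_integrable[of "u t"], of t]
    have eq: "(\<Sum>\<tau>=1..t. remainder (u t) (\<theta> \<tau> \<omega>) - expectation (remainder (u t))) = sample_remainder t h \<omega> - mu t" for \<omega>
      by (simp add: sample_remainder_def mu_def u_def sum_subtractf)
    have "P.prob (?dev t)
        \<le> P.prob {\<omega>\<in>space P. (sample_remainder t h \<omega> - mu t)\<^sup>2 \<ge> (e/2)\<^sup>2}"
    proof (intro P.finite_measure_mono subsetI)
      fix \<omega> assume \<omega>: "\<omega> \<in> ?dev t"
      then have "\<bar>sample_remainder t h \<omega> - q\<bar> > e" by simp
      then have "e/2 \<le> \<bar>sample_remainder t h \<omega> - mu t\<bar>" using t by linarith
      then have "(e/2)\<^sup>2 \<le> \<bar>sample_remainder t h \<omega> - mu t\<bar>\<^sup>2" using e by (intro power_mono) auto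
      then show "\<omega> \<in> {\<omega>\<in>space P. (sample_remainder t h \<omega> - mu t)\<^sup>2 \<ge> (e/2)\<^sup>2}" using \<omega> by simp
    qed measurable
    also have "\<dots> \<le> P.expectation (\<lambda>\<omega>. (sample_remainder t h \<omega> - mu t)\<^sup>2) / (e/2)\<^sup>2"
      using c(1) e unfolding eq by (intro integral_Markov_inequality_measure[where A = "{}"]) auto
    also have "P.expectation (\<lambda>\<omega>. (sample_remainder t h \<omega> - mu t)\<^sup>2) = real t * variance (remainder (u t))"
      using c(2) unfolding eq .
    also have "variance (remainder (u t)) = expectation (\<lambda>x. (remainder (u t) x)\<^sup>2) - (expectation (remainder (u t)))\<^sup>2"
      by (rule variance_eq[OF integrable_remainder remainder_square_integrable])
    also have "real t * \<dots> / (e/2)\<^sup>2 \<le> real t * expectation (\<lambda>x. (remainder (u t) x)\<^sup>2) / (e/2)\<^sup>2"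
      by (intro divide_right_mono mult_left_mono) auto
    also have "real t * expectation (\<lambda>x. (remainder (u t) x)\<^sup>2) = sec t"
      by (simp add: sec_def power_mult_distrib)
    finally show ?thesis .
  qed
  show ?thesis
  proof (rule tendsto_sandwich[OF _ _ tendsto_const])
    show "eventually (\<lambda>t. 0 \<le> P.prob (?dev t)) sequentially" by simp
    have "eventually (\<lambda>t. dist (mu t) q < e/2) sequentially" using tendstoD[OF mu, of "e/2"] e by simp
    then show "eventually (\<lambda>t. P.prob (?dev t) \<le> sec t / (e/2)\<^sup>2) sequentially"
      by eventually_elim (simp add: bound dist_real_def)
    have "(\<lambda>t. sec t / (e/2)\<^sup>2) \<longlonglongrightarrow> 0 / (e/2)\<^sup>2" using e by (intro tendsto_divide sec tendsto_const) auto
    then show "(\<lambda>t. sec t / (e/2)\<^sup>2) \<longlonglongrightarrow> 0" by simp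
  qed
qed

end

section \<open>Comparison of the scaled error with the quadratic program\<close>

text \<open>The leftover budgets \<open>- D\<close> are nonnegative and vanish for paced buyers, so the penalty
  in the rescaled problem acts only on unpaced buyers with leftover budget.\<close>

lemma (in pacing_market) first_order_condition:
  assumes min: "is_min_on H pacing_box \<beta>" and D: "GDERIV H \<beta> :> D"
  shows "\<beta> $ i < 1 \<Longrightarrow> D $ i = 0" and "D $ i \<le> 0"
proof -
  have box: "\<beta> \<in> pacing_box" using min by (simp add: is_min_on_def)
  have dir: "0 \<le> D \<bullet> h" if "eventually (\<lambda>s. \<beta> + s *\<^sub>R h \<in> pacing_box) (at_right 0)" for h
  proof (rule tendsto_lowerbound[OF GDERIV_quotient_limit[OF D, of h]])
    show "eventually (\<lambda>s. 0 \<le> (H (\<beta> + s *\<^sub>R h) - H \<beta>) / s) (at_right 0)"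
      using that eventually_at_right_less[of 0]
    proof eventually_elim
      case (elim s)
      then show ?case using min by (simp add: is_min_on_def)
    qed
  qed simp
  have "0 \<le> D \<bullet> (- axis i 1)"
  proof (rule dir)
    have "0 < \<beta> $ i" using box by (simp add: pacing_box_def)
    then show "eventually (\<lambda>s. \<beta> + s *\<^sub>R (- axis i 1) \<in> pacing_box) (at_right 0)"
      unfolding eventually_at_right_field using box
      by (intro exI[of _ "\<beta> $ i"]) (auto simp: pacing_box_def axis_def algebra_simps add_increasing)
  qed
  then show neg: "D $ i \<le> 0" by (simp add: inner_axis)
  assume i: "\<beta> $ i < 1"
  have "0 \<le> D \<bullet> (axis i 1)"
  proof (rule dir)
    show "eventually (\<lambda>s. \<beta> + s *\<^sub>R (axis i 1) \<in> pacing_box) (at_right 0)"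
      unfolding eventually_at_right_field using box i
      by (intro exI[of _ "1 - \<beta> $ i"]) (auto simp: pacing_box_def axis_def add_pos_pos)
  qed
  then show "D $ i = 0" using neg by (simp add: inner_axis)
qed

lemma convex_affine_vimage:
  assumes "convex T" shows "convex {h. a + c *\<^sub>R h \<in> T}"
proof (rule convexI)
  fix x y and u v :: real
  assume xy: "x \<in> {h. a + c *\<^sub>R h \<in> T}" "y \<in> {h. a + c *\<^sub>R h \<in> T}" and uv: "0 \<le> u" "0 \<le> v" "u + v = 1"
  have "u *\<^sub>R (a + c *\<^sub>R x) + v *\<^sub>R (a + c *\<^sub>R y) = (u + v) *\<^sub>R a + c *\<^sub>R (u *\<^sub>R x + v *\<^sub>R y)"
    by (simp add: algebra_simps)
  then show "u *\<^sub>R x + v *\<^sub>R y \<in> {h. a + c *\<^sub>R h \<in> T}"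
    using convexD[OF assms, of "a + c *\<^sub>R x" "a + c *\<^sub>R y" u v] xy uv by simp
qed

lemma convex_on_affine:
  assumes "convex_on T f"
  shows "convex_on {h. a + c *\<^sub>R h \<in> T} (\<lambda>h. f (a + c *\<^sub>R h))"
proof (rule convex_onI)
  have eq: "a + c *\<^sub>R ((1 - t) *\<^sub>R x + t *\<^sub>R y) = (1 - t) *\<^sub>R (a + c *\<^sub>R x) + t *\<^sub>R (a + c *\<^sub>R y)" for t x y
    by (simp add: algebra_simps)
  fix t :: real and x y
  assume "0 < t" "t < 1" "x \<in> {h. a + c *\<^sub>R h \<in> T}" "y \<in> {h. a + c *\<^sub>R h \<in> T}"
  then show "f (a + c *\<^sub>R ((1 - t) *\<^sub>R x + t *\<^sub>R y)) \<le> (1 - t) * f (a + c *\<^sub>R x) + t * f (a + c *\<^sub>R y)"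
    unfolding eq using convex_onD[OF assms, of t] by simp
next
  have "convex T" using assms by (rule convex_on_imp_convex)
  then show "convex {h. a + c *\<^sub>R h \<in> T}" by (rule convex_affine_vimage)
qed

lemma convex_pacing_box: "convex (pacing_box :: (real^'n::finite) set)"
proof -
  have eq: "pacing_box = pos_orthant \<inter> (\<Inter>i. {\<beta>::real^'n. \<beta> $ i \<le> 1})"
    by (auto simp: pacing_box_def pos_orthant_def)
  have half: "convex {\<beta>::real^'n. \<beta> $ i \<le> 1}" for i
    using convex_halfspace_le[of "axis i 1 :: real^'n" 1] by (simp add: inner_axis' inner_real_def)
  show ?thesis unfolding eq by (intro convex_Int convex_INT convex_pos_orthant half)
qed

context pacing_sample
begin

abbreviation sample_obj :: "nat \<Rightarrow> 'w \<Rightarrow> real^'n \<Rightarrow> real" where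
  "sample_obj t \<omega> \<equiv> sample_H b v (\<lambda>\<tau>. \<theta> \<tau> \<omega>) t"

abbreviation sample_min :: "nat \<Rightarrow> 'w \<Rightarrow> real^'n" where
  "sample_min t \<omega> \<equiv> beta_sample b v (\<lambda>\<tau>. \<theta> \<tau> \<omega>) t"

lemma sample_objective:
  assumes t: "t \<ge> 1" and \<omega>: "\<omega> \<in> space P"
  shows "is_min_on (sample_obj t \<omega>) pacing_box (sample_min t \<omega>)"
    and "convex_on pos_orthant (sample_obj t \<omega>)"
    and "continuous_on pos_orthant (sample_obj t \<omega>)"
    and "y \<in> pacing_box \<Longrightarrow>
      sample_obj t \<omega> (sample_min t \<omega>) + log_barrier.b_min b / 4 * (norm (y - sample_min t \<omega>))\<^sup>2 \<le> sample_obj t \<omega> y"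
    and "log_barrier.b_min b > 0"
proof -
  have sp: "\<theta> \<tau> \<omega> \<in> space N" if "\<tau> \<in> {1..t}" for \<tau> using draw_in_space \<omega> that by auto
  note lb = sample_log_barrier[where x = "\<lambda>\<tau>. \<theta> \<tau> \<omega>", OF sp t]
  interpret L: log_barrier b "\<lambda>\<beta>. 1 / real t * (\<Sum>\<tau>=1..t. top_bid v (\<theta> \<tau> \<omega>) \<beta>)" by (rule lb(1))
  have min: "is_min_on L.obj pacing_box (sample_min t \<omega>)"
  proof -
    obtain x where "is_min_on L.obj pacing_box x" using L.obj_min_exists by blast
    then have "is_min_on L.obj pacing_box (arg_min_on L.obj pacing_box)" by (rule is_min_on_arg_min_on)
    then show ?thesis by (simp only: beta_sample_def lb(2))
  qed
  then show "is_min_on (sample_obj t \<omega>) pacing_box (sample_min t \<omega>)" by (simp only: lb(2))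
  show "convex_on pos_orthant (sample_obj t \<omega>)" "continuous_on pos_orthant (sample_obj t \<omega>)"
    by (simp_all only: lb(2) L.convex_obj L.continuous_obj)
  show "sample_obj t \<omega> (sample_min t \<omega>) + L.b_min / 4 * (norm (y - sample_min t \<omega>))\<^sup>2 \<le> sample_obj t \<omega> y"
    if "y \<in> pacing_box" using L.obj_growth[OF min that] by (simp only: lb(2))
  show "L.b_min > 0" by (rule L.b_min(1))
qed

lemma measurable_sample_min:
  assumes t: "t \<ge> 1" shows "sample_min t \<in> borel_measurable P"
proof (rule measurable_well_posed_argmin[where f = "sample_obj t" and S = pacing_box and c = "log_barrier.b_min b / 4"])
  show "(\<lambda>\<omega>. sample_obj t \<omega> y) \<in> borel_measurable P" for y
    unfolding sample_H_def
    by (intro borel_measurable_times borel_measurable_const borel_measurable_sum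
        measurable_compose[OF draw_measurable measurable_pacing_F[OF v_measurable]]) auto
  show "continuous_on pacing_box (sample_obj t \<omega>)" if "\<omega> \<in> space P" for \<omega>
    using sample_objective(3)[OF t that] pacing_box_subset by (rule continuous_on_subset)
  obtain \<omega> where "\<omega> \<in> space P" using P.not_empty by blast
  from sample_objective(5)[OF t this] show "log_barrier.b_min b / 4 > 0" by simp
  show "sample_min t \<omega> \<in> pacing_box" if "\<omega> \<in> space P" for \<omega>
    using sample_objective(1)[OF t that] by (simp add: is_min_on_def)
  show "sample_obj t \<omega> (sample_min t \<omega>) + log_barrier.b_min b / 4 * (norm (y - sample_min t \<omega>))\<^sup>2 \<le> sample_obj t \<omega> y"
    if "\<omega> \<in> space P" "y \<in> pacing_box" for \<omega> y
    using sample_objective(4)[OF t that] .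
qed

definition scaled_error :: "nat \<Rightarrow> 'w \<Rightarrow> real^'n" where
  "scaled_error t \<omega> = sqrt (real t) *\<^sub>R (sample_min t \<omega> - \<beta>)"

lemma measurable_scaled_error [measurable]: "scaled_error t \<in> borel_measurable P"
proof (cases "t \<ge> 1")
  case True
  note [measurable] = measurable_sample_min[OF True]
  show ?thesis unfolding scaled_error_def[abs_def] by measurable
next
  case False
  then have "scaled_error t = (\<lambda>_. 0)" by (simp add: scaled_error_def fun_eq_iff)
  then show ?thesis by simp
qed

text \<open>Apply the deterministic stability lemma on the event that the score is bounded and
  that the sample remainder is close to its limit at finitely many test points; convexity of the remainder turns
  the latter into uniform closeness on a ball. The complement of this event has small probability by tightness and
  by pointwise convergence of the remainder.\<close>

lemma scaled_error_close_to_quadratic_min: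
  fixes A :: "real^'n^'n"
  defines "C \<equiv> {h::real^'n. (\<forall>i\<in>{i. \<beta> $ i = 1 \<and> D $ i < 0}. h $ i = 0) \<and>
    (\<forall>i\<in>{i. \<beta> $ i = 1 \<and> D $ i = 0}. h $ i \<le> 0)}"
  assumes min: "is_min_on H pacing_box \<beta>" and A: "pos_def_matrix A c"
    and second: "\<And>h. ((\<lambda>s. (H (\<beta> + s *\<^sub>R h) - H \<beta> - s * (D \<bullet> h)) / s\<^sup>2) \<longlongrightarrow> (h \<bullet> (A *v h)) / 2) (at_right 0)"
    and \<phi>: "\<And>w. is_min_on (quad_form A w) C (\<phi> w)" and \<phi>_meas: "\<phi> \<in> borel_measurable borel"
    and \<eta>: "\<eta> > 0"
  shows "(\<lambda>t. P.prob {\<omega>\<in>space P. dist (scaled_error t \<omega>) (\<phi> (score t \<omega>)) > \<eta>}) \<longlonglongrightarrow> 0"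
proof (rule LIMSEQ_I)
  interpret A: pos_def_matrix A c by fact
  note [measurable] = \<phi>_meas
  define I where "I = {i. \<beta> $ i = 1 \<and> D $ i < 0}"
  define J where "J = {i. \<beta> $ i = 1 \<and> D $ i = 0}"
  define q where "q h = (h \<bullet> (A *v h)) / 2" for h
  have box: "\<beta> \<in> pacing_box" using min by (simp add: is_min_on_def)
  have foc: "\<And>i. \<beta> $ i < 1 \<Longrightarrow> D $ i = 0" "\<And>i. D $ i \<le> 0" using first_order_condition[OF min D] by auto
  have IJ: "\<beta> $ i < 1" if "i \<notin> I" "i \<notin> J" for i
    using that box foc(2)[of i] by (force simp: I_def J_def pacing_box_def less_le)
  have D_out: "D $ i = 0" if "i \<notin> I" for i
    using that foc(1)[of i] IJ[of i] by (auto simp: J_def)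
  fix \<epsilon> :: real assume \<epsilon>: "\<epsilon> > 0"
  obtain K0 where K0: "\<And>t. P.prob {\<omega>\<in>space P. norm (score t \<omega>) > K0} \<le> \<epsilon> / 2"
    using score_tight[of "\<epsilon> / 2"] \<epsilon> by auto
  define K where "K = max 0 K0"
  have K: "P.prob {\<omega>\<in>space P. norm (score t \<omega>) > K} \<le> \<epsilon> / 2" for t
    by (rule order_trans[OF P.finite_measure_mono K0[of t]]) (auto simp: K_def)
  have "K \<ge> 0" by (simp add: K_def)
  have \<delta>: "i \<in> I \<Longrightarrow> (- D) $ i > 0" "i \<notin> I \<Longrightarrow> (- D) $ i = 0" for i
    using D_out[of i] by (simp add: I_def, simp)
  have C: "{h. (\<forall>i\<in>I. h $ i = 0) \<and> (\<forall>i\<in>J. h $ i \<le> 0)} = C" by (simp add: C_def I_def J_def)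
  obtain e \<rho> r0 where e: "e > 0"
    and stab: "\<forall>r w Z S x x0.
      r \<ge> r0 \<and> norm w \<le> K \<and> convex S \<and> (\<forall>h\<in>S. \<forall>i\<in>I \<union> J. h $ i \<le> 0) \<and> C \<inter> cball 0 \<rho> \<subseteq> S \<and> convex_on S Z \<and>
      (\<forall>h\<in>S. norm h \<le> \<rho> \<longrightarrow> \<bar>Z h - (quad_form A w h - r * (- D \<bullet> h))\<bar> \<le> e) \<and>
      is_min_on Z S x \<and> is_min_on (quad_form A w) C x0 \<longrightarrow> norm (x - x0) \<le> \<eta>"
    using A.constrained_argmin_stability[where I = I and J = J, OF \<delta> \<open>K \<ge> 0\<close> \<eta>] unfolding C by metis
  have q_cont: "continuous_on (cball 0 (\<rho> + 2)) q"
    unfolding q_def by (intro continuous_intros) auto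
  obtain E e' where E: "finite E" and e': "e' > 0"
    and unif: "\<forall>T h. convex_on (cball 0 (\<rho> + 2)) T \<and> (\<forall>d\<in>E. \<bar>T d - q d\<bar> \<le> e') \<and> norm h \<le> \<rho>
       \<longrightarrow> \<bar>T h - q h\<bar> \<le> e"
    using convex_uniformly_close[OF q_cont e] by metis
  let ?dev = "\<lambda>t d. {\<omega>\<in>space P. \<bar>sample_remainder t d \<omega> - q d\<bar> > e'}"
  \<comment> \<open>Perturbations of \<open>\<beta>\<close> by less than \<open>m\<close> stay positive, and stay below 1 in the coordinates of paced buyers.\<close>
  define m where "m = Min (insert 1 (range (\<lambda>i. \<beta> $ i) \<union> (\<lambda>i. 1 - \<beta> $ i) ` {i. \<beta> $ i < 1}))"
  have m: "m > 0" "\<And>i. m \<le> \<beta> $ i" "\<And>i. \<beta> $ i < 1 \<Longrightarrow> \<beta> $ i + m \<le> 1"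
  proof -
    show "m > 0" using box by (auto simp: m_def pacing_box_def)
    show "m \<le> \<beta> $ i" for i unfolding m_def by (rule Min_le) auto
    show "\<beta> $ i + m \<le> 1" if "\<beta> $ i < 1" for i
    proof -
      have "m \<le> 1 - \<beta> $ i" unfolding m_def using that by (intro Min_le) auto
      then show ?thesis by simp
    qed
  qed
  have sqrt_top: "filterlim (\<lambda>t. sqrt (real t)) at_top sequentially"
    by (intro filterlim_compose[OF sqrt_at_top filterlim_real_sequentially])
  have "(\<lambda>t. \<Sum>d\<in>E. P.prob (?dev t d)) \<longlonglongrightarrow> (\<Sum>d\<in>E. 0)"
    unfolding q_def by (intro tendsto_sum sample_remainder_limit second e')
  then have "eventually (\<lambda>t. (\<Sum>d\<in>E. P.prob (?dev t d)) < \<epsilon> / 2) sequentially"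
    using \<epsilon> by (intro order_tendstoD(2)) auto
  moreover have "eventually (\<lambda>t. sqrt (real t) \<ge> r0) sequentially"
    "eventually (\<lambda>t. sqrt (real t) > (\<bar>\<rho>\<bar> + 2) / m) sequentially"
    using sqrt_top[unfolded filterlim_at_top] sqrt_top[unfolded filterlim_at_top_dense] by blast+
  moreover have "eventually (\<lambda>t::nat. t \<ge> 1) sequentially" by (rule eventually_ge_at_top)
  ultimately have "eventually (\<lambda>t. P.prob {\<omega>\<in>space P. dist (scaled_error t \<omega>) (\<phi> (score t \<omega>)) > \<eta>} < \<epsilon>) sequentially"
  proof eventually_elim
    case (elim t)
    define k where "k = sqrt (real t)"
    have k: "k > 0" "k * k = real t" "k \<ge> r0" "\<bar>\<rho>\<bar> + 2 < m * k"
      using elim m(1) by (auto simp: k_def field_simps)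
    have small: "\<bar>(h /\<^sub>R k) $ i\<bar> < m" if "norm h \<le> \<bar>\<rho>\<bar> + 2" for h :: "real^'n" and i
    proof -
      have "\<bar>h $ i\<bar> < m * k" using component_le_norm_cart[of h i] that k(4) by linarith
      then show ?thesis using k(1) by (simp add: field_simps abs_mult)
    qed
    define S where "S = {h. \<beta> + inverse k *\<^sub>R h \<in> pacing_box}"
    define Bad where "Bad = {\<omega>\<in>space P. norm (score t \<omega>) > K} \<union>
      (\<Union>d\<in>E. ?dev t d)"
    have good: "dist (scaled_error t \<omega>) (\<phi> (score t \<omega>)) \<le> \<eta>" if \<omega>: "\<omega> \<in> space P" "\<omega> \<notin> Bad" for \<omega>
    proof -
      note obj = sample_objective[OF elim(4) \<omega>(1)]
      define Z where "Z h = real t * (sample_obj t \<omega> (\<beta> + inverse k *\<^sub>R h) - sample_obj t \<omega> \<beta>)" for h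
      have Z: "Z h = score t \<omega> \<bullet> h + k * (D \<bullet> h) + sample_remainder t h \<omega>" for h
        unfolding Z_def k_def by (rule local_objective_expansion[OF elim(4)])
      have Z_conv: "convex_on {h. \<beta> + inverse k *\<^sub>R h \<in> pos_orthant} Z"
      proof -
        have "convex_on {h. \<beta> + inverse k *\<^sub>R h \<in> pos_orthant}
            (\<lambda>h. real t * (sample_obj t \<omega> (\<beta> + inverse k *\<^sub>R h) + (- sample_obj t \<omega> \<beta>)))"
          using convex_on_affine[OF obj(2), of \<beta> "inverse k"]
          by (intro convex_on_cmul convex_on_add) (auto simp: convex_on_const dest: convex_on_imp_convex)
        then show ?thesis by (simp add: Z_def[abs_def])
      qed
      have "cball 0 (\<rho> + 2) \<subseteq> {h. \<beta> + inverse k *\<^sub>R h \<in> pos_orthant}"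
      proof (clarsimp simp: pos_orthant_def)
        fix h :: "real^'n" and i assume "norm h \<le> \<rho> + 2"
        then have "\<bar>(h /\<^sub>R k) $ i\<bar> < m" by (intro small) auto
        then show "0 < \<beta> $ i + inverse k * h $ i" using m(2)[of i] by (simp add: abs_less_iff)
      qed
      then have Z_cball: "convex_on (cball 0 (\<rho> + 2)) Z" by (intro convex_on_subset[OF Z_conv]) auto
      have lin: "convex_on (cball 0 (\<rho> + 2)) (\<lambda>h. - (score t \<omega> \<bullet> h + k * (D \<bullet> h)))"
      proof (rule convex_onI)
        show "- (score t \<omega> \<bullet> ((1 - s) *\<^sub>R x + s *\<^sub>R y) + k * (D \<bullet> ((1 - s) *\<^sub>R x + s *\<^sub>R y)))
          \<le> (1 - s) * - (score t \<omega> \<bullet> x + k * (D \<bullet> x)) + s * - (score t \<omega> \<bullet> y + k * (D \<bullet> y))" for s x y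
          by (simp add: inner_add_right algebra_simps)
      qed simp
      have "convex_on (cball 0 (\<rho> + 2)) (\<lambda>h. Z h + - (score t \<omega> \<bullet> h + k * (D \<bullet> h)))"
        by (rule convex_on_add[OF Z_cball lin])
      then have R_conv: "convex_on (cball 0 (\<rho> + 2)) (\<lambda>h. sample_remainder t h \<omega>)" by (simp add: Z)
      have R_close: "\<bar>sample_remainder t d \<omega> - q d\<bar> \<le> e'" if "d \<in> E" for d
        using that \<omega> by (auto simp: Bad_def not_less)
      have X: "scaled_error t \<omega> = k *\<^sub>R (sample_min t \<omega> - \<beta>)" by (simp add: scaled_error_def k_def)
      have "norm (scaled_error t \<omega> - \<phi> (score t \<omega>)) \<le> \<eta>"
      proof (rule stab[rule_format, where r = k and w = "score t \<omega>" and Z = Z and S = S], intro conjI ballI impI)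
        show "k \<ge> r0" by fact
        show "norm (score t \<omega>) \<le> K" using \<omega> by (auto simp: Bad_def)
        show "convex S"
          unfolding S_def by (rule convex_affine_vimage[OF convex_pacing_box])
        show "h $ i \<le> 0" if "h \<in> S" "i \<in> I \<union> J" for h i
        proof -
          have "\<beta> $ i = 1" using that(2) by (auto simp: I_def J_def)
          moreover have "\<beta> $ i + inverse k * h $ i \<le> 1" using that(1) by (simp add: S_def pacing_box_def)
          ultimately have "inverse k * h $ i \<le> 0" by simp
          then show ?thesis using k(1) by (simp add: mult_le_0_iff)
        qed
        show "C \<inter> cball 0 \<rho> \<subseteq> S"
          unfolding C[symmetric]
        proof
          fix h :: "real^'n" assume h: "h \<in> {h. (\<forall>i\<in>I. h $ i = 0) \<and> (\<forall>i\<in>J. h $ i \<le> 0)} \<inter> cball 0 \<rho>"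
          have "0 < \<beta> $ i + inverse k * h $ i \<and> \<beta> $ i + inverse k * h $ i \<le> 1" for i
          proof -
            have s: "\<bar>inverse k * h $ i\<bar> < m" using small[of h i] h by force
            then have "0 < \<beta> $ i + inverse k * h $ i" using m(2)[of i] by linarith
            moreover have "\<beta> $ i + inverse k * h $ i \<le> 1"
            proof (cases "i \<in> I \<or> i \<in> J")
              case True
              then have "h $ i \<le> 0" using h by auto
              then have "inverse k * h $ i \<le> 0" using k(1) by (simp add: mult_nonneg_nonpos)
              moreover have "\<beta> $ i \<le> 1" using box by (simp add: pacing_box_def)
              ultimately show ?thesis by linarith
            next
              case False
              then show ?thesis using m(3)[OF IJ[of i]] s by linarith
            qed
            ultimately show ?thesis by simp
          qed
          then show "h \<in> S" by (simp add: S_def pacing_box_def)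
        qed
        show "convex_on S Z"
          using pacing_box_subset \<open>convex S\<close> by (intro convex_on_subset[OF Z_conv]) (auto simp: S_def)
        show "\<bar>Z h - (quad_form A (score t \<omega>) h - k * (- D \<bullet> h))\<bar> \<le> e" if "norm h \<le> \<rho>" for h
          using unif[rule_format, of "\<lambda>h. sample_remainder t h \<omega>" h] R_conv R_close that by (simp add: Z quad_form_def q_def)
        show "is_min_on Z S (scaled_error t \<omega>)"
          unfolding is_min_on_def
        proof
          have unscale: "\<beta> + inverse k *\<^sub>R scaled_error t \<omega> = sample_min t \<omega>" using k(1) by (simp add: X)
          show "scaled_error t \<omega> \<in> S" using obj(1) by (simp add: S_def unscale is_min_on_def)
          show "\<forall>h\<in>S. Z (scaled_error t \<omega>) \<le> Z h"
            using obj(1) by (auto simp: Z_def unscale S_def is_min_on_def intro!: mult_left_mono)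
        qed
        show "is_min_on (quad_form A (score t \<omega>)) C (\<phi> (score t \<omega>))" by (rule \<phi>)
      qed
      then show ?thesis by (simp add: dist_norm)
    qed
    have Bad_meas: "Bad \<in> P.events" unfolding Bad_def using E by (intro sets.Un sets.finite_UN) auto
    have "P.prob {\<omega>\<in>space P. dist (scaled_error t \<omega>) (\<phi> (score t \<omega>)) > \<eta>} \<le> P.prob Bad"
      using good Bad_meas by (intro P.finite_measure_mono) (force simp: not_less[symmetric])+
    also have "\<dots> \<le> P.prob {\<omega>\<in>space P. norm (score t \<omega>) > K} +
        P.prob (\<Union>d\<in>E. ?dev t d)"
      unfolding Bad_def using E by (intro measure_Un_le sets.finite_UN) auto
    also have "P.prob (\<Union>d\<in>E. ?dev t d)
        \<le> (\<Sum>d\<in>E. P.prob (?dev t d))"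
      using E by (intro measure_UNION_le) auto
    finally show ?case using K[of t] elim(1) by linarith
  qed
  then show "\<exists>n0. \<forall>t\<ge>n0. norm (P.prob {\<omega>\<in>space P. dist (scaled_error t \<omega>) (\<phi> (score t \<omega>)) > \<eta>} - 0) < \<epsilon>"
    by (auto simp: eventually_sequentially)
qed

end

section \<open>The limit law\<close>

context pos_def_matrix
begin

lemma matrix_inv_right: "A *v (matrix_inv A *v w) = w"
proof -
  have "h = 0" if "A *v h = 0" for h
  proof -
    have "c * (norm h)\<^sup>2 \<le> 0" using coercive[of h] that by simp
    then show ?thesis using c_pos by (simp add: mult_le_0_iff)
  qed
  then have "invertible A" unfolding invertible_left_inverse matrix_left_invertible_ker by blast
  then have "\<exists>A'. A ** A' = mat 1 \<and> A' ** A = mat 1" by (simp add: invertible_def)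
  then have "A ** matrix_inv A = mat 1" unfolding matrix_inv_def by (metis (mono_tags, lifting) someI_ex)
  then show ?thesis by (simp add: matrix_vector_mul_assoc)
qed

text \<open>Completing the square: the metric projection of the statement and the quadratic program have the
  same minimizers.\<close>

lemma sq_norm_quad_form:
  "sq_norm A (h + matrix_inv A *v w) = 2 * quad_form A w h + w \<bullet> (matrix_inv A *v w)"
  using symmetric[of "matrix_inv A *v w" h] matrix_inv_right[of w]
  by (simp add: sq_norm_def quad_form_def matrix_vector_right_distrib inner_add_left inner_add_right inner_commute)

lemma projection_is_min_on:
  assumes "closed S" "S \<noteq> {}"
  shows "is_min_on (quad_form A w) S (arg_min_on (\<lambda>h. sq_norm A (h + matrix_inv A *v w)) S)"
proof -
  have iff: "is_min_on (\<lambda>h. sq_norm A (h + matrix_inv A *v w)) S x \<longleftrightarrow> is_min_on (quad_form A w) S x" for x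
    by (simp add: is_min_on_def sq_norm_quad_form)
  obtain x where "is_min_on (quad_form A w) S x" using quad_form_min_exists[OF assms, of w] by (rule exE)
  then have "is_min_on (\<lambda>h. sq_norm A (h + matrix_inv A *v w)) S x" by (simp only: iff)
  from is_min_on_arg_min_on[OF this] show ?thesis by (simp only: iff)
qed

end

text \<open>Positive definiteness comes from the barrier: the second difference of \<open>H\<close> is at
  least that of the logarithmic term. Points outside the box occur when \<open>\<beta>\<close> is on its boundary, so the midpoint
  inequality is needed on the whole orthant.\<close>

lemma (in smooth_pacing_market) second_order_coercive:
  assumes second: "\<And>h. ((\<lambda>s. (H (\<beta> + s *\<^sub>R h) - H \<beta> - s * (D \<bullet> h)) / s\<^sup>2) \<longlongrightarrow> (h \<bullet> (A *v h)) / 2) (at_right 0)"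
    and box: "\<beta> \<in> pacing_box"
  shows "limit.b_min * (norm h)\<^sup>2 \<le> h \<bullet> (A *v h)"
proof -
  have "((\<lambda>s. (H (\<beta> + s *\<^sub>R h) - H \<beta> - s * (D \<bullet> h)) / s\<^sup>2 + (H (\<beta> + s *\<^sub>R (- h)) - H \<beta> - s * (D \<bullet> (- h))) / s\<^sup>2)
      \<longlongrightarrow> (h \<bullet> (A *v h)) / 2 + ((- h) \<bullet> (A *v (- h))) / 2) (at_right 0)"
    by (intro tendsto_add second)
  moreover have "(h \<bullet> (A *v h)) / 2 + ((- h) \<bullet> (A *v (- h))) / 2 = h \<bullet> (A *v h)"
    using matrix_vector_mult_scaleR[of A "-1" h] by simp
  moreover have "(H (\<beta> + s *\<^sub>R h) - H \<beta> - s * (D \<bullet> h)) / s\<^sup>2 + (H (\<beta> + s *\<^sub>R (- h)) - H \<beta> - s * (D \<bullet> (- h))) / s\<^sup>2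
      = (H (\<beta> + s *\<^sub>R h) + H (\<beta> - s *\<^sub>R h) - 2 * H \<beta>) / s\<^sup>2" for s
    by (simp add: add_divide_distrib[symmetric])
  ultimately have lim: "((\<lambda>s. (H (\<beta> + s *\<^sub>R h) + H (\<beta> - s *\<^sub>R h) - 2 * H \<beta>) / s\<^sup>2) \<longlongrightarrow> h \<bullet> (A *v h)) (at_right 0)"
    by simp
  have ev: "eventually (\<lambda>s. \<beta> + s *\<^sub>R k \<in> pos_orthant) (at_right 0)" for k
  proof -
    have "((\<lambda>s. \<beta> + s *\<^sub>R k) \<longlongrightarrow> \<beta> + 0 *\<^sub>R k) (at_right 0)" by (intro tendsto_intros)
    then show ?thesis using open_pos_orthant \<beta>_pos by (intro topological_tendstoD) auto
  qed
  show ?thesis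
  proof (rule tendsto_lowerbound[OF lim])
    show "eventually (\<lambda>s. limit.b_min * (norm h)\<^sup>2 \<le> (H (\<beta> + s *\<^sub>R h) + H (\<beta> - s *\<^sub>R h) - 2 * H \<beta>) / s\<^sup>2) (at_right 0)"
      using ev[of h] ev[of "- h"] eventually_at_right_less[of 0]
    proof eventually_elim
      case (elim s)
      have "(norm h)\<^sup>2 = (\<Sum>i\<in>UNIV. (h $ i)\<^sup>2)"
        unfolding power2_norm_eq_inner by (simp add: inner_vec_def power2_eq_square)
      then have "limit.b_min * (norm h)\<^sup>2 * s\<^sup>2 = (\<Sum>i\<in>UNIV. limit.b_min * (s * h $ i)\<^sup>2)"
        by (simp add: sum_distrib_left sum_distrib_right power_mult_distrib mult_ac)
      also have "\<dots> \<le> (\<Sum>i\<in>UNIV. b i * (((\<beta> + s *\<^sub>R h) $ i - (\<beta> - s *\<^sub>R h) $ i)\<^sup>2 / ((\<beta> + s *\<^sub>R h) $ i + (\<beta> - s *\<^sub>R h) $ i)\<^sup>2))"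
      proof (rule sum_mono)
        fix i
        have \<beta>i: "0 < \<beta> $ i" "\<beta> $ i \<le> 1" using box by (auto simp: pacing_box_def)
        then have "(\<beta> $ i)\<^sup>2 \<le> 1" by (simp add: power_le_one)
        then have "(s * h $ i)\<^sup>2 \<le> (s * h $ i)\<^sup>2 / (\<beta> $ i)\<^sup>2"
          using \<beta>i by (simp add: le_divide_eq mult_left_le)
        then have "limit.b_min * (s * h $ i)\<^sup>2 \<le> b i * ((s * h $ i)\<^sup>2 / (\<beta> $ i)\<^sup>2)"
          using limit.b_min(1) limit.b_min(2)[of i] by (intro mult_mono) auto
        also have "(s * h $ i)\<^sup>2 / (\<beta> $ i)\<^sup>2 = (2 * (s * h $ i))\<^sup>2 / (2 * \<beta> $ i)\<^sup>2"
          by (simp add: power_mult_distrib)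
        finally show "limit.b_min * (s * h $ i)\<^sup>2 \<le>
            b i * (((\<beta> + s *\<^sub>R h) $ i - (\<beta> - s *\<^sub>R h) $ i)\<^sup>2 / ((\<beta> + s *\<^sub>R h) $ i + (\<beta> - s *\<^sub>R h) $ i)\<^sup>2)"
          by simp
      qed
      also have "\<dots> \<le> H (\<beta> + s *\<^sub>R h) + H (\<beta> - s *\<^sub>R h) - 2 * H ((1/2) *\<^sub>R ((\<beta> + s *\<^sub>R h) + (\<beta> - s *\<^sub>R h)))"
        using limit.obj_midpoint[of "\<beta> + s *\<^sub>R h" "\<beta> - s *\<^sub>R h"] elim unfolding H_obj by simp
      also have "(1/2) *\<^sub>R ((\<beta> + s *\<^sub>R h) + (\<beta> - s *\<^sub>R h)) = \<beta>" by (simp add: scaleR_2[symmetric])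
      finally show ?case using elim by (simp add: le_divide_eq)
    qed
  qed simp
qed

lemma (in pacing_sample) score_var_covariance:
  "score_var a = a \<bullet> ((\<chi> i j. expectation (\<lambda>x. (g x $ i - D $ i) * (g x $ j - D $ j))) *v a)"
proof -
  obtain C where C: "\<And>x. x \<in> space N \<Longrightarrow> norm (g x) \<le> C" using g_bounded by blast
  have bd: "\<bar>g x $ i - D $ i\<bar> \<le> C + norm D" if "x \<in> space N" for x i
    using component_le_norm_cart[of "g x - D" i] norm_triangle_ineq4[of "g x" D] C[OF that] by simp
  have int: "integrable N (\<lambda>x. (g x $ i - D $ i) * (g x $ j - D $ j))" for i j
  proof (rule integrable_const_bound[of _ "(C + norm D) * (C + norm D)"])
    have "\<bar>g x $ i - D $ i\<bar> * \<bar>g x $ j - D $ j\<bar> \<le> (C + norm D) * (C + norm D)" if "x \<in> space N" for x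
      using bd[OF that, of i] bd[OF that, of j] by (intro mult_mono) auto
    then show "AE x in N. norm ((g x $ i - D $ i) * (g x $ j - D $ j)) \<le> (C + norm D) * (C + norm D)"
      by (intro AE_I2) (simp add: abs_mult)
  qed measurable
  have "(a \<bullet> g x - a \<bullet> D)\<^sup>2 = (\<Sum>i\<in>UNIV. \<Sum>j\<in>UNIV. a $ i * a $ j * ((g x $ i - D $ i) * (g x $ j - D $ j)))" for x
  proof -
    have "a \<bullet> g x - a \<bullet> D = (\<Sum>i\<in>UNIV. a $ i * (g x $ i - D $ i))"
      by (simp add: inner_vec_def sum_subtractf right_diff_distrib)
    then show ?thesis by (simp add: power2_eq_square sum_product mult_ac)
  qed
  then have "score_var a = (\<Sum>i\<in>UNIV. \<Sum>j\<in>UNIV. a $ i * a $ j * expectation (\<lambda>x. (g x $ i - D $ i) * (g x $ j - D $ j)))"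
    unfolding score_var_def using int by simp
  then show ?thesis
    by (simp add: inner_vec_def matrix_vector_mult_def sum_distrib_left mult_ac)
qed

theorem mainTheorem1:
  fixes M :: "'a measure" and s :: "'a \<Rightarrow> real"
    and b :: "'n::finite \<Rightarrow> real" and v :: "'n \<Rightarrow> 'a \<Rightarrow> real"
    and P :: "'w measure" and \<theta> :: "nat \<Rightarrow> 'w \<Rightarrow> 'a"
    and Q :: "'g measure" and G :: "'g \<Rightarrow> real^'n"
  assumes budgets: "\<And>i. b i > 0"
    and v_nonneg: "\<And>i x. x \<in> space M \<Longrightarrow> v i x \<ge> 0"
    and v_integrable: "\<And>i. integrable M (v i)"
    and v_bounded: "\<And>i. bdd_above (v i ` space M)"
    and s_nonneg: "\<And>x. x \<in> space M \<Longrightarrow> s x \<ge> 0"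
    and s_bounded: "bdd_above (s ` space M)"
    and s_integrable: "integrable M s"
    and s_total: "(\<integral>x. s x \<partial>M) = 1"
    and P_prob: "prob_space P"
    and draws_indep: "prob_space.indep_vars P (\<lambda>_. M) \<theta> {1..}"
    and draws_density: "\<And>\<tau>. \<tau> \<ge> 1 \<Longrightarrow> distributed P M (\<theta> \<tau>) (\<lambda>x. ennreal (s x))"
    and H_C2: "\<exists>U. beta_star M s b v \<in> U \<and> C2_on (pacing_H M s b v) U"
    and G_normal: "normal_vector Q G 0
      (supply_Cov M s (\<lambda>x. grad (pacing_F b v x) (beta_star M s b v)))"
  shows "conv_in_distribution P
    (\<lambda>t \<omega>. sqrt (real t) *\<^sub>R (beta_sample b v (\<lambda>\<tau>. \<theta> \<tau> \<omega>) t - beta_star M s b v))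
    Q (\<lambda>\<omega>. limit_map M s b v (G \<omega>))"
proof -
  interpret P: prob_space P by (rule P_prob)
  have s_meas [measurable]: "s \<in> borel_measurable M" using s_integrable by auto
  have v_meas: "v i \<in> borel_measurable M" for i using v_integrable[of i] by auto
  define N where "N = density M (\<lambda>x. ennreal (s x))"
  have sets_N [measurable_cong]: "sets N = sets M" and space_N: "space N = space M" by (simp_all add: N_def)
  have law: "distr P M (\<theta> \<tau>) = N" if "\<tau> \<ge> 1" for \<tau>
    using distributed_distr_eq_density[OF draws_density[OF that]] by (simp add: N_def)
  have E_N: "supply_E M s f = (\<integral>x. f x \<partial>N)" if "f \<in> borel_measurable M" for f
    unfolding supply_E_def N_def using integral_density[OF that s_meas AE_I2[OF s_nonneg]] by (simp add: mult.commute)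

  obtain B where B: "\<And>i x. x \<in> space M \<Longrightarrow> v i x \<le> B"
  proof -
    have "\<forall>i. \<exists>B. \<forall>x\<in>space M. v i x \<le> B" using v_bounded by (auto simp: bdd_above_def)
    then obtain B where B: "\<And>i x. x \<in> space M \<Longrightarrow> v i x \<le> B i" by metis
    have "v i x \<le> Max (range B)" if "x \<in> space M" for i x
      by (rule order_trans[OF B[OF that]]) (rule Max_ge, auto)
    then show ?thesis by (rule that)
  qed
  have "prob_space (distr P M (\<theta> 1))"
    using draws_indep unfolding P.indep_vars_def2 by (intro P.prob_space_distr) simp
  then have "prob_space N" using law[of 1] by simp
  then interpret mkt: pacing_market N b v B
    using budgets v_meas v_nonneg B
    by (intro pacing_market.intro pacing_market_axioms.intro)
      (auto simp: space_N measurable_cong_sets[OF sets_N refl])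
  have H: "pacing_H M s b v = mkt.H"
    by (rule ext) (simp add: pacing_H_def mkt.H_def E_N measurable_pacing_F[OF v_meas])

  define \<beta> where "\<beta> = beta_star M s b v"
  obtain \<beta>0 where "is_min_on mkt.H pacing_box \<beta>0"
    using mkt.limit.obj_min_exists unfolding mkt.H_obj by (rule exE)
  from is_min_on_arg_min_on[OF this] have min: "is_min_on mkt.H pacing_box \<beta>"
    by (simp only: \<beta>_def beta_star_def H)
  then have box: "\<beta> \<in> pacing_box" by (simp add: is_min_on_def)
  then have pos: "\<beta> \<in> pos_orthant" using pacing_box_subset by blast
  obtain U g Af where U: "open U" "\<beta> \<in> U"
    and g: "\<And>x. x \<in> U \<Longrightarrow> GDERIV mkt.H x :> g x"
    and Af: "\<And>x. x \<in> U \<Longrightarrow> (g has_derivative (\<lambda>h. Af x *v h)) (at x)"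
    using H_C2 unfolding C2_on_def H \<beta>_def by blast
  define D where "D = g \<beta>"
  define A where "A = Af \<beta>"
  have D: "GDERIV mkt.H \<beta> :> D" unfolding D_def by (rule g[OF U(2)])
  have A: "(g has_derivative (\<lambda>h. A *v h)) (at \<beta>)" unfolding A_def by (rule Af[OF U(2)])

  interpret smp: pacing_sample N b v B \<beta> D P \<theta>
  proof
    show "\<beta> \<in> pos_orthant" "GDERIV mkt.H \<beta> :> D" by fact+
    show "P.indep_vars (\<lambda>_. N) \<theta> {1..}"
      using draws_indep unfolding P.indep_vars_def2 by (simp add: sets_N measurable_cong_sets[OF refl sets_N])
    show "distr P N (\<theta> \<tau>) = N" if "\<tau> \<ge> 1" for \<tau>
      using law[OF that] distr_cong[OF refl sets_N, of P "\<theta> \<tau>" "\<theta> \<tau>"] by simp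
  qed

  have second: "((\<lambda>s. (mkt.H (\<beta> + s *\<^sub>R h) - mkt.H \<beta> - s * (D \<bullet> h)) / s\<^sup>2) \<longlongrightarrow> (h \<bullet> (A *v h)) / 2) (at_right 0)" for h
    unfolding D_def by (rule second_order_expansion[OF U g A])
  interpret A: pos_def_matrix A "mkt.limit.b_min"
    using hessian_symmetric[OF U g A] mkt.limit.b_min(1) smp.second_order_coercive[OF second box]
    by unfold_locales auto

  define C where "C = {h::real^'n. (\<forall>i\<in>{i. \<beta> $ i = 1 \<and> D $ i < 0}. h $ i = 0) \<and>
    (\<forall>i\<in>{i. \<beta> $ i = 1 \<and> D $ i = 0}. h $ i \<le> 0)}"
  have "limit_hessian M s b v = A"
    unfolding limit_hessian_def H \<beta>_def[symmetric] by (rule hessian_eq[OF U g A])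
  moreover have "leftover M s b v = - D"
    unfolding leftover_def H \<beta>_def[symmetric] by (simp add: grad_eq[OF D])
  ultimately have limit_map: "limit_map M s b v w = arg_min_on (\<lambda>h. sq_norm A (h + matrix_inv A *v w)) C" for w
    unfolding limit_map_def I_pos_def I_zero_def C_def \<beta>_def[symmetric] by simp
  have C: "convex C" "closed C" "C \<noteq> {}"
  proof -
    show "convex C" unfolding C_def convex_def by (auto intro!: add_nonpos_nonpos mult_nonneg_nonpos)
    have "C = (\<Inter>i\<in>{i. \<beta> $ i = 1 \<and> D $ i < 0}. {h. h $ i = 0}) \<inter> (\<Inter>i\<in>{i. \<beta> $ i = 1 \<and> D $ i = 0}. {h. h $ i \<le> 0})"
      by (auto simp: C_def)
    also have "closed \<dots>"
      by (intro closed_Int closed_INT ballI closed_Collect_eq closed_Collect_le continuous_intros)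
    finally show "closed C" .
    have "0 \<in> C" by (simp add: C_def)
    then show "C \<noteq> {}" by blast
  qed
  have \<phi>: "is_min_on (quad_form A w) C (limit_map M s b v w)" for w
    unfolding limit_map by (rule A.projection_is_min_on[OF C(2,3)])
  have \<phi>_cont: "continuous_on UNIV (limit_map M s b v)"
  proof (rule continuous_onI)
    fix w :: "real^'n" and e :: real assume e: "e > 0"
    have "dist (limit_map M s b v w') (limit_map M s b v w) \<le> e" if "dist w' w < e * mkt.limit.b_min" for w'
    proof -
      have "norm (limit_map M s b v w' - limit_map M s b v w) \<le> norm (w' - w) / mkt.limit.b_min"
        by (rule A.quad_form_min_lipschitz[OF C(1) \<phi> \<phi>])
      also have "\<dots> \<le> e" using that A.c_pos by (simp add: dist_norm divide_le_eq)
      finally show ?thesis by (simp add: dist_norm)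
    qed
    then show "\<exists>d>0. \<forall>x'\<in>UNIV. dist x' w < d \<longrightarrow> dist (limit_map M s b v x') (limit_map M s b v w) \<le> e"
      using e A.c_pos by (intro exI[of _ "e * mkt.limit.b_min"]) auto
  qed

  have Q: "prob_space Q" and G_meas: "G \<in> borel_measurable Q"
    using G_normal by (auto simp: normal_vector_def)
  have cov: "supply_Cov M s smp.g = (\<chi> i j. mkt.expectation (\<lambda>x. (smp.g x $ i - D $ i) * (smp.g x $ j - D $ j)))"
  proof -
    have gM [measurable]: "smp.g \<in> borel_measurable M"
      using smp.measurable_g by (simp add: measurable_cong_sets[OF sets_N refl])
    have "supply_E M s (\<lambda>x. smp.g x $ i) = D $ i" for i
      using smp.expectation_inner_g[of "axis i 1"] by (simp add: E_N inner_axis')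
    then show ?thesis unfolding supply_Cov_def by (simp add: E_N)
  qed
  have G_law: "distr Q borel (\<lambda>\<omega>. a \<bullet> G \<omega>) = normal_law 0 (smp.score_var a)" for a
    using G_normal smp.score_var_covariance[of a] unfolding normal_vector_def \<beta>_def[symmetric] smp.g_def[abs_def, symmetric] cov
    by simp
  have conv: "conv_in_distribution P smp.score Q G"
  proof (rule conv_in_distribution_char[OF P_prob Q smp.measurable_score G_meas smp.score_tight])
    fix a
    have "(\<integral>\<omega>. cis (a \<bullet> G \<omega>) \<partial>Q) = exp (- smp.score_var a / 2)"
      using G_meas by (intro prob_space.char_normal_law[OF Q _ smp.score_var_nonneg G_law]) measurable
    then show "(\<lambda>t. P.expectation (\<lambda>\<omega>. cis (a \<bullet> smp.score t \<omega>))) \<longlonglongrightarrow> (\<integral>\<omega>. cis (a \<bullet> G \<omega>) \<partial>Q)"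
      using smp.score_char[of a] by simp
  qed
  have "conv_in_distribution P smp.scaled_error Q (\<lambda>\<omega>. limit_map M s b v (G \<omega>))"
  proof (rule conv_in_distribution_transfer[OF P_prob conv smp.score_tight smp.measurable_scaled_error \<phi>_cont])
    fix \<eta> :: real assume "\<eta> > 0"
    then show "(\<lambda>t. P.prob {\<omega> \<in> space P. \<eta> < dist (smp.scaled_error t \<omega>) (limit_map M s b v (smp.score t \<omega>))}) \<longlonglongrightarrow> 0"
      by (intro smp.scaled_error_close_to_quadratic_min[OF min A.pos_def_matrix_axioms second]
          borel_measurable_continuous_onI[OF \<phi>_cont] \<phi>[unfolded C_def])
  qed
  then show ?thesis by (simp only: smp.scaled_error_def[abs_def]) (simp only: \<beta>_def)
qed

end
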